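(* Let $X_1,\dots,X_n$ be i.i.d. with density $f(x;\theta_0)$ belonging to a full-rank exponential family $f(x;\theta)=\exp\{\theta^{\mathsf T}b(x)-A(\theta)\}$, $\theta\in\Theta\subseteq\mathbb R^p$. Suppose that (A.1) $q_n>0$ is a sequence with $q_n\to1$ as $n\to\infty$, and (A.2) $\Theta$ is compact and $\theta_0$ is an interior point of $\Theta$. Let $\widetilde\theta_n$ be the maximum L$q$-likelihood estimator of $\theta_0$ with distortion parameter $q=q_n$, and let $\theta_n^*=\theta_0/q_n$. Then $$\sqrt n\,V_n^{-1/2}(\widetilde\theta_n-\theta_n^* )\xrightarrow{\ \mathscr D\ }N_p(0,\mathbf I_p)\qquad\text{as }n\to\infty,$$ where $\mathbf I_p$ is the $p\times p$ identity matrix, $V_n=J_n^{-1}K_nJ_n^{-1}$ and $$K_n=E_{\theta_0}\big[U^*(X;\theta_n^*,q_n)\big]^{\mathsf T}\big[U^*(X;\theta_n^*,q_n)\big],\qquad J_n=E_{\theta_0}\big[\nabla_\theta U^*(X;\theta_n^*,q_n)\big].$$ Moreover, a necessary and sufficient condition for asymptotic normality of $\widetilde\theta_n$ around $\theta_0$, i.e. for $\sqrt n\,V_n^{-1/2}(\widetilde\theta_n-\theta_0)\xrightarrow{\mathscr D}N_p(0,\mathbf I_p)$, is $\sqrt n\,(q_n-1)\to0$.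
   Context: Exponential family: $\mu$ is a $\sigma$-finite measure on a measurable space $(\Omega,\mathscr F)$, $b(x)=(b_1(x),\dots,b_p(x))^{\mathsf T}$ is a vector of real measurable functions, $A(\theta)=\log\int_\Omega e^{\theta^{\mathsf T}b(x)}\,d\mu(x)$ (finite on $\Theta$), and $f(\cdot;\theta)$ is a density with respect to $\mu$. The family is of full rank (the functions $b_1,\dots,b_p$ satisfy no nontrivial affine relation $\mu$-almost everywhere). $E_{\theta_0}$ denotes expectation when $X$ has density $f(\cdot;\theta_0)$. For $u>0$, $L_q(u)=\log u$ if $q=1$ and $L_q(u)=(u^{1-q}-1)/(1-q)$ if $q\neq1$ ($q>0$). The maximum L$q$-likelihood estimator (ML$q$E) is $\widetilde\theta_n=\arg\max_{\theta\in\Theta}\sum_{i=1}^nL_{q_n}[f(X_i;\theta)]$. Define the score $U(x;\theta)=\nabla_\theta\log f(x;\theta)$ (viewed as a $1\times p$ row vector, so that $U^{\mathsf T}U$ is $p\times p$) and the modified score $U^*(x;\theta,q)=U(x;\theta)f(x;\theta)^{1-q}$; $\nabla_\theta U^*$ is its $p\times p$ matrix of first partial derivatives, and $\nabla_\theta U^*(X;\theta_n^*,q_n)$ means this matrix evaluated at $\theta=\theta_n^*$. The point $\theta_n^*=\theta_0/q_n$ is the "surrogate parameter", the value satisfying $E_{\theta_0}U^*(X;\theta_n^*,q_n)=0$. $V_n^{-1/2}$ is the inverse of the symmetric positive definite square root of $V_n$ (defined for $n$ large).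
   Formalization: Necessity of √n(q_n−1)→0 is stated only for θ_0≠0: if θ_0=0 then θ_n^*=θ_0 for every n, so normality around θ_0 holds for every q_n→1 and necessity fails; the first claim and sufficiency are kept for all θ_0. *)

theory Defs
  imports "HOL-Probability.Probability"
begin

section \<open>Exponential families\<close>

definition log_partition :: "'x measure \<Rightarrow> ('x \<Rightarrow> real^'p) \<Rightarrow> real^'p \<Rightarrow> real" where
  "log_partition \<mu> b \<theta> = ln (\<integral>x. exp (\<theta> \<bullet> b x) \<partial>\<mu>)"

definition expfam_density :: "'x measure \<Rightarrow> ('x \<Rightarrow> real^'p) \<Rightarrow> 'x \<Rightarrow> real^'p \<Rightarrow> real" where
  "expfam_density \<mu> b x \<theta> = exp (\<theta> \<bullet> b x - log_partition \<mu> b \<theta>)"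

text \<open>The integrability condition says that the log-partition function is finite on the
  parameter set. The Bochner integral is 0 for a non-integrable function, so
  \<^term>\<open>log_partition\<close> is only meaningful under it.\<close>

definition exponential_family ::
  "'x measure \<Rightarrow> ('x \<Rightarrow> real^'p) \<Rightarrow> (real^'p) set \<Rightarrow> bool" where
  "exponential_family \<mu> b \<Theta> \<longleftrightarrow>
     sigma_finite_measure \<mu> \<and> b \<in> borel_measurable \<mu> \<and>
     (\<forall>\<theta>\<in>\<Theta>. integrable \<mu> (\<lambda>x. exp (\<theta> \<bullet> b x)))"

text \<open>No nontrivial affine relation; this also excludes the null measure.\<close>

definition full_rank :: "'x measure \<Rightarrow> ('x \<Rightarrow> real^'p) \<Rightarrow> bool" where
  "full_rank \<mu> b \<longleftrightarrow>
     (\<forall>a c. (AE x in \<mu>. a \<bullet> b x + c = 0) \<longrightarrow> a = 0 \<and> c = 0)"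

section \<open>Maximum Lq-likelihood\<close>

definition Lq :: "real \<Rightarrow> real \<Rightarrow> real" where
  "Lq q u = (if q = 1 then ln u else (u powr (1 - q) - 1) / (1 - q))"

text \<open>The maximiser need not be unique when \<open>q \<noteq> 1\<close>, so the estimator is described by the
  property of being a maximiser.\<close>

definition is_MLqE ::
  "('x \<Rightarrow> 't \<Rightarrow> real) \<Rightarrow> 't set \<Rightarrow> real \<Rightarrow> nat \<Rightarrow> (nat \<Rightarrow> 'x) \<Rightarrow> 't \<Rightarrow> bool" where
  "is_MLqE f \<Theta> q n xs t \<longleftrightarrow>
     is_arg_max (\<lambda>\<theta>. \<Sum>i<n. Lq q (f (xs i) \<theta>)) (\<lambda>\<theta>. \<theta> \<in> \<Theta>) t"

definition gradient :: "('a::real_inner \<Rightarrow> real) \<Rightarrow> 'a \<Rightarrow> 'a" where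
  "gradient g x = (THE D. GDERIV g x :> D)"

definition score :: "('x \<Rightarrow> real^'p \<Rightarrow> real) \<Rightarrow> 'x \<Rightarrow> real^'p \<Rightarrow> real^'p" where
  "score f x \<theta> = gradient (\<lambda>t. ln (f x t)) \<theta>"

definition mod_score ::
  "('x \<Rightarrow> real^'p \<Rightarrow> real) \<Rightarrow> 'x \<Rightarrow> real^'p \<Rightarrow> real \<Rightarrow> real^'p" where
  "mod_score f x \<theta> q = (f x \<theta> powr (1 - q)) *\<^sub>R score f x \<theta>"

text \<open>\<open>outer u v\<close> is \<open>u\<^sup>T v\<close> for row vectors \<open>u\<close> and \<open>v\<close>.\<close>

definition outer :: "real^'p \<Rightarrow> real^'p \<Rightarrow> real^'p^'p" where
  "outer u v = (\<chi> i j. u $ i * v $ j)"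

text \<open>In \<open>K_mat\<close>, \<open>J_mat\<close> and \<open>V_mat\<close>, the expectation is under the density \<open>f(\<cdot>; \<theta>0)\<close> with
  respect to \<open>\<mu>\<close>, and the (modified) score is evaluated at \<open>t\<close>.\<close>

definition K_mat ::
  "'x measure \<Rightarrow> ('x \<Rightarrow> real^'p \<Rightarrow> real) \<Rightarrow> real^'p \<Rightarrow> real^'p \<Rightarrow> real \<Rightarrow> real^'p^'p" where
  "K_mat \<mu> f \<theta>0 t q =
     (\<integral>x. outer (mod_score f x t q) (mod_score f x t q) \<partial>density \<mu> (\<lambda>x. ennreal (f x \<theta>0)))"

definition J_mat ::
  "'x measure \<Rightarrow> ('x \<Rightarrow> real^'p \<Rightarrow> real) \<Rightarrow> real^'p \<Rightarrow> real^'p \<Rightarrow> real \<Rightarrow> real^'p^'p" where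
  "J_mat \<mu> f \<theta>0 t q =
     (\<integral>x. jacobian (\<lambda>\<theta>. mod_score f x \<theta> q) (at t) \<partial>density \<mu> (\<lambda>x. ennreal (f x \<theta>0)))"

definition V_mat ::
  "'x measure \<Rightarrow> ('x \<Rightarrow> real^'p \<Rightarrow> real) \<Rightarrow> real^'p \<Rightarrow> real^'p \<Rightarrow> real \<Rightarrow> real^'p^'p" where
  "V_mat \<mu> f \<theta>0 t q =
     matrix_inv (J_mat \<mu> f \<theta>0 t q) ** K_mat \<mu> f \<theta>0 t q ** matrix_inv (J_mat \<mu> f \<theta>0 t q)"

definition sym_pos_def :: "real^'p^'p \<Rightarrow> bool" where
  "sym_pos_def S \<longleftrightarrow> transpose S = S \<and> (\<forall>x. x \<noteq> 0 \<longrightarrow> x \<bullet> (S *v x) > 0)"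

definition spd_sqrt :: "real^'p^'p \<Rightarrow> real^'p^'p" where
  "spd_sqrt V = (THE S. sym_pos_def S \<and> S ** S = V)"

section \<open>Convergence in distribution\<close>

text \<open>The library's \<^term>\<open>weak_conv_m\<close> is restricted to measures on the real line.\<close>

definition conv_in_distribution ::
  "'w measure \<Rightarrow> (nat \<Rightarrow> 'w \<Rightarrow> 'a::topological_space) \<Rightarrow> 'a measure \<Rightarrow> bool" where
  "conv_in_distribution M Y N \<longleftrightarrow>
     (\<forall>g :: 'a \<Rightarrow> real. continuous_on UNIV g \<and> bounded (range g) \<longrightarrow>
        (\<lambda>n. \<integral>y. g y \<partial>distr M borel (Y n)) \<longlonglongrightarrow> (\<integral>y. g y \<partial>N))"

definition std_normal_vec :: "(real^'p) measure" where
  "std_normal_vec =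
     density lborel (\<lambda>z. ennreal (exp (- (norm z)\<^sup>2 / 2) / sqrt (2 * pi) ^ CARD('p)))"

end

theory Submission
  imports Defs
begin

text \<open>Write \<open>r = 1 - q\<close> and let \<open>\<psi>\<^sub>n\<close> be the empirical cumulant generating function of
  \<open>b(X\<^sub>i)\<close>. Because \<open>f\<close> is an exponential family, maximising the \<open>Lq\<close>-likelihood is the same as
  maximising \<open>\<psi>\<^sub>n(r \<theta>) / r - A(\<theta>)\<close>, which is uniformly close to the log-likelihood
  \<open>\<theta> \<bullet> mean b - A(\<theta>)\<close> since \<open>r \<rightarrow> 0\<close>; strict convexity of \<open>A\<close> gives consistency. The first order
  condition reads \<open>mean ((b - \<nabla>A(\<theta>)) exp (r \<theta> \<bullet> b)) = 0\<close>, and its population version is solved by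
  \<open>\<theta>\<^sub>0 / q\<close>. Its expansion there shows that \<open>\<surd>n (T\<^sub>n - \<theta>\<^sub>0 / q\<^sub>n)\<close> differs from
  \<open>\<Sigma>\<inverse> \<surd>n (mean b - E b)\<close>, with \<open>\<Sigma>\<close> the covariance of \<open>b(X)\<close>, by a term tending to \<open>0\<close> in
  probability. Since \<open>K\<^sub>n \<rightarrow> \<Sigma>\<close> and \<open>J\<^sub>n \<rightarrow> -\<Sigma>\<close>, also \<open>V\<^sub>n \<rightarrow> \<Sigma>\<inverse>\<close>, so the one-dimensional central
  limit theorem gives pointwise convergence of the characteristic functions. Recentring at \<open>\<theta>\<^sub>0\<close>
  adds a deterministic shift, which must vanish because the Gaussian characteristic function has
  no zeros.\<close>

section \<open>Square roots of positive definite matrices\<close>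

text \<open>Integrals are taken under the law \<open>P\<close> of one observation at
  \<open>\<theta>0\<close>, with \<open>c = b - E b\<close>: the family is then a tilt of
  \<open>P\<close> by \<open>exp ((\<theta> - \<theta>0) \<bullet> c)\<close>, and an interior
  \<open>\<theta>0\<close> gives \<open>c\<close> exponential moments on a ball. These justify
  differentiation under the integral and every domination; the weights
  \<open>exp (r * (\<theta> \<bullet> c))\<close> are controlled because \<open>r * \<theta>\<close>
  eventually lies in that ball. The surrogate solves the population equation because
  \<open>(1 - q) * (\<theta>0 / q) = \<theta>0 / q - \<theta>0\<close>: the weight at
  \<open>\<theta>0 / q\<close> is exactly the tilt from \<open>\<theta>0\<close> to
  \<open>\<theta>0 / q\<close>, under which the score there has mean zero. The obstacle is that the
  maximiser comes without a rate. The expansion leaves an error that is small only relative to the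
  unknown \<open>T - \<theta>0 / q\<close>; invertibility of \<open>\<Sigma>\<close> trades it for
  one relative to the estimating function at the surrogate, which is tight after scaling. As the
  standardising matrix varies with \<open>n\<close>, inversion and the square root must be shown
  continuous.\<close>

lemma norm_matrix_vector_mult_le:
  fixes A :: "real^'n^'m"
  shows "norm (A *v x) \<le> norm A * norm x"
proof -
  have "norm (A *v x) \<le> L2_set (\<lambda>i. norm (A $ i) * norm x) UNIV"
    unfolding norm_vec_def[of "A *v x"]
    by (intro L2_set_mono) (auto simp: matrix_vector_mul_component Cauchy_Schwarz_ineq2)
  also have "\<dots> = norm A * norm x"
    by (simp add: L2_set_left_distrib norm_vec_def[of A])
  finally show ?thesis .
qed

section \<open>Continuity of matrix products and inverses\<close>

lemma tendsto_matrix_vector_mult: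
  fixes A :: "'a \<Rightarrow> real^'n^'m"
  assumes "(A \<longlongrightarrow> B) F" "(x \<longlongrightarrow> y) F"
  shows "((\<lambda>n. A n *v x n) \<longlongrightarrow> B *v y) F"
  unfolding matrix_vector_mult_def using assms by (auto intro!: tendsto_intros)

lemma tendsto_matrix_mult:
  fixes A :: "'a \<Rightarrow> real^'n^'m" and C :: "'a \<Rightarrow> real^'k^'n"
  assumes "(A \<longlongrightarrow> B) F" "(C \<longlongrightarrow> D) F"
  shows "((\<lambda>n. A n ** C n) \<longlongrightarrow> B ** D) F"
  unfolding matrix_matrix_mult_def using assms by (auto intro!: tendsto_intros)

lemma tendsto_matrixI:
  fixes A :: "'a \<Rightarrow> real^'n^'m"
  assumes "\<And>y. ((\<lambda>n. A n *v y) \<longlongrightarrow> B *v y) F"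
  shows "(A \<longlongrightarrow> B) F"
proof (intro vec_tendstoI)
  fix i j
  have "((\<lambda>n. (A n *v axis j 1) $ i) \<longlongrightarrow> (B *v axis j 1) $ i) F"
    by (intro tendsto_vec_nth assms)
  then show "((\<lambda>n. A n $ i $ j) \<longlongrightarrow> B $ i $ j) F"
    by (simp add: matrix_vector_mul_component inner_axis)
qed

lemma matrix_inv_mult_vector:
  fixes A :: "real^'n^'n"
  assumes "invertible A"
  shows "matrix_inv A *v (A *v x) = x" "A *v (matrix_inv A *v x) = x"
proof -
  have "A ** matrix_inv A = mat 1 \<and> matrix_inv A ** A = mat 1"
    using assms unfolding invertible_def matrix_inv_def by (rule someI_ex)
  then show "matrix_inv A *v (A *v x) = x" "A *v (matrix_inv A *v x) = x"
    by (simp_all add: matrix_vector_mul_assoc)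
qed

lemma matrix_inv_bounded_below:
  fixes A :: "real^'n^'n"
  assumes "invertible A"
  shows "norm x \<le> norm (matrix_inv A) * norm (A *v x)"
  by (metis assms matrix_inv_mult_vector(1) norm_matrix_vector_mult_le)

lemma invertible_if_bounded_below:
  fixes A :: "real^'n^'n"
  assumes "\<And>x. norm x \<le> K * norm (A *v x)"
  shows "invertible A"
proof -
  have "x = 0" if "A *v x = 0" for x
    using assms[of x] that by simp
  then show ?thesis
    by (simp add: invertible_left_inverse matrix_left_invertible_ker)
qed

text \<open>The bound \<open>norm x \<le> K * norm (B *v x)\<close> survives a perturbation of size
  \<open>1 / (2 * K)\<close> with \<open>K\<close> doubled, which gives invertibility nearby. The
  doubled bound applied to \<open>A^-1 - B^-1 = A^-1 (B - A) B^-1\<close> gives the limit.\<close>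

lemma
  fixes A :: "'a \<Rightarrow> real^'n^'n"
  assumes lim: "(A \<longlongrightarrow> B) F" and inv: "invertible B"
  shows eventually_invertible: "\<forall>\<^sub>F n in F. invertible (A n)"
    and tendsto_matrix_inv: "((\<lambda>n. matrix_inv (A n)) \<longlongrightarrow> matrix_inv B) F"
proof -
  define K where "K = norm (matrix_inv B) + 1"
  have K: "K > 0" unfolding K_def by (smt (verit) norm_ge_zero)
  have "\<forall>\<^sub>F n in F. dist (A n) B < 1 / (2 * K)"
    using lim K by (intro tendstoD) auto
  then have bd: "\<forall>\<^sub>F n in F. \<forall>x. norm x \<le> 2 * K * norm (A n *v x)"
  proof eventually_elim
    case (elim n)
    show ?case
    proof
      fix x
      have "norm x \<le> K * norm (B *v x)"
        using matrix_inv_bounded_below[OF inv, of x] unfolding K_def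
        by (smt (verit) mult_right_mono norm_ge_zero)
      also have "B *v x = A n *v x + (B - A n) *v x"
        by (simp add: matrix_vector_mult_diff_rdistrib)
      also have "norm \<dots> \<le> norm (A n *v x) + norm (B - A n) * norm x"
        by (intro norm_triangle_le add_left_mono norm_matrix_vector_mult_le)
      also have "norm (B - A n) * norm x \<le> 1 / (2 * K) * norm x"
        using elim by (intro mult_right_mono) (auto simp: dist_norm norm_minus_commute)
      finally show "norm x \<le> 2 * K * norm (A n *v x)"
        using K by (simp add: field_simps)
    qed
  qed
  then show ev: "\<forall>\<^sub>F n in F. invertible (A n)"
    by eventually_elim (metis invertible_if_bounded_below)
  show "((\<lambda>n. matrix_inv (A n)) \<longlongrightarrow> matrix_inv B) F"
  proof (rule tendsto_matrixI)
    fix y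
    have "((\<lambda>n. 2 * K * (norm (B - A n) * norm (matrix_inv B *v y))) \<longlongrightarrow>
        2 * K * (norm (B - B) * norm (matrix_inv B *v y))) F"
      by (intro tendsto_intros lim)
    then have z: "((\<lambda>n. 2 * K * (norm (B - A n) * norm (matrix_inv B *v y))) \<longlongrightarrow> 0) F"
      by simp
    have "((\<lambda>n. matrix_inv (A n) *v y - matrix_inv B *v y) \<longlongrightarrow> 0) F"
    proof (rule Lim_null_comparison[OF _ z])
      show "\<forall>\<^sub>F n in F. norm (matrix_inv (A n) *v y - matrix_inv B *v y)
          \<le> 2 * K * (norm (B - A n) * norm (matrix_inv B *v y))"
        using bd ev
      proof eventually_elim
        case (elim n)
        have "norm (matrix_inv (A n) *v y - matrix_inv B *v y)
            \<le> 2 * K * norm (A n *v (matrix_inv (A n) *v y - matrix_inv B *v y))"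
          using elim by blast
        also have "A n *v (matrix_inv (A n) *v y - matrix_inv B *v y)
            = (B - A n) *v (matrix_inv B *v y)"
          using elim inv
          by (simp add: matrix_vector_mult_diff_distrib matrix_vector_mult_diff_rdistrib
              matrix_inv_mult_vector)
        also have "2 * K * norm \<dots> \<le> 2 * K * (norm (B - A n) * norm (matrix_inv B *v y))"
          using K by (intro mult_left_mono norm_matrix_vector_mult_le) auto
        finally show ?case .
      qed
    qed
    then show "((\<lambda>n. matrix_inv (A n) *v y) \<longlongrightarrow> matrix_inv B *v y) F"
      by (rule LIM_zero_cancel)
  qed
qed

text \<open>Homogeneity reduces to the unit sphere, where compactness turns pointwise positivity
  into a positive minimum. The constant \<open>c\<close> makes the stability and Lipschitz estimates
  for square roots quantitative.\<close>

lemma coercive_matrix: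
  fixes A :: "real^'n^'n"
  assumes "\<And>x. x \<noteq> 0 \<Longrightarrow> x \<bullet> (A *v x) > 0"
  obtains c where "c > 0" "\<And>x. c * (norm x)\<^sup>2 \<le> x \<bullet> (A *v x)"
proof -
  have "continuous_on (sphere 0 1) (\<lambda>x. x \<bullet> (A *v x))"
    by (intro continuous_intros matrix_vector_mult_linear_continuous_on)
  from continuous_attains_inf[OF compact_sphere _ this]
  obtain u where u: "u \<in> sphere 0 1" "\<And>x. x \<in> sphere 0 1 \<Longrightarrow> u \<bullet> (A *v u) \<le> x \<bullet> (A *v x)"
    by auto
  have "(u \<bullet> (A *v u)) * (norm x)\<^sup>2 \<le> x \<bullet> (A *v x)" for x
  proof (cases "x = 0")
    case False
    define e where "e = (1 / norm x) *\<^sub>R x"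
    have x: "x = norm x *\<^sub>R e" using False by (simp add: e_def)
    have "u \<bullet> (A *v u) \<le> e \<bullet> (A *v e)"
      using False by (intro u) (simp add: e_def)
    then have "(u \<bullet> (A *v u)) * (norm x)\<^sup>2 \<le> (e \<bullet> (A *v e)) * (norm x)\<^sup>2"
      by (intro mult_right_mono) auto
    also have "\<dots> = x \<bullet> (A *v x)"
    proof -
      have "x \<bullet> (A *v x) = (norm x *\<^sub>R e) \<bullet> (A *v (norm x *\<^sub>R e))"
        using x by simp
      also have "\<dots> = (e \<bullet> (A *v e)) * (norm x)\<^sup>2"
        by (simp add: power2_eq_square matrix_vector_mult_scaleR)
      finally show ?thesis by simp
    qed
    finally show ?thesis .
  qed simp
  moreover have "u \<bullet> (A *v u) > 0"
    using u(1) by (intro assms) auto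
  ultimately show thesis using that by blast
qed

section \<open>Positive definite matrices\<close>

lemma sym_pos_def_invertible:
  fixes A :: "real^'n^'n"
  assumes "sym_pos_def A"
  shows "invertible A"
proof -
  have "x = 0" if "A *v x = 0" for x
    using assms that unfolding sym_pos_def_def by (metis inner_zero_right less_irrefl)
  then show ?thesis
    by (simp add: invertible_left_inverse matrix_left_invertible_ker)
qed

lemma inner_symmetric_matrix:
  fixes A :: "real^'n^'n"
  assumes "transpose A = A"
  shows "(A *v x) \<bullet> y = x \<bullet> (A *v y)"
  by (metis assms dot_lmul_matrix inner_commute transpose_matrix_vector)

lemma symmetric_matrixI:
  fixes A :: "real^'n^'n"
  assumes "\<And>x y. (A *v x) \<bullet> y = x \<bullet> (A *v y)"
  shows "transpose A = A"
proof -
  have "A $ j $ i = A $ i $ j" for i j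
    using assms[of "axis i 1" "axis j 1"]
    by (simp add: inner_axis inner_axis' matrix_vector_mul_component)
  then show ?thesis by (simp add: vec_eq_iff transpose_def)
qed

lemma symmetric_matrix_inv:
  fixes A :: "real^'n^'n"
  assumes "transpose A = A" "invertible A"
  shows "transpose (matrix_inv A) = matrix_inv A"
  by (rule symmetric_matrixI)
    (metis assms inner_symmetric_matrix matrix_inv_mult_vector(2))

lemma sym_pos_def_matrix_inv:
  fixes A :: "real^'n^'n"
  assumes "sym_pos_def A"
  shows "sym_pos_def (matrix_inv A)"
proof -
  have i: "invertible A" by (rule sym_pos_def_invertible[OF assms])
  have "x \<bullet> (matrix_inv A *v x) > 0" if "x \<noteq> 0" for x
  proof -
    define y where "y = matrix_inv A *v x"
    have x: "x = A *v y" using i by (simp add: y_def matrix_inv_mult_vector)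
    then have "y \<noteq> 0" using that by auto
    then have "y \<bullet> (A *v y) > 0" using assms by (auto simp: sym_pos_def_def)
    then show ?thesis using x by (metis inner_commute y_def)
  qed
  then show ?thesis
    using assms i by (simp add: sym_pos_def_def symmetric_matrix_inv)
qed

text \<open>A perturbation of norm below the coercivity constant of the limit cannot destroy
  positivity. Symmetry is assumed separately since it is not an open condition.\<close>

lemma eventually_sym_pos_def:
  fixes A :: "'a \<Rightarrow> real^'n^'n"
  assumes "(A \<longlongrightarrow> B) F" "sym_pos_def B" "\<forall>\<^sub>F n in F. transpose (A n) = A n"
  shows "\<forall>\<^sub>F n in F. sym_pos_def (A n)"
proof -
  obtain c where c: "c > 0" "\<And>x. c * (norm x)\<^sup>2 \<le> x \<bullet> (B *v x)"
    using coercive_matrix[of B] assms(2) by (auto simp: sym_pos_def_def)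
  have "\<forall>\<^sub>F n in F. dist (A n) B < c"
    using assms(1) c(1) by (rule tendstoD)
  with assms(3) show ?thesis
  proof eventually_elim
    case (elim n)
    have "x \<bullet> (A n *v x) > 0" if "x \<noteq> 0" for x
    proof -
      have "\<bar>x \<bullet> ((A n - B) *v x)\<bar> \<le> norm x * norm ((A n - B) *v x)"
        by (rule Cauchy_Schwarz_ineq2)
      also have "\<dots> \<le> norm x * (norm (A n - B) * norm x)"
        by (intro mult_left_mono norm_matrix_vector_mult_le) auto
      also have "\<dots> = norm (A n - B) * (norm x)\<^sup>2"
        by (simp add: power2_eq_square)
      also have "\<dots> < c * (norm x)\<^sup>2"
        using elim that by (intro mult_strict_right_mono) (auto simp: dist_norm)
      also have "\<dots> \<le> x \<bullet> (B *v x)" by (rule c)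
      finally show ?thesis
        by (simp add: matrix_vector_mult_diff_rdistrib inner_diff_right)
    qed
    then show ?case using elim by (simp add: sym_pos_def_def)
  qed
qed

section \<open>Trace inner product and square roots\<close>

lemma inner_matrix_trace:
  fixes A B :: "real^'n^'n"
  shows "A \<bullet> B = trace (transpose A ** B)"
  unfolding inner_vec_def trace_def matrix_matrix_mult_def transpose_def
  by simp (rule sum.swap)

text \<open>The trace becomes a sum of values of the quadratic form of \<open>S\<close> at the
  columns of \<open>D\<close>, so a lower bound for that form passes to the trace.\<close>

lemma trace_conj_symmetric:
  fixes D S :: "real^'n^'n"
  assumes "transpose D = D"
  shows "trace (D ** S ** D) = (\<Sum>j\<in>UNIV. (D *v axis j 1) \<bullet> (S *v (D *v axis j 1)))"
proof -
  have "trace (D ** S ** D) = (\<Sum>j\<in>UNIV. axis j 1 \<bullet> ((D ** S ** D) *v axis j 1))"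
    by (simp add: trace_def inner_axis' matrix_vector_mul_component inner_axis)
  also have "\<dots> = (\<Sum>j\<in>UNIV. (D *v axis j 1) \<bullet> (S *v (D *v axis j 1)))"
    by (simp flip: matrix_vector_mul_assoc add: inner_symmetric_matrix[OF assms])
  finally show ?thesis .
qed

text \<open>With \<open>D = S - R\<close> one has \<open>S\<^sup>2 - R\<^sup>2 = S D + D R\<close>; pairing this with \<open>D\<close> in the trace inner
  product makes both terms nonnegative.\<close>

lemma norm_diff_le_norm_square_diff:
  fixes S R :: "real^'n^'n"
  assumes S: "transpose S = S" "\<And>x. x \<bullet> (S *v x) \<ge> 0"
    and R: "transpose R = R" "\<And>x. c * (norm x)\<^sup>2 \<le> x \<bullet> (R *v x)"
  shows "c * norm (S - R) \<le> norm (S ** S - R ** R)"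
proof -
  define D where "D = S - R"
  have D: "transpose D = D" using S R by (simp add: D_def vec_eq_iff transpose_def)
  have eq: "S ** S - R ** R = S ** D + D ** R"
    by (simp add: D_def matrix_eq matrix_vector_mult_diff_rdistrib matrix_vector_mult_diff_distrib
        matrix_vector_mult_add_rdistrib flip: matrix_vector_mul_assoc)
  have "D \<bullet> (S ** S - R ** R) = trace (D ** S ** D) + trace (D ** R ** D)"
    using trace_mul_sym[of D "D ** R"]
    by (simp add: inner_matrix_trace D eq matrix_add_ldistrib trace_add matrix_mul_assoc)
  moreover have "trace (D ** S ** D) \<ge> 0"
    unfolding trace_conj_symmetric[OF D] by (intro sum_nonneg S)
  moreover have "trace (D ** R ** D) \<ge> c * (norm D)\<^sup>2"
  proof -
    have "c * (norm D)\<^sup>2 = c * (trace (D ** mat 1 ** D))"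
      by (simp add: power2_norm_eq_inner inner_matrix_trace D)
    also have "\<dots> = (\<Sum>j\<in>UNIV. c * (norm (D *v axis j 1))\<^sup>2)"
      unfolding trace_conj_symmetric[OF D] by (simp add: sum_distrib_left power2_norm_eq_inner)
    also have "\<dots> \<le> trace (D ** R ** D)"
      unfolding trace_conj_symmetric[OF D] by (intro sum_mono R)
    finally show ?thesis .
  qed
  ultimately have "c * (norm D)\<^sup>2 \<le> norm D * norm (S ** S - R ** R)"
    using norm_cauchy_schwarz[of D "S ** S - R ** R"] by linarith
  then show ?thesis
    by (cases "norm D = 0") (auto simp: D_def power2_eq_square)
qed

lemma spd_sqrt_unique:
  fixes S R :: "real^'n^'n"
  assumes "sym_pos_def S" "sym_pos_def R" "S ** S = R ** R"
  shows "S = R"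
proof -
  obtain c where c: "c > 0" "\<And>x. c * (norm x)\<^sup>2 \<le> x \<bullet> (R *v x)"
    using coercive_matrix[of R] assms(2) by (auto simp: sym_pos_def_def)
  have "x \<bullet> (S *v x) \<ge> 0" for x
    using assms(1) by (cases "x = 0") (auto simp: sym_pos_def_def less_imp_le)
  then have "c * norm (S - R) \<le> norm (S ** S - R ** R)"
    using assms c by (intro norm_diff_le_norm_square_diff) (auto simp: sym_pos_def_def)
  then show ?thesis
    using assms(3) c(1) by (simp add: mult_le_0_iff)
qed

text \<open>After scaling, \<open>W = I - k V\<close> has operator norm \<open>r < 1\<close>, and \<open>Y \<mapsto> (W + Y\<^sup>2) / 2\<close> is a
  contraction of the symmetric operators of norm at most \<open>r\<close>; its fixed point \<open>Y\<close> satisfies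
  \<open>(I - Y)\<^sup>2 = k V\<close>.\<close>

lemma spd_sqrt_exists:
  fixes V :: "real^'n^'n"
  assumes "sym_pos_def V"
  shows "\<exists>S. sym_pos_def S \<and> S ** S = V"
proof -
  obtain c where c: "c > 0" "\<And>x. c * (norm x)\<^sup>2 \<le> x \<bullet> (V *v x)"
    using coercive_matrix[of V] assms by (auto simp: sym_pos_def_def)
  have sym: "(V *v x) \<bullet> y = x \<bullet> (V *v y)" for x y
    using assms by (intro inner_symmetric_matrix) (simp add: sym_pos_def_def)
  \<comment> \<open>Adding \<open>c\<close> makes \<open>B\<close> positive and at least
    \<open>c\<close>, so that \<open>1 - c^2 / B^2\<close> is nonnegative and can serve as
    \<open>r^2\<close>.\<close>
  define B where "B = norm V + c"
  have B: "B > 0" "c \<le> B" using c(1) by (simp_all add: B_def add_nonneg_pos)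
  \<comment> \<open>This \<open>k\<close> minimises \<open>1 - 2 * k * c + k^2 * B^2\<close>, a
    bound for the squared operator norm of \<open>I - k V\<close>; the minimum is
    \<open>1 - c^2 / B^2\<close>.\<close>
  define k where "k = c / B\<^sup>2"
  have k: "k > 0" using B c by (simp add: k_def)
  define r where "r = sqrt (1 - c\<^sup>2 / B\<^sup>2)"
  have "c\<^sup>2 / B\<^sup>2 > 0" "c\<^sup>2 / B\<^sup>2 \<le> 1"
    using B c by (simp_all add: power_mono)
  then have r: "0 \<le> r" "r < 1" "r\<^sup>2 = 1 - c\<^sup>2 / B\<^sup>2" by (simp_all add: r_def real_sqrt_lt_1_iff)
  \<comment> \<open>Bounded linear functions replace matrices here: the contraction needs the
    operator norm, whereas the matrix type carries the Frobenius norm, in which \<open>W\<close>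
    need not be smaller than 1.\<close>
  define W where "W = Blinfun (\<lambda>x. x - k *\<^sub>R (V *v x))"
  have W: "blinfun_apply W x = x - k *\<^sub>R (V *v x)" for x
    unfolding W_def
    by (subst bounded_linear_Blinfun_apply)
       (auto intro!: bounded_linear_intros matrix_vector_mul_bounded_linear)
  have "norm W \<le> r"
  proof (rule norm_blinfun_bound)
    fix x
    have "(norm (blinfun_apply W x))\<^sup>2 = (norm x)\<^sup>2 - 2 * k * (x \<bullet> (V *v x)) + k\<^sup>2 * (norm (V *v x))\<^sup>2"
      unfolding W power2_norm_eq_inner
      by (simp add: inner_diff inner_commute power2_eq_square algebra_simps)
    also have "\<dots> \<le> (norm x)\<^sup>2 - 2 * k * (c * (norm x)\<^sup>2) + k\<^sup>2 * (B * norm x)\<^sup>2"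
    proof -
      have "norm (V *v x) \<le> B * norm x"
        using norm_matrix_vector_mult_le[of V x] c(1)
        by (simp add: B_def distrib_right add_increasing2)
      then show ?thesis using k c(2)[of x]
        by (intro add_mono diff_mono mult_left_mono power_mono) auto
    qed
    also have "\<dots> = (r * norm x)\<^sup>2"
      using B unfolding power_mult_distrib r(3) k_def by (simp add: field_simps power2_eq_square)
    finally show "norm (blinfun_apply W x) \<le> r * norm x"
      using r(1) by (intro power2_le_imp_le[OF _ mult_nonneg_nonneg]) auto
  qed (use r in auto)
  define \<S> where "\<S> = {Y :: (real^'n) \<Rightarrow>\<^sub>L (real^'n). norm Y \<le> r \<and> (\<forall>x y. blinfun_apply Y x \<bullet> y = x \<bullet> blinfun_apply Y y)}"
  define G where "G Y = (1/2) *\<^sub>R (W + (Y o\<^sub>L Y))" for Y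
  have "closed \<S>"
    unfolding \<S>_def
    by (intro closed_Collect_conj closed_Collect_all closed_Collect_le closed_Collect_eq
        continuous_intros)
  note this[folded complete_eq_closed]
  moreover have "\<S> \<noteq> {}" using r by (auto simp: \<S>_def intro!: exI[of _ 0])
  moreover have "G ` \<S> \<subseteq> \<S>"
  proof (rule image_subsetI)
    fix Y assume Y: "Y \<in> \<S>"
    have "norm (Y o\<^sub>L Y) \<le> norm Y * norm Y" by (rule norm_blinfun_compose)
    also have "\<dots> \<le> r * 1"
      using Y r by (intro mult_mono) (auto simp: \<S>_def)
    finally have "norm (G Y) \<le> r"
      using \<open>norm W \<le> r\<close> norm_triangle_ineq[of W "Y o\<^sub>L Y"] by (simp add: G_def)
    moreover have "blinfun_apply (G Y) x \<bullet> y = x \<bullet> blinfun_apply (G Y) y" for x y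
      using Y by (simp add: G_def W \<S>_def blinfun.add_left blinfun.scaleR_left inner_left_distrib
          inner_right_distrib inner_diff sym)
    ultimately show "G Y \<in> \<S>" by (simp add: \<S>_def)
  qed
  moreover have "dist (G Y) (G Z) \<le> r * dist Y Z" if "Y \<in> \<S>" "Z \<in> \<S>" for Y Z
  proof -
    have "G Y - G Z = (1/2) *\<^sub>R ((Y o\<^sub>L (Y - Z)) + ((Y - Z) o\<^sub>L Z))"
      by (rule blinfun_eqI)
        (simp add: G_def blinfun.bilinear_simps scaleR_add_right scaleR_diff_right)
    also have "norm \<dots> \<le> (1/2) * (norm (Y o\<^sub>L (Y - Z)) + norm ((Y - Z) o\<^sub>L Z))"
      by (simp add: norm_triangle_ineq)
    also have "\<dots> \<le> (1/2) * (norm Y * norm (Y - Z) + norm (Y - Z) * norm Z)"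
      by (intro mult_left_mono add_mono norm_blinfun_compose) auto
    also have "\<dots> \<le> (1/2) * (r * norm (Y - Z) + norm (Y - Z) * r)"
      using that by (intro mult_left_mono add_mono mult_right_mono) (auto simp: \<S>_def)
    finally show ?thesis by (simp add: dist_norm)
  qed
  ultimately have "\<exists>!Y\<in>\<S>. G Y = Y"
    using r by (intro Banach_fix) auto
  then obtain Y where Y: "Y \<in> \<S>" "G Y = Y" by blast
  have lin: "linear (\<lambda>x. (1 / sqrt k) *\<^sub>R (x - blinfun_apply Y x))"
    by (intro linearI) (simp_all add: blinfun.bilinear_simps algebra_simps)
  define S where "S = matrix (\<lambda>x. (1 / sqrt k) *\<^sub>R (x - blinfun_apply Y x))"
  have S: "S *v x = (1 / sqrt k) *\<^sub>R (x - blinfun_apply Y x)" for x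
    unfolding S_def using lin by (simp add: matrix_works)
  have "transpose S = S"
    using Y(1) by (intro symmetric_matrixI) (simp add: S \<S>_def inner_diff)
  moreover have "x \<bullet> (S *v x) > 0" if "x \<noteq> 0" for x
  proof -
    have "x \<bullet> blinfun_apply Y x \<le> norm x * norm (blinfun_apply Y x)" by (rule norm_cauchy_schwarz)
    also have "\<dots> \<le> norm x * (r * norm x)"
      using Y(1) norm_blinfun[of Y x] mult_right_mono[of "norm Y" r "norm x"]
      by (intro mult_left_mono) (auto simp: \<S>_def)
    also have "\<dots> < norm x * (1 * norm x)"
      using that r by (intro mult_strict_left_mono mult_strict_right_mono) auto
    finally have "x \<bullet> (x - blinfun_apply Y x) > 0"
      by (simp add: inner_diff_right power2_norm_eq_inner[symmetric] power2_eq_square)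
    then show ?thesis using k by (simp add: S)
  qed
  moreover have "S ** S = V"
  proof -
    have "S *v (S *v x) = V *v x" for x
    proof -
      have "2 *\<^sub>R blinfun_apply Y x = 2 *\<^sub>R blinfun_apply (G Y) x" by (simp add: Y)
      also have "\<dots> = x - k *\<^sub>R (V *v x) + blinfun_apply Y (blinfun_apply Y x)"
        by (simp add: G_def blinfun.bilinear_simps W)
      finally have "k *\<^sub>R (V *v x) = x - blinfun_apply Y x - (blinfun_apply Y x - blinfun_apply Y (blinfun_apply Y x))"
        by (simp add: scaleR_2 algebra_simps)
      moreover have "S *v (S *v x) = (1 / k) *\<^sub>R (x - blinfun_apply Y x - (blinfun_apply Y x - blinfun_apply Y (blinfun_apply Y x)))"
        using k by (simp add: S blinfun.bilinear_simps scaleR_diff_right scaleR_add_right)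
      ultimately show ?thesis using k by (metis divide_self_if less_irrefl scaleR_one scaleR_scaleR times_divide_eq_left mult_1)
    qed
    then show ?thesis by (simp add: matrix_eq matrix_vector_mul_assoc)
  qed
  ultimately show ?thesis by (auto simp: sym_pos_def_def)
qed

lemma
  fixes V :: "real^'n^'n"
  assumes "sym_pos_def V"
  shows sym_pos_def_spd_sqrt: "sym_pos_def (spd_sqrt V)"
    and spd_sqrt_square: "spd_sqrt V ** spd_sqrt V = V"
proof -
  have "\<exists>!S. sym_pos_def S \<and> S ** S = V"
    using spd_sqrt_exists[OF assms] spd_sqrt_unique by metis
  from theI'[OF this] show "sym_pos_def (spd_sqrt V)" "spd_sqrt V ** spd_sqrt V = V"
    by (simp_all add: spd_sqrt_def)
qed

text \<open>The estimate for differences of squares asks coercivity of one of the two roots only. It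
  is taken from the fixed \<open>spd_sqrt W\<close>, so the Lipschitz constant \<open>1 / c\<close>
  does not depend on \<open>n\<close>.\<close>

lemma tendsto_spd_sqrt:
  fixes V :: "'a \<Rightarrow> real^'n^'n"
  assumes lim: "(V \<longlongrightarrow> W) F" and ev: "\<forall>\<^sub>F n in F. sym_pos_def (V n)" and W: "sym_pos_def W"
  shows "((\<lambda>n. spd_sqrt (V n)) \<longlongrightarrow> spd_sqrt W) F"
proof -
  obtain c where c: "c > 0" "\<And>x. c * (norm x)\<^sup>2 \<le> x \<bullet> (spd_sqrt W *v x)"
    using coercive_matrix[of "spd_sqrt W"] sym_pos_def_spd_sqrt[OF W] by (auto simp: sym_pos_def_def)
  have "((\<lambda>n. norm (V n - W) / c) \<longlongrightarrow> norm (W - W) / c) F"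
    using c by (intro tendsto_intros lim) auto
  then have z: "((\<lambda>n. norm (V n - W) / c) \<longlongrightarrow> 0) F" by simp
  have "((\<lambda>n. spd_sqrt (V n) - spd_sqrt W) \<longlongrightarrow> 0) F"
  proof (rule Lim_null_comparison[OF _ z])
    show "\<forall>\<^sub>F n in F. norm (spd_sqrt (V n) - spd_sqrt W) \<le> norm (V n - W) / c"
      using ev
    proof eventually_elim
      case (elim n)
      have "x \<bullet> (spd_sqrt (V n) *v x) \<ge> 0" for x
        using sym_pos_def_spd_sqrt[OF elim]
        by (cases "x = 0") (auto simp: sym_pos_def_def less_imp_le)
      then have "c * norm (spd_sqrt (V n) - spd_sqrt W)
          \<le> norm (spd_sqrt (V n) ** spd_sqrt (V n) - spd_sqrt W ** spd_sqrt W)"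
        using c sym_pos_def_spd_sqrt[OF elim] sym_pos_def_spd_sqrt[OF W]
        by (intro norm_diff_le_norm_square_diff) (auto simp: sym_pos_def_def)
      then show ?case
        using c by (simp add: spd_sqrt_square elim W field_simps)
    qed
  qed
  then show ?thesis by (rule LIM_zero_cancel)
qed

section \<open>The multivariate Levy continuity theorem\<close>

lemma borel_measurable_cis [measurable]: "cis \<in> borel_measurable borel"
  by (intro borel_measurable_continuous_onI continuous_intros)

section \<open>Characteristic function of the standard normal vector\<close>

lemma integral_lborel_prod:
  fixes g :: "'a::euclidean_space \<Rightarrow> real \<Rightarrow> complex"
  assumes "\<And>b. b \<in> Basis \<Longrightarrow> integrable lborel (g b)"
  shows "(\<integral>z. (\<Prod>b\<in>Basis. g b (z \<bullet> b)) \<partial>lborel) = (\<Prod>b\<in>Basis. \<integral>u. g b u \<partial>lborel)"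
proof -
  interpret product_sigma_finite "\<lambda>_::'a. lborel :: real measure" ..
  have [measurable]: "g b \<in> borel_measurable borel" if "b \<in> Basis" for b
    using borel_measurable_integrable[OF assms[OF that]] by simp
  have "(\<integral>z. (\<Prod>b\<in>Basis. g b (z \<bullet> b)) \<partial>lborel)
      = (\<integral>f. (\<Prod>b\<in>Basis. g b ((\<Sum>b\<in>Basis. f b *\<^sub>R b) \<bullet> b)) \<partial>(\<Pi>\<^sub>M b\<in>Basis. lborel))"
    by (subst lborel_eq) (simp add: integral_distr)
  also have "\<dots> = (\<integral>f. (\<Prod>b\<in>Basis. g b (f b)) \<partial>(\<Pi>\<^sub>M b\<in>Basis. lborel))"
    by (intro Bochner_Integration.integral_cong prod.cong) auto
  also have "\<dots> = (\<Prod>b\<in>Basis. \<integral>u. g b u \<partial>lborel)"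
    by (intro product_integral_prod assms) auto
  finally show ?thesis .
qed

text \<open>The product form reduces total mass and characteristic function to the one-dimensional
  normal law, one factor per coordinate.\<close>

lemma std_normal_vec_prod:
  "std_normal_vec = density lborel (\<lambda>z :: real^'p. ennreal (\<Prod>b\<in>Basis. std_normal_density (z \<bullet> b)))"
proof -
  have "exp (- (norm z)\<^sup>2 / 2) / sqrt (2 * pi) ^ CARD('p) = (\<Prod>b\<in>Basis. std_normal_density (z \<bullet> b))"
    for z :: "real^'p"
  proof -
    have "(norm z)\<^sup>2 = (\<Sum>b\<in>Basis. (z \<bullet> b)\<^sup>2)"
      unfolding power2_norm_eq_inner unfolding power2_eq_square by (rule euclidean_inner)
    then have "exp (- (norm z)\<^sup>2 / 2) = (\<Prod>b\<in>Basis. exp (- (z \<bullet> b)\<^sup>2 / 2))"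
      by (simp add: exp_sum sum_negf sum_divide_distrib flip: exp_sum)
    then show ?thesis
      by (simp add: std_normal_density_def prod_dividef)
  qed
  then show ?thesis by (simp add: std_normal_vec_def)
qed

lemma sets_std_normal_vec [measurable_cong, simp]: "sets std_normal_vec = sets borel"
  by (simp add: std_normal_vec_def)

lemma prob_space_std_normal_vec: "prob_space (std_normal_vec :: (real^'p) measure)"
proof
  have "emeasure (std_normal_vec :: (real^'p) measure) (space std_normal_vec)
      = (\<integral>\<^sup>+z. (\<Prod>b\<in>Basis. ennreal (std_normal_density (z \<bullet> b))) \<partial>(lborel :: (real^'p) measure))"
    by (simp add: std_normal_vec_prod emeasure_density prod_ennreal)
  also have "\<dots> = (\<Prod>b\<in>(Basis :: (real^'p) set). \<integral>\<^sup>+u. ennreal (std_normal_density u) \<partial>lborel)"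
    by (rule nn_integral_lborel_prod) auto
  also have "(\<integral>\<^sup>+u. ennreal (std_normal_density u) \<partial>lborel) = 1"
    using prob_space.emeasure_space_1[OF prob_space_normal_density[of 1 0]]
    by (simp add: emeasure_density)
  finally show "emeasure (std_normal_vec :: (real^'p) measure) (space std_normal_vec) = 1"
    by simp
qed

lemma char_std_normal_vec:
  fixes x :: "real^'p"
  shows "(\<integral>z. cis (x \<bullet> z) \<partial>std_normal_vec) = of_real (exp (- (norm x)\<^sup>2 / 2))"
proof -
  define g where "g b u = std_normal_density u *\<^sub>R cis ((x \<bullet> b) * u)" for b :: "real^'p" and u
  have int: "integrable lborel (g b)" for b
    unfolding g_def using integrable_std_normal_moment[of 0]
    by (rule Bochner_Integration.integrable_bound) (auto intro!: AE_I2)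
  have "(\<integral>z. cis (x \<bullet> z) \<partial>std_normal_vec)
      = (\<integral>z. (\<Prod>b\<in>Basis. std_normal_density (z \<bullet> b)) *\<^sub>R cis (x \<bullet> z) \<partial>lborel)"
    unfolding std_normal_vec_prod
    by (intro integral_density) (auto intro!: AE_I2 prod_nonneg)
  also have "\<dots> = (\<integral>z. (\<Prod>b\<in>Basis. g b (z \<bullet> b)) \<partial>lborel)"
  proof (intro Bochner_Integration.integral_cong refl)
    fix z :: "real^'p"
    have "cis (x \<bullet> z) = (\<Prod>b\<in>Basis. cis ((x \<bullet> b) * (z \<bullet> b)))"
      by (subst euclidean_inner) (simp add: cis_conv_exp sum_distrib_left exp_sum)
    then show "(\<Prod>b\<in>Basis. std_normal_density (z \<bullet> b)) *\<^sub>R cis (x \<bullet> z) = (\<Prod>b\<in>Basis. g b (z \<bullet> b))"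
      by (simp add: g_def scaleR_conv_of_real prod.distrib)
  qed
  also have "\<dots> = (\<Prod>b\<in>Basis. \<integral>u. g b u \<partial>lborel)"
    by (rule integral_lborel_prod[OF int])
  also have "\<dots> = (\<Prod>b\<in>Basis. of_real (exp (- (x \<bullet> b)\<^sup>2 / 2)))"
  proof (intro prod.cong refl)
    fix b :: "real^'p"
    have "(\<integral>u. g b u \<partial>lborel) = (\<integral>u. cis ((x \<bullet> b) * u) \<partial>std_normal_distribution)"
      unfolding g_def by (subst integral_density) auto
    also have "\<dots> = char std_normal_distribution (x \<bullet> b)"
      by (simp add: char_def cis_conv_exp)
    finally show "(\<integral>u. g b u \<partial>lborel) = of_real (exp (- (x \<bullet> b)\<^sup>2 / 2))"
      by (simp add: char_std_normal_distribution)
  qed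
  also have "\<dots> = of_real (exp (- (norm x)\<^sup>2 / 2))"
  proof -
    have "(norm x)\<^sup>2 = (\<Sum>b\<in>Basis. (x \<bullet> b)\<^sup>2)"
      unfolding power2_norm_eq_inner unfolding power2_eq_square by (rule euclidean_inner)
    then show ?thesis
      by (simp add: sum_negf sum_divide_distrib flip: exp_sum of_real_prod)
  qed
  finally show ?thesis .
qed

text \<open>If \<open>f\<close> is not integrable its integral is 0, and the bound only says that
  the integral of \<open>g\<close> is nonnegative. The majorant is thus the only integrability
  obligation.\<close>

lemma norm_integral_le:
  fixes f :: "'a \<Rightarrow> 'b::{banach, second_countable_topology}"
  assumes "integrable M g" "\<And>x. x \<in> space M \<Longrightarrow> norm (f x) \<le> g x"
  shows "norm (\<integral>x. f x \<partial>M) \<le> (\<integral>x. g x \<partial>M)"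
proof (cases "integrable M f")
  case True
  have "norm (\<integral>x. f x \<partial>M) \<le> (\<integral>x. norm (f x) \<partial>M)"
    by (rule integral_norm_bound)
  also have "\<dots> \<le> (\<integral>x. g x \<partial>M)"
    using True assms by (intro integral_mono) auto
  finally show ?thesis .
next
  case False
  have "0 \<le> (\<integral>x. g x \<partial>M)"
    by (intro integral_nonneg_AE AE_I2 order_trans[OF norm_ge_zero assms(2)])
  then show ?thesis using False by (simp add: not_integrable_integral_eq)
qed

text \<open>The Gaussian is its own Fourier transform up to scaling. Written as a mixture of cosines
  it links characteristic functions to Gaussian test integrals.\<close>

lemma gaussian_eq_integral_cos:
  fixes x :: "real^'p"
  shows "exp (- (norm x)\<^sup>2 / 2) = (\<integral>z. cos (x \<bullet> z) \<partial>std_normal_vec)"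
proof -
  interpret prob_space "std_normal_vec :: (real^'p) measure" by (rule prob_space_std_normal_vec)
  have "integrable std_normal_vec (\<lambda>z. cis (x \<bullet> z))"
    by (intro integrable_const_bound[where B=1]) auto
  then have "(\<integral>z. Re (cis (x \<bullet> z)) \<partial>std_normal_vec) = Re (\<integral>z. cis (x \<bullet> z) \<partial>std_normal_vec)"
    by (rule integral_Re)
  then show ?thesis by (simp add: char_std_normal_vec)
qed

section \<open>From characteristic functions to bounded continuous test functions\<close>

locale char_convergence =
  fixes N :: "nat \<Rightarrow> (real^'p) measure" and L :: "(real^'p) measure"
  assumes prob_N: "\<And>n. prob_space (N n)" and prob_L: "prob_space L"
    and sets_N [measurable_cong]: "\<And>n. sets (N n) = sets borel"
    and sets_L [measurable_cong]: "sets L = sets borel"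
    and char_conv: "\<And>t. (\<lambda>n. \<integral>y. cis (t \<bullet> y) \<partial>N n) \<longlonglongrightarrow> (\<integral>y. cis (t \<bullet> y) \<partial>L)"
begin

text \<open>The class of admissible test functions. It contains the cosines by hypothesis and is
  enlarged by mixtures to Gaussian kernels, by Gaussian smoothing to continuous functions of compact
  support, and by cut-offs to bounded continuous functions.\<close>

definition conv_int :: "(real^'p \<Rightarrow> real) \<Rightarrow> bool" where
  "conv_int h \<longleftrightarrow> (\<lambda>n. \<integral>y. h y \<partial>N n) \<longlonglongrightarrow> (\<integral>y. h y \<partial>L)"

text \<open>Fubini moves the mixing integral outside, where dominated convergence in
  \<open>y\<close> applies. The mixing measure is merely sigma-finite because smoothing uses
  Lebesgue measure; the weight \<open>w\<close> then carries the integrability.\<close>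

lemma conv_int_mix:
  assumes \<eta>: "sigma_finite_measure \<eta>" and w: "integrable \<eta> w"
    and h [measurable]: "(\<lambda>(x, y). h y x) \<in> borel_measurable (borel \<Otimes>\<^sub>M \<eta>)"
    and bound: "\<And>x y. \<bar>h y x\<bar> \<le> w y"
    and conv: "\<And>y. conv_int (h y)"
  shows "conv_int (\<lambda>x. \<integral>y. h y x \<partial>\<eta>)"
proof -
  have swap: "(\<integral>x. \<integral>y. h y x \<partial>\<eta> \<partial>Q) = (\<integral>y. \<integral>x. h y x \<partial>Q \<partial>\<eta>)"
    "\<bar>\<integral>x. h y x \<partial>Q\<bar> \<le> w y" "(\<lambda>y. \<integral>x. h y x \<partial>Q) \<in> borel_measurable \<eta>"
    if Q: "prob_space Q" and s [measurable_cong]: "sets Q = sets borel" for Q y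
  proof -
    interpret Q: prob_space Q by (rule Q)
    interpret \<eta>: sigma_finite_measure \<eta> by (rule \<eta>)
    interpret PQ: pair_sigma_finite Q \<eta> ..
    have m: "(\<lambda>(x, y). h y x) \<in> borel_measurable (Q \<Otimes>\<^sub>M \<eta>)" by measurable
    have int_y: "integrable \<eta> (\<lambda>y. h y x)" for x
    proof (rule Bochner_Integration.integrable_bound[OF w])
      have "(\<lambda>y. (\<lambda>(x, y). h y x) (x, y)) \<in> borel_measurable \<eta>" by measurable
      then show "(\<lambda>y. h y x) \<in> borel_measurable \<eta>" by simp
    qed (use bound in \<open>auto intro!: AE_I2 intro: order_trans[OF _ abs_ge_self]\<close>)
    have "integrable (Q \<Otimes>\<^sub>M \<eta>) (\<lambda>(x, y). h y x)"
    proof (rule PQ.Fubini_integrable[OF m])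
      show "integrable Q (\<lambda>x. \<integral>y. norm (case (x, y) of (x, y) \<Rightarrow> h y x) \<partial>\<eta>)"
      proof (rule Q.integrable_const_bound[where B="integral\<^sup>L \<eta> w"])
        show "AE x in Q. norm (\<integral>y. norm (case (x, y) of (x, y) \<Rightarrow> h y x) \<partial>\<eta>) \<le> integral\<^sup>L \<eta> w"
          using bound w int_y by (auto intro!: AE_I2 integral_mono)
      qed measurable
      show "AE x in Q. integrable \<eta> (\<lambda>y. case (x, y) of (x, y) \<Rightarrow> h y x)"
        using int_y by simp
    qed
    from PQ.Fubini_integral[OF this]
    show "(\<integral>x. \<integral>y. h y x \<partial>\<eta> \<partial>Q) = (\<integral>y. \<integral>x. h y x \<partial>Q \<partial>\<eta>)" by simp
    show "\<bar>\<integral>x. h y x \<partial>Q\<bar> \<le> w y"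
    proof (cases "integrable Q (h y)")
      case True
      then have "\<bar>\<integral>x. h y x \<partial>Q\<bar> \<le> (\<integral>x. w y \<partial>Q)"
        using bound by (intro integral_abs_bound_integral) auto
      then show ?thesis by (simp add: Q.prob_space)
    next
      case False
      \<comment> \<open>Any argument serves: the bound is used only for
        \<open>0 \<le> w y\<close>.\<close>
      then show ?thesis using bound[of y undefined] by (simp add: not_integrable_integral_eq)
    qed
    show "(\<lambda>y. \<integral>x. h y x \<partial>Q) \<in> borel_measurable \<eta>" by measurable
  qed
  have "(\<lambda>n. \<integral>y. \<integral>x. h y x \<partial>N n \<partial>\<eta>) \<longlonglongrightarrow> (\<integral>y. \<integral>x. h y x \<partial>L \<partial>\<eta>)"
  proof (rule integral_dominated_convergence[where w=w])
    show "AE y in \<eta>. (\<lambda>n. \<integral>x. h y x \<partial>N n) \<longlonglongrightarrow> (\<integral>x. h y x \<partial>L)"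
      using conv by (simp add: conv_int_def)
  qed (use swap prob_N prob_L sets_N sets_L w in auto)
  then show ?thesis
    by (simp add: conv_int_def swap(1) prob_N prob_L sets_N sets_L)
qed

lemma conv_int_uniform_limit:
  assumes [measurable]: "g \<in> borel_measurable borel"
    and approx: "\<And>e. e > 0 \<Longrightarrow> \<exists>h. h \<in> borel_measurable borel \<and> conv_int h \<and> (\<exists>B. \<forall>x. \<bar>h x\<bar> \<le> B) \<and> (\<forall>x. \<bar>g x - h x\<bar> \<le> e)"
  shows "conv_int g"
  unfolding conv_int_def
proof (rule LIMSEQ_I)
  \<comment> \<open>Two replacements of \<open>g\<close> by \<open>h\<close> and one limit for
    \<open>h\<close> cost \<open>r / 4\<close> each, which leaves strict room below
    \<open>r\<close>.\<close>
  fix r :: real assume r: "r > 0"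
  then obtain h B where [measurable]: "h \<in> borel_measurable borel" and h: "conv_int h"
    "\<And>x. \<bar>h x\<bar> \<le> B" "\<And>x. \<bar>g x - h x\<bar> \<le> r / 4"
    using approx[of "r / 4"] by (metis zero_less_divide_iff zero_less_numeral)
  have close: "\<bar>(\<integral>y. g y \<partial>Q) - (\<integral>y. h y \<partial>Q)\<bar> \<le> r / 4"
    if Q: "prob_space Q" and [measurable_cong]: "sets Q = sets borel" for Q
  proof -
    interpret prob_space Q by (rule Q)
    have gB: "\<bar>g x\<bar> \<le> B + r / 4" for x using h(2)[of x] h(3)[of x] by linarith
    have ih: "integrable Q h" using h by (intro integrable_const_bound[where B=B]) auto
    have ig: "integrable Q g" using gB by (intro integrable_const_bound[where B="B + r / 4"]) auto
    have "(\<integral>y. g y \<partial>Q) - (\<integral>y. h y \<partial>Q) = (\<integral>y. g y - h y \<partial>Q)" using ih ig by simp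
    also have "\<bar>\<dots>\<bar> \<le> (\<integral>y. r / 4 \<partial>Q)"
      using ih ig h by (intro integral_abs_bound_integral) auto
    finally show ?thesis by (simp add: prob_space)
  qed
  obtain n0 where n0: "\<And>n. n \<ge> n0 \<Longrightarrow> norm ((\<integral>y. h y \<partial>N n) - (\<integral>y. h y \<partial>L)) < r / 4"
    using LIMSEQ_D[OF h(1)[unfolded conv_int_def], of "r / 4"] r by auto
  show "\<exists>n0. \<forall>n\<ge>n0. norm ((\<integral>y. g y \<partial>N n) - (\<integral>y. g y \<partial>L)) < r"
  proof (intro exI[of _ n0] allI impI)
    fix n assume "n \<ge> n0"
    from n0[OF this] show "norm ((\<integral>y. g y \<partial>N n) - (\<integral>y. g y \<partial>L)) < r"
      using close[OF prob_N sets_N, of n] close[OF prob_L sets_L] r unfolding real_norm_def by linarith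
  qed
qed

text \<open>Real part of the characteristic function at \<open>- t\<close>, rotated by
  \<open>cis (t \<bullet> y)\<close>.\<close>

lemma conv_int_cos: "conv_int (\<lambda>x. cos (t \<bullet> (y - x)))"
proof -
  have "(\<lambda>n. Re (cis (t \<bullet> y) * (\<integral>x. cis (- t \<bullet> x) \<partial>N n)))
      \<longlonglongrightarrow> Re (cis (t \<bullet> y) * (\<integral>x. cis (- t \<bullet> x) \<partial>L))"
    by (intro tendsto_intros char_conv)
  moreover have "Re (cis (t \<bullet> y) * (\<integral>x. cis (- t \<bullet> x) \<partial>Q)) = (\<integral>x. cos (t \<bullet> (y - x)) \<partial>Q)"
    if Q: "prob_space Q" and [measurable_cong]: "sets Q = sets borel" for Q
  proof -
    interpret prob_space Q by (rule Q)
    have "integrable Q (\<lambda>x. cis (t \<bullet> y) * cis (- t \<bullet> x))"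
      by (intro integrable_const_bound[where B=1]) (auto simp: norm_mult)
    from integral_Re[OF this] show ?thesis
      by (simp add: cos_diff inner_diff_right)
  qed
  ultimately show ?thesis
    by (simp add: conv_int_def prob_N prob_L sets_N sets_L)
qed

lemma conv_int_gaussian: "conv_int (\<lambda>x. exp (- (norm ((1 / s) *\<^sub>R (y - x)))\<^sup>2 / 2))"
proof -
  interpret S: prob_space "std_normal_vec :: (real^'p) measure" by (rule prob_space_std_normal_vec)
  have "conv_int (\<lambda>x. \<integral>z. cos (((1 / s) *\<^sub>R z) \<bullet> (y - x)) \<partial>std_normal_vec)"
    by (rule conv_int_mix[where w="\<lambda>_. 1"])
       (auto simp: S.sigma_finite_measure_axioms simp del: inner_scaleR_left intro: conv_int_cos)
  then show ?thesis
    unfolding gaussian_eq_integral_cos by (simp add: inner_commute)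
qed

text \<open>The left-hand side is uniformly close to \<open>g\<close> for small \<open>s\<close>; the right-hand side is a mixture
  of Gaussian kernels, to which the previous two lemmas apply.\<close>

lemma gaussian_smoothing:
  fixes g :: "real^'p \<Rightarrow> real"
  assumes [measurable]: "g \<in> borel_measurable borel" and s: "s > 0"
  shows "(\<integral>z. g (x + s *\<^sub>R z) \<partial>std_normal_vec)
      = (\<integral>y. g y * exp (- (norm ((1 / s) *\<^sub>R (y - x)))\<^sup>2 / 2) \<partial>lborel) / (sqrt (2 * pi) * s) ^ CARD('p)"
proof -
  have "(\<integral>y. g y * exp (- (norm ((1 / s) *\<^sub>R (y - x)))\<^sup>2 / 2) \<partial>lborel)
      = (\<integral>z. s ^ CARD('p) * (g (x + s *\<^sub>R z) * exp (- (norm z)\<^sup>2 / 2)) \<partial>lborel)"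
    using s by (subst lborel_affine[of s x])
      (auto simp: integral_density integral_distr ennreal_power intro!: Bochner_Integration.integral_cong)
  moreover have "(\<integral>z. g (x + s *\<^sub>R z) \<partial>std_normal_vec)
      = (\<integral>z. (exp (- (norm z)\<^sup>2 / 2) / sqrt (2 * pi) ^ CARD('p)) * g (x + s *\<^sub>R z) \<partial>lborel)"
    unfolding std_normal_vec_def by (subst integral_density) auto
  ultimately show ?thesis using s
    by (simp add: power_mult_distrib mult.commute)
qed

text \<open>Such a function is uniformly continuous and integrable: the first keeps it close to its
  Gaussian smoothing, the second makes the smoothing an admissible mixture.\<close>

lemma conv_int_compact_support:
  assumes g: "continuous_on UNIV g" and K: "compact K" "\<And>x. x \<notin> K \<Longrightarrow> g x = 0"
  shows "conv_int g"
proof (rule conv_int_uniform_limit)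
  interpret S: prob_space "std_normal_vec :: (real^'p) measure" by (rule prob_space_std_normal_vec)
  show m [measurable]: "g \<in> borel_measurable borel"
    by (rule borel_measurable_continuous_onI[OF g])
  have "compact (g ` K)"
    by (intro compact_continuous_image K continuous_on_subset[OF g]) auto
  from compact_imp_bounded[OF this] obtain B0 where "\<And>x. x \<in> K \<Longrightarrow> \<bar>g x\<bar> \<le> B0"
    by (auto simp: bounded_iff)
  then have B: "\<bar>g x\<bar> \<le> \<bar>B0\<bar>" for x
    using K(2)[of x] by (cases "x \<in> K") fastforce+
  define B where "B = \<bar>B0\<bar> + 1"
  have B: "\<bar>g x\<bar> \<le> B" "B > 0" for x using B[of x] by (auto simp: B_def)
  have int: "integrable lborel g"
  proof -
    have "integrable lborel (\<lambda>x. indicator K x *\<^sub>R g x)"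
      using borel_integrable_compact[OF K(1) continuous_on_subset[OF g]] by (simp add: set_integrable_def)
    also have "(\<lambda>x. indicator K x *\<^sub>R g x) = g"
      using K(2) by (auto simp: fun_eq_iff indicator_def)
    finally show ?thesis .
  qed
  have "uniformly_continuous_on UNIV g"
    unfolding uniformly_continuous_on_def
  proof (intro allI impI)
    fix e :: real assume e: "e > 0"
    \<comment> \<open>The closed 1-neighbourhood of \<open>K\<close>. Two points at distance below
      1, one of them in \<open>K\<close>, both lie in it; two points outside \<open>K\<close> have
      equal values.\<close>
    define K' where "K' = (\<Union>x\<in>K. \<Union>y\<in>cball 0 1. {x + y})"
    have K': "compact K'" unfolding K'_def by (rule compact_sums'[OF K(1) compact_cball])
    have "uniformly_continuous_on K' g"
      by (intro compact_uniformly_continuous K' continuous_on_subset[OF g]) auto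
    then obtain d where d: "d > 0" "\<And>x y. x \<in> K' \<Longrightarrow> y \<in> K' \<Longrightarrow> dist y x < d \<Longrightarrow> dist (g y) (g x) < e"
      using e unfolding uniformly_continuous_on_def by meson
    have sub: "x \<in> K'" if "k \<in> K" "dist x k < 1" for x k
    proof -
      have "x - k \<in> cball 0 1" "x \<in> {k + (x - k)}" using that by (auto simp: dist_norm norm_minus_commute)
      then show ?thesis unfolding K'_def using that(1) by blast
    qed
    show "\<exists>d>0. \<forall>x\<in>UNIV. \<forall>y\<in>UNIV. dist y x < d \<longrightarrow> dist (g y) (g x) < e"
    proof (intro exI[of _ "min d 1"] conjI ballI impI)
      fix x y :: "real^'p" assume xy: "dist y x < min d 1"
      show "dist (g y) (g x) < e"
      proof (cases "x \<in> K \<or> y \<in> K")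
        case True
        then have "x \<in> K'" "y \<in> K'"
          using xy sub[of x x] sub[of x y] sub[of y y] sub[of y x] by (auto simp: dist_commute)
        then show ?thesis using d xy by auto
      qed (use K(2) e in auto)
    qed (use d in auto)
  qed
  fix e :: real assume e: "e > 0"
  obtain d where d: "d > 0" "\<And>x y. dist y x < d \<Longrightarrow> dist (g y) (g x) < e / 2"
    using \<open>uniformly_continuous_on UNIV g\<close>[unfolded uniformly_continuous_on_def, rule_format, of "e / 2"] e
    by auto
  \<comment> \<open>The Gaussian mass outside a large ball vanishes. The radius \<open>k\<close> is
    chosen so that samples beyond it contribute at most
    \<open>2 * B * (e / (4 * B)) = e / 2\<close>.\<close>
  have "(\<lambda>k. \<integral>z. indicat_real {z. norm z \<ge> real k} z \<partial>(std_normal_vec :: (real^'p) measure))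
      \<longlonglongrightarrow> (\<integral>z. 0 \<partial>(std_normal_vec :: (real^'p) measure))"
  proof (rule integral_dominated_convergence[where w="\<lambda>_. 1"])
    show "AE z in (std_normal_vec :: (real^'p) measure). (\<lambda>k. indicat_real {z. norm z \<ge> real k} z) \<longlonglongrightarrow> 0"
    proof (intro AE_I2 tendsto_eventually)
      fix z :: "real^'p"
      have "\<forall>\<^sub>F k in sequentially. real k > norm z"
        using filterlim_real_sequentially by (simp add: filterlim_at_top_dense)
      then show "\<forall>\<^sub>F k in sequentially. indicat_real {z. norm z \<ge> real k} z = 0"
        by eventually_elim auto
    qed
  qed auto
  then have "\<forall>\<^sub>F k in sequentially. (\<integral>z. indicat_real {z. norm z \<ge> real k} z \<partial>(std_normal_vec :: (real^'p) measure)) < e / (4 * B)"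
    using e B by (intro order_tendstoD) auto
  then obtain k :: nat where k: "(\<integral>z. indicat_real {z. norm z \<ge> real k} z \<partial>(std_normal_vec :: (real^'p) measure)) < e / (4 * B)"
    by (auto simp: eventually_sequentially)
  \<comment> \<open>At this scale a Gaussian sample of norm below \<open>k\<close> moves
    \<open>x\<close> by less than \<open>d\<close>; the \<open>+ 1\<close> avoids a zero denominator
    and gives strictness.\<close>
  define s where "s = d / (real k + 1)"
  have s: "s > 0" "s * real k < d" using d by (auto simp: s_def field_simps)
  define h where "h x = (\<integral>z. g (x + s *\<^sub>R z) \<partial>std_normal_vec)" for x
  have hm: "h \<in> borel_measurable borel"
    unfolding h_def by (intro S.borel_measurable_lebesgue_integral) auto
  have hB: "\<bar>h x\<bar> \<le> B" for x
  proof -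
    have "\<bar>h x\<bar> \<le> (\<integral>z. B \<partial>(std_normal_vec :: (real^'p) measure))"
      unfolding h_def
      using B by (intro integral_abs_bound_integral S.integrable_const_bound[where B=B]) auto
    then show ?thesis by (simp add: S.prob_space)
  qed
  have "conv_int (\<lambda>x. \<integral>y. g y * exp (- (norm ((1 / s) *\<^sub>R (y - x)))\<^sup>2 / 2) \<partial>lborel)"
  proof (rule conv_int_mix[where w="\<lambda>y. \<bar>g y\<bar>"])
    show "conv_int (\<lambda>x. g y * exp (- (norm ((1 / s) *\<^sub>R (y - x)))\<^sup>2 / 2))" for y
      using conv_int_gaussian[of s y] unfolding conv_int_def
      by (simp only: integral_mult_right_zero) (rule tendsto_mult_left)
    show "\<bar>g y * exp (- (norm ((1 / s) *\<^sub>R (y - x)))\<^sup>2 / 2)\<bar> \<le> \<bar>g y\<bar>" for x y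
      by (simp add: abs_mult mult_left_le)
  qed (use int in \<open>auto simp: lborel.sigma_finite_measure_axioms\<close>)
  then have hc: "conv_int h"
    unfolding h_def gaussian_smoothing[OF m s(1)] conv_int_def
    by (simp only: integral_divide_zero) (rule tendsto_divide, auto simp: s less_imp_neq[symmetric])
  have "\<bar>g x - h x\<bar> \<le> e" for x
  proof -
    have i: "integrable std_normal_vec (\<lambda>z. g (x + s *\<^sub>R z))"
      using B by (intro S.integrable_const_bound[where B=B]) auto
    have ii: "integrable (std_normal_vec :: (real^'p) measure) (indicat_real {z. norm z \<ge> real k})"
      by (rule S.integrable_const_bound[where B=1]) auto
    have "g x - h x = (\<integral>z. g x - g (x + s *\<^sub>R z) \<partial>std_normal_vec)"
      using i by (simp add: h_def S.prob_space)
    also have "\<bar>\<dots>\<bar> \<le> (\<integral>z. e / 2 + 2 * B * indicator {z. norm z \<ge> real k} z \<partial>(std_normal_vec :: (real^'p) measure))"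
    proof (rule integral_abs_bound_integral)
      fix z :: "real^'p"
      show "\<bar>g x - g (x + s *\<^sub>R z)\<bar> \<le> e / 2 + 2 * B * indicator {z. norm z \<ge> real k} z"
      proof (cases "norm z \<ge> real k")
        case True
        then show ?thesis using B(1)[of x] B(1)[of "x + s *\<^sub>R z"] e by (simp add: abs_if split: if_splits)
      next
        case False
        then have "s * norm z \<le> s * real k" using s by (intro mult_left_mono) auto
        then have "s * norm z < d" using s(2) by linarith
        then have "dist x (x + s *\<^sub>R z) < d" using s(1) by (simp add: dist_norm)
        then show ?thesis using d(2)[of x "x + s *\<^sub>R z"] False by (simp add: dist_real_def)
      qed
    qed (use i ii in auto)
    also have "\<dots> = e / 2 + 2 * B * (\<integral>z. indicat_real {z. norm z \<ge> real k} z \<partial>(std_normal_vec :: (real^'p) measure))"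
      using ii by (simp add: S.prob_space)
    also have "\<dots> \<le> e / 2 + 2 * B * (e / (4 * B))"
      using k B by (intro add_left_mono mult_left_mono) auto
    also have "\<dots> = e" using B by simp
    finally show ?thesis .
  qed
  with hm hc hB show "\<exists>h. h \<in> borel_measurable borel \<and> conv_int h \<and> (\<exists>B. \<forall>x. \<bar>h x\<bar> \<le> B) \<and> (\<forall>x. \<bar>g x - h x\<bar> \<le> e)"
    by blast
qed

text \<open>Cutting off costs at most \<open>B\<close> times the mass missed by
  \<open>cut k\<close>. The mass kept is itself an integral of a compactly supported function, so it
  converges, and \<open>L\<close> having total mass one makes the loss small: this supplies the
  tightness.\<close>

lemma conv_int_bounded_continuous:
  assumes g: "continuous_on UNIV g" and b: "bounded (range g)"
  shows "conv_int g"
proof -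
  interpret L: prob_space L by (rule prob_L)
  obtain B0 where "\<And>x. norm (g x) \<le> B0" using b by (auto simp: bounded_iff)
  then have B: "\<bar>g x\<bar> \<le> \<bar>B0\<bar> + 1" for x by (smt (verit) real_norm_def)
  define B where "B = \<bar>B0\<bar> + 1"
  have B: "\<bar>g x\<bar> \<le> B" "B > 0" for x using B[of x] by (auto simp: B_def)
  have [measurable]: "g \<in> borel_measurable borel"
    by (rule borel_measurable_continuous_onI[OF g])
  define cut where "cut k x = max 0 (min 1 (real k + 1 - norm x))" for k :: nat and x :: "real^'p"
  have cut: "0 \<le> cut k x" "cut k x \<le> 1" for k x by (auto simp: cut_def)
  have c: "continuous_on UNIV (cut k)" for k unfolding cut_def by (intro continuous_intros)
  have [measurable]: "cut k \<in> borel_measurable borel" for k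
    by (rule borel_measurable_continuous_onI[OF c])
  have supp: "cut k x = 0" if "x \<notin> cball 0 (real k + 1)" for k x using that by (auto simp: cut_def)
  have conv1: "conv_int (cut k)" for k
    by (rule conv_int_compact_support[OF c compact_cball supp])
  have conv2: "conv_int (\<lambda>x. g x * cut k x)" for k
    by (rule conv_int_compact_support[OF _ compact_cball, where x1=0])
       (use supp g c in \<open>auto intro!: continuous_intros\<close>)
  show ?thesis unfolding conv_int_def
  proof (rule LIMSEQ_I)
    fix r :: real assume r: "r > 0"
    have "(\<lambda>k. \<integral>x. cut k x \<partial>L) \<longlonglongrightarrow> (\<integral>x. 1 \<partial>L)"
    proof (rule integral_dominated_convergence[where w="\<lambda>_. 1"])
      show "AE x in L. (\<lambda>k. cut k x) \<longlonglongrightarrow> 1"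
      proof (intro AE_I2 tendsto_eventually)
        fix x :: "real^'p"
        have "\<forall>\<^sub>F k in sequentially. real k > norm x"
          using filterlim_real_sequentially by (simp add: filterlim_at_top_dense)
        then show "\<forall>\<^sub>F k in sequentially. cut k x = 1"
          by eventually_elim (auto simp: cut_def)
      qed
    qed (use cut in \<open>auto simp: abs_of_nonneg\<close>)
    then have "\<forall>\<^sub>F k in sequentially. (\<integral>x. cut k x \<partial>L) > 1 - r / (4 * B)"
      using r B by (intro order_tendstoD) (auto simp: L.prob_space)
    then obtain k where k: "(\<integral>x. cut k x \<partial>L) > 1 - r / (4 * B)"
      by (auto simp: eventually_sequentially)
    have split: "\<bar>(\<integral>x. g x \<partial>Q) - (\<integral>x. g x * cut k x \<partial>Q)\<bar> \<le> B * (1 - (\<integral>x. cut k x \<partial>Q))"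
      if Q: "prob_space Q" and [measurable_cong]: "sets Q = sets borel" for Q
    proof -
      interpret prob_space Q by (rule Q)
      have "\<bar>g x * cut k x\<bar> \<le> B * 1" for x
        unfolding abs_mult using B cut[of k x] by (intro mult_mono) auto
      then have i: "integrable Q g" "integrable Q (cut k)" "integrable Q (\<lambda>x. g x * cut k x)"
        using B cut
        by (auto intro!: integrable_const_bound[where B=B and f=g] integrable_const_bound[where B=1 and f="cut k"]
            integrable_const_bound[where B=B and f="\<lambda>x. g x * cut k x"])
      have "(\<integral>x. g x \<partial>Q) - (\<integral>x. g x * cut k x \<partial>Q) = (\<integral>x. g x * (1 - cut k x) \<partial>Q)"
        using i by (simp add: right_diff_distrib)
      also have "\<bar>\<dots>\<bar> \<le> (\<integral>x. B * (1 - cut k x) \<partial>Q)"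
      proof (rule integral_abs_bound_integral)
        show "\<bar>g x * (1 - cut k x)\<bar> \<le> B * (1 - cut k x)" for x
          using B(1)[of x] cut[of k x] by (simp add: abs_mult mult_right_mono)
      qed (use i in \<open>auto simp: right_diff_distrib\<close>)
      also have "\<dots> = B * (1 - (\<integral>x. cut k x \<partial>Q))"
        using i by (simp add: prob_space)
      finally show ?thesis .
    qed
    have small: "B * (1 - (\<integral>x. cut k x \<partial>L)) < r / 4"
      using mult_strict_left_mono[OF k B(2)] B(2) by (simp add: algebra_simps)
    have "(\<lambda>n. \<bar>(\<integral>x. g x * cut k x \<partial>N n) - (\<integral>x. g x * cut k x \<partial>L)\<bar>
        + B * (1 - (\<integral>x. cut k x \<partial>N n)) + B * (1 - (\<integral>x. cut k x \<partial>L)))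
      \<longlonglongrightarrow> \<bar>(\<integral>x. g x * cut k x \<partial>L) - (\<integral>x. g x * cut k x \<partial>L)\<bar>
        + B * (1 - (\<integral>x. cut k x \<partial>L)) + B * (1 - (\<integral>x. cut k x \<partial>L))"
      using conv1[of k] conv2[of k] unfolding conv_int_def by (intro tendsto_intros)
    from order_tendstoD(2)[OF this, of r] small r
    have "\<forall>\<^sub>F n in sequentially. \<bar>(\<integral>x. g x * cut k x \<partial>N n) - (\<integral>x. g x * cut k x \<partial>L)\<bar>
        + B * (1 - (\<integral>x. cut k x \<partial>N n)) + B * (1 - (\<integral>x. cut k x \<partial>L)) < r"
      by linarith
    then have "\<forall>\<^sub>F n in sequentially. norm ((\<integral>x. g x \<partial>N n) - (\<integral>x. g x \<partial>L)) < r"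
    proof eventually_elim
      case (elim n)
      then show ?case
        using split[OF prob_N sets_N, of n] split[OF prob_L sets_L] by (simp add: abs_if split: if_splits)
    qed
    then show "\<exists>n0. \<forall>n\<ge>n0. norm ((\<integral>x. g x \<partial>N n) - (\<integral>x. g x \<partial>L)) < r"
      by (simp add: eventually_sequentially)
  qed
qed

end

section \<open>Convergence in distribution to the standard normal law\<close>

lemma conv_in_distribution_std_normal_vecI:
  fixes Y :: "nat \<Rightarrow> 'w \<Rightarrow> real^'p"
  assumes M: "prob_space M" and [measurable]: "\<And>n. Y n \<in> borel_measurable M"
    and conv: "\<And>t. (\<lambda>n. \<integral>\<omega>. cis (t \<bullet> Y n \<omega>) \<partial>M) \<longlonglongrightarrow> of_real (exp (- (norm t)\<^sup>2 / 2))"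
  shows "conv_in_distribution M Y std_normal_vec"
proof -
  interpret char_convergence "\<lambda>n. distr M borel (Y n)" std_normal_vec
  proof (rule char_convergence.intro)
    show "prob_space (distr M borel (Y n))" for n
      by (intro prob_space.prob_space_distr[OF M]) measurable
    show "(\<lambda>n. \<integral>y. cis (t \<bullet> y) \<partial>distr M borel (Y n)) \<longlonglongrightarrow> (\<integral>y. cis (t \<bullet> y) \<partial>std_normal_vec)" for t
      using conv[of t] by (simp add: integral_distr char_std_normal_vec)
  qed (simp_all add: prob_space_std_normal_vec)
  show ?thesis
    using conv_int_bounded_continuous by (simp add: conv_in_distribution_def conv_int_def)
qed

text \<open>Convergence in distribution tests with real functions, so the complex limit is assembled
  from cosine and sine parts. The necessity of the rate condition rests on this direction.\<close>

lemma conv_in_distribution_char: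
  fixes Y :: "nat \<Rightarrow> 'w \<Rightarrow> real^'p"
  assumes [measurable]: "\<And>n. Y n \<in> borel_measurable M" and M: "prob_space M"
    and conv: "conv_in_distribution M Y std_normal_vec"
  shows "(\<lambda>n. \<integral>\<omega>. cis (t \<bullet> Y n \<omega>) \<partial>M) \<longlonglongrightarrow> of_real (exp (- (norm t)\<^sup>2 / 2))"
proof -
  interpret prob_space M by (rule M)
  interpret S: prob_space "std_normal_vec :: (real^'p) measure" by (rule prob_space_std_normal_vec)
  have lim: "(\<lambda>n. \<integral>\<omega>. g (Y n \<omega>) \<partial>M) \<longlonglongrightarrow> (\<integral>y. g y \<partial>std_normal_vec)"
    if "continuous_on UNIV g" "\<And>x. \<bar>g x\<bar> \<le> 1" for g :: "real^'p \<Rightarrow> real"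
  proof -
    have "bounded (range g)" using that(2) by (auto simp: bounded_iff)
    moreover have [measurable]: "g \<in> borel_measurable borel"
      by (rule borel_measurable_continuous_onI[OF that(1)])
    ultimately show ?thesis
      using conv that(1) unfolding conv_in_distribution_def by (auto simp: integral_distr)
  qed
  have eq: "(\<integral>x. cis (t \<bullet> g x) \<partial>Q) = Complex (\<integral>x. cos (t \<bullet> g x) \<partial>Q) (\<integral>x. sin (t \<bullet> g x) \<partial>Q)"
    if Q: "prob_space Q" and g [measurable]: "g \<in> borel_measurable Q" for Q :: "'v measure" and g
  proof -
    interpret Q: prob_space Q by (rule Q)
    have "integrable Q (\<lambda>x. cis (t \<bullet> g x))"
      by (intro Q.integrable_const_bound[where B=1]) auto
    from integral_Re[OF this] integral_Im[OF this] show ?thesis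
      by (simp add: complex_eq_iff)
  qed
  have "(\<lambda>n. Complex (\<integral>\<omega>. cos (t \<bullet> Y n \<omega>) \<partial>M) (\<integral>\<omega>. sin (t \<bullet> Y n \<omega>) \<partial>M))
      \<longlonglongrightarrow> Complex (\<integral>y. cos (t \<bullet> y) \<partial>std_normal_vec) (\<integral>y. sin (t \<bullet> y) \<partial>std_normal_vec)"
    by (intro tendsto_Complex lim[of "\<lambda>y. cos (t \<bullet> y)"] lim[of "\<lambda>y. sin (t \<bullet> y)"])
       (auto intro!: continuous_intros)
  then show ?thesis
    using char_std_normal_vec[of t] by (simp add: eq[OF M] eq[OF prob_space_std_normal_vec, of "\<lambda>x. x"])
qed

section \<open>Convergence in probability as convergence along a filter\<close>

text \<open>A property of \<open>(n, \<omega>)\<close> holds eventually along this filter iff it holds with probability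
  tending to one, so that limits along it are limits in probability.\<close>

definition prob_filter :: "'w measure \<Rightarrow> (nat \<times> 'w) filter" where
  "prob_filter M = Abs_filter (\<lambda>Q. \<forall>e>0. \<forall>\<^sub>F n in sequentially.
     \<exists>E\<in>sets M. measure M E \<ge> 1 - e \<and> (\<forall>\<omega>\<in>E. Q (n, \<omega>)))"

lemma norm_cis_diff_le: "norm (cis x - cis y) \<le> \<bar>x - y\<bar>"
proof -
  have "cis x = cis y * cis (x - y)" by (simp add: cis_mult)
  then have "cis x - cis y = cis y * (exp (\<i> * of_real (x - y)) - 1)"
    unfolding cis_conv_exp[of "x - y"] right_diff_distrib by simp
  also have "norm \<dots> = norm (exp (\<i> * of_real (x - y)) - 1)"
    by (simp add: norm_mult)
  also have "\<dots> \<le> \<bar>x - y\<bar>"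
    using iexp_approx1[of "x - y" 0] by simp
  finally show ?thesis .
qed

context prob_space
begin

text \<open>Asking for an event \<open>E\<close> inside the set where \<open>Q\<close> holds gives a
  meaning also to non-measurable \<open>Q\<close>. Closure under conjunction splits \<open>e\<close>
  in halves and intersects the two events.\<close>

lemma eventually_prob_filter:
  "eventually Q (prob_filter M) \<longleftrightarrow>
     (\<forall>e>0. \<forall>\<^sub>F n in sequentially. \<exists>E\<in>events. prob E \<ge> 1 - e \<and> (\<forall>\<omega>\<in>E. Q (n, \<omega>)))"
  unfolding prob_filter_def
proof (rule eventually_Abs_filter, rule is_filter.intro)
  show "\<forall>e>0. \<forall>\<^sub>F n in sequentially. \<exists>E\<in>events. prob E \<ge> 1 - e \<and> (\<forall>\<omega>\<in>E. True)"
    by (auto intro!: always_eventually bexI[of _ "space M"] simp: prob_space)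
next
  fix P Q :: "nat \<times> 'a \<Rightarrow> bool"
  assume P: "\<forall>e>0. \<forall>\<^sub>F n in sequentially. \<exists>E\<in>events. prob E \<ge> 1 - e \<and> (\<forall>\<omega>\<in>E. P (n, \<omega>))"
    and Q: "\<forall>e>0. \<forall>\<^sub>F n in sequentially. \<exists>E\<in>events. prob E \<ge> 1 - e \<and> (\<forall>\<omega>\<in>E. Q (n, \<omega>))"
  show "\<forall>e>0. \<forall>\<^sub>F n in sequentially. \<exists>E\<in>events. prob E \<ge> 1 - e \<and> (\<forall>\<omega>\<in>E. P (n, \<omega>) \<and> Q (n, \<omega>))"
  proof (intro allI impI)
    fix e :: real assume "e > 0"
    then have "\<forall>\<^sub>F n in sequentially. \<exists>E\<in>events. prob E \<ge> 1 - e / 2 \<and> (\<forall>\<omega>\<in>E. P (n, \<omega>))"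
      and "\<forall>\<^sub>F n in sequentially. \<exists>E\<in>events. prob E \<ge> 1 - e / 2 \<and> (\<forall>\<omega>\<in>E. Q (n, \<omega>))"
      using P Q by (auto simp del: prob_space)
    then show "\<forall>\<^sub>F n in sequentially. \<exists>E\<in>events. prob E \<ge> 1 - e \<and> (\<forall>\<omega>\<in>E. P (n, \<omega>) \<and> Q (n, \<omega>))"
    proof eventually_elim
      case (elim n)
      then obtain E E' where E: "E \<in> events" "prob E \<ge> 1 - e / 2" "\<forall>\<omega>\<in>E. P (n, \<omega>)"
        "E' \<in> events" "prob E' \<ge> 1 - e / 2" "\<forall>\<omega>\<in>E'. Q (n, \<omega>)" by auto
      have "prob (E \<union> E') = prob E + prob E' - prob (E \<inter> E')"
        using E by (intro measure_Un3) (auto simp: fmeasurable_eq_sets)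
      then have "prob (E \<inter> E') \<ge> 1 - e"
        using E prob_le_1[of "E \<union> E'"] by linarith
      then show ?case using E by (intro bexI[of _ "E \<inter> E'"]) auto
    qed
  qed
next
  fix P Q :: "nat \<times> 'a \<Rightarrow> bool"
  assume "\<forall>x. P x \<longrightarrow> Q x"
    and P: "\<forall>e>0. \<forall>\<^sub>F n in sequentially. \<exists>E\<in>events. prob E \<ge> 1 - e \<and> (\<forall>\<omega>\<in>E. P (n, \<omega>))"
  then show "\<forall>e>0. \<forall>\<^sub>F n in sequentially. \<exists>E\<in>events. prob E \<ge> 1 - e \<and> (\<forall>\<omega>\<in>E. Q (n, \<omega>))"
    by (fast elim: eventually_mono)
qed

lemma eventually_prob_filter_AE:
  assumes "\<forall>\<^sub>F n in sequentially. AE \<omega> in M. Q (n, \<omega>)"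
  shows "eventually Q (prob_filter M)"
  unfolding eventually_prob_filter
proof (intro allI impI)
  fix e :: real assume e: "e > 0"
  show "\<forall>\<^sub>F n in sequentially. \<exists>E\<in>events. prob E \<ge> 1 - e \<and> (\<forall>\<omega>\<in>E. Q (n, \<omega>))"
    using assms
  proof eventually_elim
    case (elim n)
    then obtain N where N: "N \<in> null_sets M" "{\<omega> \<in> space M. \<not> Q (n, \<omega>)} \<subseteq> N"
      by (auto simp: eventually_ae_filter)
    then have "prob (space M - N) = 1"
      by (simp add: prob_compl null_setsD2 measure_eq_0_null_sets)
    then show ?case using N e by (intro bexI[of _ "space M - N"]) auto
  qed
qed

lemma filterlim_fst_prob_filter: "filterlim fst sequentially (prob_filter M)"
  unfolding filterlim_iff by (auto intro!: eventually_prob_filter_AE elim: eventually_mono)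

lemma tendsto_prob_filter_deterministic:
  assumes "X \<longlonglongrightarrow> c"
  shows "((\<lambda>p. X (fst p)) \<longlongrightarrow> c) (prob_filter M)"
  by (rule filterlim_compose[OF assms filterlim_fst_prob_filter])

section \<open>Limits in probability from moment bounds\<close>

lemma prob_le_ge_Markov:
  fixes Y :: "'a \<Rightarrow> real"
  assumes "integrable M Y" "\<And>\<omega>. Y \<omega> \<ge> 0" "c > 0" "expectation Y \<le> c * e"
  shows "{\<omega>\<in>space M. Y \<omega> < c} \<in> events" "prob {\<omega>\<in>space M. Y \<omega> < c} \<ge> 1 - e"
proof -
  have [measurable]: "Y \<in> borel_measurable M" using assms by auto
  show "{\<omega>\<in>space M. Y \<omega> < c} \<in> events" by measurable
  have "prob {\<omega>\<in>space M. Y \<omega> \<ge> c} \<le> expectation Y / c"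
    using assms by (intro integral_Markov_inequality_measure[where A="{}"]) auto
  also have "\<dots> \<le> e" using assms by (simp add: field_simps)
  finally have "prob (space M - {\<omega>\<in>space M. Y \<omega> < c}) \<le> e"
    by (simp add: set_diff_eq not_less cong: conj_cong)
  moreover have "{\<omega>\<in>space M. Y \<omega> < c} \<in> events" by measurable
  ultimately show "prob {\<omega>\<in>space M. Y \<omega> < c} \<ge> 1 - e"
    by (subst (asm) prob_compl) auto
qed

lemma tendsto_prob_filter_L1:
  fixes Y :: "nat \<Rightarrow> 'a \<Rightarrow> real"
  assumes int: "\<forall>\<^sub>F n in sequentially. integrable M (Y n)" and nn: "\<And>n \<omega>. Y n \<omega> \<ge> 0"
    and lim: "(\<lambda>n. expectation (Y n)) \<longlonglongrightarrow> 0"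
  shows "((\<lambda>(n, \<omega>). Y n \<omega>) \<longlongrightarrow> 0) (prob_filter M)"
proof (rule tendstoI)
  fix c :: real assume c: "c > 0"
  show "\<forall>\<^sub>F x in prob_filter M. dist (case x of (n, \<omega>) \<Rightarrow> Y n \<omega>) 0 < c"
    unfolding eventually_prob_filter
  proof (intro allI impI)
    fix e :: real assume "e > 0"
    then have "\<forall>\<^sub>F n in sequentially. expectation (Y n) < c * e"
      using lim c by (intro order_tendstoD) auto
    with int show "\<forall>\<^sub>F n in sequentially. \<exists>E\<in>events. prob E \<ge> 1 - e
        \<and> (\<forall>\<omega>\<in>E. dist (case (n, \<omega>) of (n, \<omega>) \<Rightarrow> Y n \<omega>) 0 < c)"
    proof eventually_elim
      case (elim n)
      then show ?case
        using prob_le_ge_Markov[of "Y n" c e] nn c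
        by (intro bexI[of _ "{\<omega>\<in>space M. Y n \<omega> < c}"]) auto
    qed
  qed
qed

lemma tendsto_prob_filter_L2:
  fixes Y :: "nat \<Rightarrow> 'a \<Rightarrow> 'b::real_normed_vector"
  assumes "\<forall>\<^sub>F n in sequentially. integrable M (\<lambda>\<omega>. (norm (Y n \<omega>))\<^sup>2)"
    and "(\<lambda>n. expectation (\<lambda>\<omega>. (norm (Y n \<omega>))\<^sup>2)) \<longlonglongrightarrow> 0"
  shows "((\<lambda>(n, \<omega>). Y n \<omega>) \<longlongrightarrow> 0) (prob_filter M)"
proof -
  have "((\<lambda>(n, \<omega>). (norm (Y n \<omega>))\<^sup>2) \<longlongrightarrow> 0) (prob_filter M)"
    using assms by (intro tendsto_prob_filter_L1) auto
  then have "((\<lambda>p. sqrt (case p of (n, \<omega>) \<Rightarrow> (norm (Y n \<omega>))\<^sup>2)) \<longlongrightarrow> sqrt 0) (prob_filter M)"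
    by (rule tendsto_real_sqrt)
  then have "((\<lambda>p. norm (case p of (n, \<omega>) \<Rightarrow> Y n \<omega>)) \<longlongrightarrow> 0) (prob_filter M)"
    by (simp add: case_prod_unfold)
  then show ?thesis by (rule tendsto_norm_zero_cancel)
qed

text \<open>Markov's inequality makes the factors \<open>Y n\<close> uniformly tight, and a tight
  factor cannot rescue a factor that vanishes in probability.\<close>

lemma tendsto_prob_filter_mult_bounded:
  fixes k :: "nat \<times> 'a \<Rightarrow> real" and Y :: "nat \<Rightarrow> 'a \<Rightarrow> real"
  assumes k: "(k \<longlongrightarrow> 0) (prob_filter M)"
    and int: "\<And>n. integrable M (Y n)" and nn: "\<And>n \<omega>. Y n \<omega> \<ge> 0"
    and bd: "\<And>n. expectation (Y n) \<le> B"
  shows "((\<lambda>p. k p * Y (fst p) (snd p)) \<longlongrightarrow> 0) (prob_filter M)"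
proof (rule tendstoI)
  fix c :: real assume c: "c > 0"
  have "0 \<le> expectation (Y 0)" using nn by (intro integral_nonneg_AE) auto
  then have B: "B \<ge> 0" using bd[of 0] by simp
  show "\<forall>\<^sub>F x in prob_filter M. dist (k x * Y (fst x) (snd x)) 0 < c"
    unfolding eventually_prob_filter
  proof (intro allI impI)
    fix e :: real assume e: "e > 0"
    \<comment> \<open>Markov at this level bounds the probability of \<open>Y n \<ge> K\<close> by
      \<open>e / 2\<close>; the \<open>+ 1\<close> keeps \<open>K\<close> positive when
      \<open>B = 0\<close>.\<close>
    define K where "K = 2 * (B + 1) / e"
    have K: "K > 0" using e B by (simp add: K_def)
    have "\<forall>\<^sub>F x in prob_filter M. dist (k x) 0 < c / K"
      using k c K by (intro tendstoD) auto
    then have "\<forall>\<^sub>F n in sequentially. \<exists>E\<in>events. prob E \<ge> 1 - e / 2 \<and> (\<forall>\<omega>\<in>E. dist (k (n, \<omega>)) 0 < c / K)"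
      using e unfolding eventually_prob_filter by auto
    then show "\<forall>\<^sub>F n in sequentially. \<exists>E\<in>events. prob E \<ge> 1 - e \<and> (\<forall>\<omega>\<in>E. dist (k (n, \<omega>) * Y (fst (n, \<omega>)) (snd (n, \<omega>))) 0 < c)"
    proof eventually_elim
      case (elim n)
      then obtain E where E: "E \<in> events" "prob E \<ge> 1 - e / 2" "\<And>\<omega>. \<omega> \<in> E \<Longrightarrow> dist (k (n, \<omega>)) 0 < c / K"
        by auto
      define E' where "E' = {\<omega>\<in>space M. Y n \<omega> < K}"
      have "expectation (Y n) \<le> K * (e / 2)"
        using bd[of n] e by (simp add: K_def)
      from prob_le_ge_Markov[OF int nn K this]
      have E': "E' \<in> events" "prob E' \<ge> 1 - e / 2" by (auto simp: E'_def)
      have "prob (E \<union> E') = prob E + prob E' - prob (E \<inter> E')"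
        using E E' by (intro measure_Un3) (auto simp: fmeasurable_eq_sets)
      then have "prob (E \<inter> E') \<ge> 1 - e"
        using E E' prob_le_1[of "E \<union> E'"] by linarith
      moreover have "dist (k (n, \<omega>) * Y n \<omega>) 0 < c" if "\<omega> \<in> E \<inter> E'" for \<omega>
      proof -
        have "\<bar>k (n, \<omega>)\<bar> * Y n \<omega> \<le> \<bar>k (n, \<omega>)\<bar> * K"
          using that by (intro mult_left_mono) (auto simp: E'_def)
        also have "\<dots> < (c / K) * K"
          using that E(3)[of \<omega>] K by (intro mult_strict_right_mono) auto
        finally show ?thesis using K nn by (simp add: abs_mult)
      qed
      ultimately show ?case using E E' by (intro bexI[of _ "E \<inter> E'"]) auto
    qed
  qed
qed

text \<open>Slutsky's principle for characteristic functions: \<open>cis\<close> is 1-Lipschitz,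
  which serves on the good event, and its differences are bounded by 2 elsewhere.\<close>

lemma tendsto_expectation_cis_diff:
  assumes [measurable]: "\<And>n. U n \<in> borel_measurable M" "\<And>n. W n \<in> borel_measurable M"
    and lim: "((\<lambda>(n, \<omega>). U n \<omega> - W n \<omega>) \<longlongrightarrow> 0) (prob_filter M)"
  shows "(\<lambda>n. (\<integral>\<omega>. cis (U n \<omega>) \<partial>M) - (\<integral>\<omega>. cis (W n \<omega>) \<partial>M)) \<longlonglongrightarrow> 0"
proof (rule tendstoI)
  fix e :: real assume e: "e > 0"
  have "\<forall>\<^sub>F x in prob_filter M. dist (case x of (n, \<omega>) \<Rightarrow> U n \<omega> - W n \<omega>) 0 < e / 4"
    using lim e by (intro tendstoD) auto
  \<comment> \<open>The exceptional event contributes at most \<open>2 * (e / 8)\<close>, so the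
    total stays at \<open>e / 2\<close>.\<close>
  then have "\<forall>\<^sub>F n in sequentially. \<exists>E\<in>events. prob E \<ge> 1 - e / 8 \<and> (\<forall>\<omega>\<in>E. \<bar>U n \<omega> - W n \<omega>\<bar> < e / 4)"
    using e unfolding eventually_prob_filter by (auto elim!: allE[of _ "e / 8"])
  then show "\<forall>\<^sub>F n in sequentially. dist ((\<integral>\<omega>. cis (U n \<omega>) \<partial>M) - (\<integral>\<omega>. cis (W n \<omega>) \<partial>M)) 0 < e"
  proof eventually_elim
    case (elim n)
    then obtain E where [measurable]: "E \<in> events" and E: "prob E \<ge> 1 - e / 8" "\<And>\<omega>. \<omega> \<in> E \<Longrightarrow> \<bar>U n \<omega> - W n \<omega>\<bar> < e / 4"
      by auto
    have i: "integrable M (\<lambda>\<omega>. cis (U n \<omega>))" "integrable M (\<lambda>\<omega>. cis (W n \<omega>))"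
      by (auto intro!: integrable_const_bound[where B=1])
    have iE: "integrable M (indicat_real (space M - E))"
      by (auto intro!: integrable_const_bound[where B=1])
    have "norm ((\<integral>\<omega>. cis (U n \<omega>) \<partial>M) - (\<integral>\<omega>. cis (W n \<omega>) \<partial>M)) = norm (\<integral>\<omega>. cis (U n \<omega>) - cis (W n \<omega>) \<partial>M)"
      using i by simp
    also have "\<dots> \<le> (\<integral>\<omega>. e / 4 + 2 * indicat_real (space M - E) \<omega> \<partial>M)"
    proof (rule norm_integral_le)
      fix \<omega> assume \<omega>: "\<omega> \<in> space M"
      show "norm (cis (U n \<omega>) - cis (W n \<omega>)) \<le> e / 4 + 2 * indicat_real (space M - E) \<omega>"
      proof (cases "\<omega> \<in> E")
        case True
        then show ?thesis using E(2)[OF True] norm_cis_diff_le[of "U n \<omega>" "W n \<omega>"] by simp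
      next
        case False
        then show ?thesis using norm_triangle_ineq4[of "cis (U n \<omega>)" "cis (W n \<omega>)"] e \<omega> by simp
      qed
    qed (use iE in auto)
    also have "\<dots> = e / 4 + 2 * prob (space M - E)"
      using iE by (simp add: prob_space)
    also have "\<dots> < e" using E(1) e by (simp add: prob_compl)
    finally show ?case by simp
  qed
qed

end

section \<open>Exponential moments\<close>

lemma abs_exp_diff_le: "\<bar>exp a - exp b\<bar> \<le> \<bar>a - b\<bar> * exp (max a b)" for a b :: real
proof -
  have *: "exp a - exp b \<le> (a - b) * exp a" for a b :: real
    using exp_ge_add_one_self[of "b - a"] mult_left_mono[of "1 + (b - a)" "exp (b - a)" "exp a"]
    by (simp add: exp_diff algebra_simps)
  show ?thesis
    using *[of a b] *[of b a] by (cases "a \<le> b") (auto simp: max_def)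
qed

lemma abs_exp_minus_linear_le: "\<bar>exp b - 1 - b\<bar> \<le> b\<^sup>2 * exp \<bar>b\<bar>" for b :: real
proof -
  have "norm (exp b - (\<Sum>k\<le>1. b ^ k / fact k)) \<le> exp (norm b) * norm b ^ Suc 1 / fact 1"
    by (rule Taylor_exp_field)
  then show ?thesis by (simp add: power2_eq_square algebra_simps flip: abs_mult)
qed

text \<open>The inequality \<open>y / k \<le> exp (y / k)\<close> raised to the power
  \<open>k\<close>. It lets an exponential absorb polynomial factors; the constant is
  immaterial.\<close>

lemma power_le_exp: "y ^ k \<le> real k ^ k * exp y" if "y \<ge> 0" for y :: real
proof (cases "k = 0")
  case False
  have "(y / k) ^ k \<le> exp (y / k) ^ k"
  proof (rule power_mono)
    show "y / k \<le> exp (y / k)" using exp_ge_add_one_self[of "y / k"] by linarith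
  qed (use that in simp)
  also have "\<dots> = exp y" using False by (simp flip: exp_of_nat_mult)
  finally show ?thesis using False by (simp add: power_divide field_simps)
qed (use that in simp)

lemma abs_inner_le_norm: "\<bar>s \<bullet> v\<bar> \<le> d * norm v" if "norm s \<le> d" for s v :: "'a::real_inner"
  by (rule order_trans[OF Cauchy_Schwarz_ineq2 mult_right_mono[OF that norm_ge_zero]])

lemma exp_inner_le: "exp (s \<bullet> v) \<le> exp (d * norm v)" if "norm s \<le> d" for s v :: "'a::real_inner"
  using abs_inner_le_norm[OF that, of v] by simp

lemma outer_mult_vector: "outer u v *v w = (v \<bullet> w) *\<^sub>R u"
  by (simp add: vec_eq_iff outer_def matrix_vector_mult_def inner_vec_def sum_distrib_left sum_distrib_right ac_simps)

lemma norm_outer: "norm (outer u v) = norm u * norm v"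
proof -
  have "outer u v $ i = (u $ i) *\<^sub>R v" for i by (simp add: vec_eq_iff outer_def)
  then have "norm (outer u v) = L2_set (\<lambda>i. norm (u $ i) * norm v) UNIV"
    by (simp add: norm_vec_def[of "outer u v"])
  also have "\<dots> = norm u * norm v"
    by (simp add: L2_set_left_distrib norm_vec_def[of u])
  finally show ?thesis .
qed

lemma transpose_outer [simp]: "transpose (outer u u) = outer u u"
  by (simp add: vec_eq_iff outer_def transpose_def mult.commute)

lemma tendsto_outer:
  assumes "(u \<longlongrightarrow> u') F" "(v \<longlongrightarrow> v') F"
  shows "((\<lambda>n. outer (u n) (v n)) \<longlongrightarrow> outer u' v') F"
  unfolding outer_def using assms by (auto intro!: tendsto_intros)

lemma borel_measurable_outer [measurable]:
  assumes [measurable]: "u \<in> borel_measurable M" "v \<in> borel_measurable M"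
  shows "(\<lambda>x. outer (u x) (v x)) \<in> borel_measurable M"
proof -
  have "continuous_on UNIV (\<lambda>p. outer (fst p) (snd p) :: real^'n^'n)"
    unfolding outer_def by (intro continuous_intros)
  from borel_measurable_continuous_onI[OF this]
  have "(\<lambda>p. outer (fst p) (snd p)) \<in> borel_measurable (borel \<Otimes>\<^sub>M borel)"
    by (simp add: borel_prod)
  from measurable_compose[OF measurable_Pair[OF assms] this] show ?thesis by simp
qed

lemma bounded_linear_matrix_apply: "bounded_linear (\<lambda>A :: real^'n^'m. A *v v)"
  by (rule bounded_linear_intro[where K="norm v"])
     (simp_all add: matrix_vector_mult_add_rdistrib scaleR_matrix_vector_assoc norm_matrix_vector_mult_le)

lemma bounded_linear_transpose: "bounded_linear (transpose :: real^'n^'m \<Rightarrow> real^'m^'n)"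
  by (intro linear_conv_bounded_linear[THEN iffD1] linearI)
     (simp_all add: vec_eq_iff transpose_def)

text \<open>Discarding the indices before the bound starts to hold leaves a sequence dominated
  throughout, with the same limit.\<close>

lemma dominated_convergence_eventually:
  fixes F :: "nat \<Rightarrow> 'x \<Rightarrow> 'v::{banach, second_countable_topology}"
  assumes [measurable]: "\<And>n. F n \<in> borel_measurable P" "F' \<in> borel_measurable P"
    and w: "integrable P w" and lim: "\<And>x. (\<lambda>n. F n x) \<longlonglongrightarrow> F' x"
    and bd: "\<forall>\<^sub>F n in sequentially. \<forall>x. norm (F n x) \<le> w x"
  shows "(\<lambda>n. \<integral>x. F n x \<partial>P) \<longlonglongrightarrow> (\<integral>x. F' x \<partial>P)"
proof -
  obtain n0 where n0: "\<And>n x. n \<ge> n0 \<Longrightarrow> norm (F n x) \<le> w x"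
    using bd by (auto simp: eventually_sequentially)
  have "(\<lambda>n. \<integral>x. F (n + n0) x \<partial>P) \<longlonglongrightarrow> (\<integral>x. F' x \<partial>P)"
    using n0 by (intro integral_dominated_convergence[where w=w] w)
      (auto intro!: AE_I2 LIMSEQ_ignore_initial_segment lim)
  then show ?thesis by (rule LIMSEQ_offset)
qed

text \<open>Transposition is a bounded linear bijection with bounded inverse, so \<open>F\<close>
  and its transpose are integrable together; otherwise both integrals are 0.\<close>

lemma transpose_integral:
  fixes F :: "'x \<Rightarrow> real^'n^'n"
  shows "transpose (\<integral>x. F x \<partial>P) = (\<integral>x. transpose (F x) \<partial>P)"
  by (rule integral_bounded_linear'[symmetric, OF bounded_linear_transpose bounded_linear_transpose])
     simp_all

text \<open>The moment at \<open>2 * d\<close> is split in two: one \<open>d\<close> dominates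
  \<open>exp (s \<bullet> c x)\<close> for \<open>norm s \<le> d\<close>, the other absorbs powers
  of \<open>norm (c x)\<close>.\<close>

locale exp_moments = prob_space P for P :: "'x measure" +
  fixes c :: "'x \<Rightarrow> real^'p" and d :: real
  assumes c_meas [measurable]: "c \<in> borel_measurable P"
    and d_pos: "d > 0"
    and integrable_exp_norm: "integrable P (\<lambda>x. exp (2 * d * norm (c x)))"
begin

lemma integrable_power_exp: "integrable P (\<lambda>x. norm (c x) ^ k * exp (d * norm (c x)))"
proof (rule Bochner_Integration.integrable_bound)
  show "integrable P (\<lambda>x. (real k ^ k / d ^ k) * exp (2 * d * norm (c x)))"
    by (intro integrable_mult_right integrable_exp_norm)
  have "norm (c x) ^ k * exp (d * norm (c x)) \<le> (real k ^ k / d ^ k) * exp (2 * d * norm (c x))" for x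
  proof -
    have "norm (c x) ^ k \<le> (real k ^ k / d ^ k) * exp (d * norm (c x))"
      using power_le_exp[of "d * norm (c x)" k] d_pos by (simp add: power_mult_distrib field_simps)
    then have "norm (c x) ^ k * exp (d * norm (c x))
        \<le> (real k ^ k / d ^ k) * exp (d * norm (c x)) * exp (d * norm (c x))"
      by (intro mult_right_mono) auto
    also have "\<dots> = (real k ^ k / d ^ k) * exp (2 * d * norm (c x))"
      by (simp add: mult_exp_exp)
    finally show ?thesis .
  qed
  then show "AE x in P. norm (norm (c x) ^ k * exp (d * norm (c x)))
      \<le> norm ((real k ^ k / d ^ k) * exp (2 * d * norm (c x)))"
    using d_pos by simp
qed measurable

lemma integrable_exp_scaleR:
  fixes h :: "'x \<Rightarrow> 'v::{banach, second_countable_topology}"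
  assumes [measurable]: "h \<in> borel_measurable P" and h: "\<And>x. norm (h x) \<le> norm (c x) ^ k"
    and s: "norm s \<le> d"
  shows "integrable P (\<lambda>x. exp (s \<bullet> c x) *\<^sub>R h x)"
proof (rule Bochner_Integration.integrable_bound[OF integrable_power_exp[of k]])
  have "exp (s \<bullet> c x) * norm (h x) \<le> exp (d * norm (c x)) * norm (c x) ^ k" for x
    by (intro mult_mono exp_inner_le s h) auto
  then show "AE x in P. norm (exp (s \<bullet> c x) *\<^sub>R h x) \<le> norm (norm (c x) ^ k * exp (d * norm (c x)))"
    by (simp add: mult.commute)
qed measurable

text \<open>Differentiation under the integral by an explicit remainder: the second-order error of
  \<open>exp (v \<bullet> c x)\<close> carries a factor \<open>exp (norm v * norm (c x))\<close>,
  and \<open>norm v \<le> d - norm s\<close> keeps the combined exponent at \<open>d\<close>. The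
  growth condition on \<open>h\<close> admits \<open>1\<close>, \<open>c\<close> and
  \<open>outer c c\<close>.\<close>

lemma has_derivative_integral_exp:
  fixes h :: "'x \<Rightarrow> 'v::{banach, second_countable_topology}"
  assumes [measurable]: "h \<in> borel_measurable P" and h: "\<And>x. norm (h x) \<le> norm (c x) ^ k"
    and s: "norm s < d"
  shows "((\<lambda>s. \<integral>x. exp (s \<bullet> c x) *\<^sub>R h x \<partial>P) has_derivative
      (\<lambda>v. \<integral>x. exp (s \<bullet> c x) *\<^sub>R ((v \<bullet> c x) *\<^sub>R h x) \<partial>P)) (at s)"
proof -
  have le: "norm ((v \<bullet> c x) *\<^sub>R h x) \<le> norm v * norm (c x) ^ Suc k" for v x
  proof -
    have "\<bar>v \<bullet> c x\<bar> * norm (h x) \<le> (norm v * norm (c x)) * norm (c x) ^ k"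
      by (intro mult_mono h Cauchy_Schwarz_ineq2) auto
    then show ?thesis by (simp add: mult_ac)
  qed
  have int1: "integrable P (\<lambda>x. exp (s \<bullet> c x) *\<^sub>R ((v \<bullet> c x) *\<^sub>R h x))" for v
  proof (rule Bochner_Integration.integrable_bound[OF integrable_mult_right[OF integrable_power_exp[of "Suc k"], of "norm v"]])
    have "exp (s \<bullet> c x) * norm ((v \<bullet> c x) *\<^sub>R h x)
        \<le> exp (d * norm (c x)) * (norm v * norm (c x) ^ Suc k)" for x
      using s by (intro mult_mono exp_inner_le le) auto
    then show "AE x in P. norm (exp (s \<bullet> c x) *\<^sub>R ((v \<bullet> c x) *\<^sub>R h x))
        \<le> norm (norm v * (norm (c x) ^ Suc k * exp (d * norm (c x))))"
      by (simp add: abs_mult mult_ac)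
  qed measurable
  define F' where "F' v = (\<integral>x. exp (s \<bullet> c x) *\<^sub>R ((v \<bullet> c x) *\<^sub>R h x) \<partial>P)" for v
  have bl: "bounded_linear F'"
  proof (rule bounded_linear_intro)
    fix v w
    show "F' (v + w) = F' v + F' w"
      unfolding F'_def by (subst Bochner_Integration.integral_add[symmetric, OF int1 int1])
        (simp add: inner_add_left scaleR_add_left scaleR_add_right)
  next
    fix r v
    show "F' (r *\<^sub>R v) = r *\<^sub>R F' v"
      unfolding F'_def by (subst integral_scaleR_right[symmetric]) (simp_all add: mult_ac)
  next
    fix v
    have "norm (F' v) \<le> (\<integral>x. norm v * (norm (c x) ^ Suc k * exp (d * norm (c x))) \<partial>P)"
      unfolding F'_def
    proof (rule norm_integral_le)
      fix x
      have "exp (s \<bullet> c x) * norm ((v \<bullet> c x) *\<^sub>R h x)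
          \<le> exp (d * norm (c x)) * (norm v * norm (c x) ^ Suc k)"
        using s by (intro mult_mono exp_inner_le le) auto
      then show "norm (exp (s \<bullet> c x) *\<^sub>R ((v \<bullet> c x) *\<^sub>R h x))
          \<le> norm v * (norm (c x) ^ Suc k * exp (d * norm (c x)))"
        by (simp add: abs_mult mult_ac)
    qed (intro integrable_mult_right integrable_power_exp)
    then show "norm (F' v) \<le> norm v * (\<integral>x. norm (c x) ^ Suc k * exp (d * norm (c x)) \<partial>P)"
      by simp
  qed
  define C where "C = (\<integral>x. norm (c x) ^ (k + 2) * exp (d * norm (c x)) \<partial>P)"
  have rem: "norm ((\<integral>x. exp ((s + v) \<bullet> c x) *\<^sub>R h x \<partial>P) - (\<integral>x. exp (s \<bullet> c x) *\<^sub>R h x \<partial>P) - F' v)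
      \<le> (norm v)\<^sup>2 * C" if v: "norm v \<le> d - norm s" for v
  proof -
    have "norm (s + v) \<le> d" using v norm_triangle_ineq[of s v] by linarith
    then have i: "integrable P (\<lambda>x. exp ((s + v) \<bullet> c x) *\<^sub>R h x)" "integrable P (\<lambda>x. exp (s \<bullet> c x) *\<^sub>R h x)"
      using s h by (auto intro!: integrable_exp_scaleR)
    have "(\<integral>x. exp ((s + v) \<bullet> c x) *\<^sub>R h x \<partial>P) - (\<integral>x. exp (s \<bullet> c x) *\<^sub>R h x \<partial>P) - F' v
        = (\<integral>x. exp ((s + v) \<bullet> c x) *\<^sub>R h x - exp (s \<bullet> c x) *\<^sub>R h x - exp (s \<bullet> c x) *\<^sub>R ((v \<bullet> c x) *\<^sub>R h x) \<partial>P)"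
      unfolding F'_def using i int1[of v] by simp
    also have "norm \<dots> \<le> (\<integral>x. (norm v)\<^sup>2 * (norm (c x) ^ (k + 2) * exp (d * norm (c x))) \<partial>P)"
    proof (rule norm_integral_le)
      fix x
      have "exp ((s + v) \<bullet> c x) *\<^sub>R h x - exp (s \<bullet> c x) *\<^sub>R h x - exp (s \<bullet> c x) *\<^sub>R ((v \<bullet> c x) *\<^sub>R h x)
          = (exp (s \<bullet> c x) * (exp (v \<bullet> c x) - 1 - v \<bullet> c x)) *\<^sub>R h x"
        by (simp add: inner_add_left exp_add algebra_simps scaleR_diff_left)
      also have "norm \<dots> = exp (s \<bullet> c x) * \<bar>exp (v \<bullet> c x) - 1 - v \<bullet> c x\<bar> * norm (h x)"
        by (simp add: abs_mult)
      also have "\<dots> \<le> exp (norm s * norm (c x)) * ((norm v * norm (c x))\<^sup>2 * exp ((d - norm s) * norm (c x))) * norm (c x) ^ k"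
      proof (intro mult_mono exp_inner_le h order_trans[OF abs_exp_minus_linear_le])
        have "\<bar>v \<bullet> c x\<bar>\<^sup>2 \<le> (norm v * norm (c x))\<^sup>2"
          by (intro power_mono Cauchy_Schwarz_ineq2) auto
        then show "(v \<bullet> c x)\<^sup>2 \<le> (norm v * norm (c x))\<^sup>2" by simp
        show "exp \<bar>v \<bullet> c x\<bar> \<le> exp ((d - norm s) * norm (c x))"
          using abs_inner_le_norm[OF v, of "c x"] by simp
      qed auto
      also have "\<dots> = (norm v)\<^sup>2 * (norm (c x) ^ (k + 2) * exp (d * norm (c x)))"
      proof -
        have "exp (norm s * norm (c x)) * exp ((d - norm s) * norm (c x)) = exp (d * norm (c x))"
          by (simp add: mult_exp_exp left_diff_distrib)
        then show ?thesis
          by (simp add: power_mult_distrib power_add power2_eq_square mult_ac)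
      qed
      finally show "norm (exp ((s + v) \<bullet> c x) *\<^sub>R h x - exp (s \<bullet> c x) *\<^sub>R h x - exp (s \<bullet> c x) *\<^sub>R ((v \<bullet> c x) *\<^sub>R h x))
          \<le> (norm v)\<^sup>2 * (norm (c x) ^ (k + 2) * exp (d * norm (c x)))" .
    qed (intro integrable_mult_right integrable_power_exp)
    finally show ?thesis by (simp add: C_def)
  qed
  have "((\<lambda>v. norm ((\<integral>x. exp ((s + v) \<bullet> c x) *\<^sub>R h x \<partial>P) - (\<integral>x. exp (s \<bullet> c x) *\<^sub>R h x \<partial>P) - F' v) / norm v) \<longlongrightarrow> 0) (at 0)"
  proof (rule Lim_null_comparison)
    have "\<forall>\<^sub>F v :: real^'p in at 0. dist v 0 < d - norm s"
      using s eventually_at_ball[of "d - norm s" 0 UNIV] by (auto elim: eventually_mono simp: dist_commute)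
    then show "\<forall>\<^sub>F v in at 0. norm (norm ((\<integral>x. exp ((s + v) \<bullet> c x) *\<^sub>R h x \<partial>P) - (\<integral>x. exp (s \<bullet> c x) *\<^sub>R h x \<partial>P) - F' v) / norm v) \<le> norm v * C"
    proof eventually_elim
      case (elim v)
      then have "norm ((\<integral>x. exp ((s + v) \<bullet> c x) *\<^sub>R h x \<partial>P) - (\<integral>x. exp (s \<bullet> c x) *\<^sub>R h x \<partial>P) - F' v) \<le> norm v * (norm v * C)"
        using rem[of v] by (simp add: power2_eq_square mult_ac)
      then show ?case by (cases "v = 0") (auto simp: field_simps)
    qed
    have "((\<lambda>v :: real^'p. norm v * C) \<longlongrightarrow> norm (0 :: real^'p) * C) (at 0)"
      by (intro tendsto_intros)
    then show "((\<lambda>v :: real^'p. norm v * C) \<longlongrightarrow> 0) (at 0)" by simp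
  qed
  then show ?thesis
    using bl unfolding F'_def[symmetric] has_derivative_at by simp
qed

section \<open>Moment and cumulant generating functions\<close>

definition mgf :: "real^'p \<Rightarrow> real" where "mgf s = (\<integral>x. exp (s \<bullet> c x) \<partial>P)"
definition mgf1 :: "real^'p \<Rightarrow> real^'p" where "mgf1 s = (\<integral>x. exp (s \<bullet> c x) *\<^sub>R c x \<partial>P)"
definition mgf2 :: "real^'p \<Rightarrow> real^'p^'p" where "mgf2 s = (\<integral>x. exp (s \<bullet> c x) *\<^sub>R outer (c x) (c x) \<partial>P)"
text \<open>The mean and, with \<open>cgf2\<close>, the covariance of \<open>c\<close> under
  \<open>P\<close> tilted by \<open>exp (s \<bullet> c)\<close>; equally the gradient and Hessian of
  \<open>ln (mgf s)\<close>.\<close>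

definition cgf1 :: "real^'p \<Rightarrow> real^'p" where "cgf1 s = (1 / mgf s) *\<^sub>R mgf1 s"
definition cgf2 :: "real^'p \<Rightarrow> real^'p^'p" where
  "cgf2 s = (1 / mgf s) *\<^sub>R mgf2 s - outer (cgf1 s) (cgf1 s)"

lemma
  assumes "norm s \<le> d"
  shows integrable_mgf: "integrable P (\<lambda>x. exp (s \<bullet> c x))"
    and integrable_mgf1: "integrable P (\<lambda>x. exp (s \<bullet> c x) *\<^sub>R c x)"
    and integrable_mgf2: "integrable P (\<lambda>x. exp (s \<bullet> c x) *\<^sub>R outer (c x) (c x))"
  using integrable_exp_scaleR[of "\<lambda>_. 1 :: real" 0 s] integrable_exp_scaleR[of c 1 s]
    integrable_exp_scaleR[of "\<lambda>x. outer (c x) (c x)" 2 s] assms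
  by (auto simp: norm_outer power2_eq_square)

text \<open>Integrability is the hypothesis instead of \<open>norm s \<le> d\<close>, because
  positivity is also wanted at \<open>\<theta> - \<theta>0\<close> for parameters far from
  \<open>\<theta>0\<close>.\<close>

lemma mgf_pos:
  assumes "integrable P (\<lambda>x. exp (s \<bullet> c x))"
  shows "mgf s > 0"
proof -
  have "mgf s \<noteq> 0"
  proof
    assume "mgf s = 0"
    then have "AE x in P. exp (s \<bullet> c x) = 0"
      using integral_nonneg_eq_0_iff_AE[OF assms] by (simp add: mgf_def)
    then show False by simp
  qed
  moreover have "mgf s \<ge> 0" unfolding mgf_def by (intro integral_nonneg_AE) simp
  ultimately show ?thesis by simp
qed

lemma mgf_has_derivative:
  assumes s: "norm s < d"
  shows "(mgf has_derivative (\<lambda>v. v \<bullet> mgf1 s)) (at s)"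
proof -
  have "(\<lambda>v. \<integral>x. exp (s \<bullet> c x) *\<^sub>R ((v \<bullet> c x) *\<^sub>R (1::real)) \<partial>P) = (\<lambda>v. v \<bullet> mgf1 s)"
    unfolding mgf1_def using integrable_mgf1[of s] s
    by (subst integral_inner_right[symmetric]) auto
  with has_derivative_integral_exp[of "\<lambda>_. 1 :: real" 0 s] s show ?thesis
    by (simp add: mgf_def[abs_def])
qed

lemma mgf1_has_derivative:
  assumes s: "norm s < d"
  shows "(mgf1 has_derivative (\<lambda>v. mgf2 s *v v)) (at s)"
proof -
  have "(\<lambda>v. \<integral>x. exp (s \<bullet> c x) *\<^sub>R ((v \<bullet> c x) *\<^sub>R c x) \<partial>P) = (\<lambda>v. mgf2 s *v v)"
    unfolding mgf2_def using integrable_mgf2[of s] s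
    by (subst integral_bounded_linear[OF bounded_linear_matrix_apply, symmetric])
       (auto simp: scaleR_matrix_vector_assoc[symmetric] outer_mult_vector inner_commute)
  with has_derivative_integral_exp[of c 1 s] s show ?thesis
    by (simp add: mgf1_def[abs_def])
qed

lemma cgf_has_derivative:
  assumes s: "norm s < d"
  shows "((\<lambda>s. ln (mgf s)) has_derivative (\<lambda>v. v \<bullet> cgf1 s)) (at s)"
proof -
  have "mgf s > 0" using s by (intro mgf_pos integrable_mgf) auto
  then show ?thesis
    by (auto intro!: derivative_eq_intros mgf_has_derivative s simp: cgf1_def divide_inverse)
qed

lemma cgf1_has_derivative:
  assumes s: "norm s < d"
  shows "(cgf1 has_derivative (\<lambda>v. cgf2 s *v v)) (at s)"
proof -
  have "mgf s > 0" using s by (intro mgf_pos integrable_mgf) auto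
  then show ?thesis
    unfolding cgf1_def[abs_def]
    by (auto intro!: derivative_eq_intros mgf_has_derivative mgf1_has_derivative s
        simp: cgf2_def cgf1_def fun_eq_iff matrix_vector_mult_diff_rdistrib outer_mult_vector
          scaleR_matrix_vector_assoc[symmetric] inner_commute power2_eq_square divide_inverse mult_ac)
qed

text \<open>Continuity of the second derivative comes from differentiating once more, with
  \<open>outer (c x) (c x)\<close> in the integrand.\<close>

lemma continuous_on_cgf2: "continuous_on (ball 0 d) cgf2"
proof -
  have "isCont mgf2 s" if "norm s < d" for s
    using has_derivative_continuous[OF has_derivative_integral_exp[of "\<lambda>x. outer (c x) (c x)" 2 s]] that
    by (simp add: mgf2_def[abs_def] norm_outer power2_eq_square)
  moreover have "isCont mgf s" "isCont cgf1 s" "mgf s \<noteq> 0" if "norm s < d" for s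
    using has_derivative_continuous[OF mgf_has_derivative[OF that]]
      has_derivative_continuous[OF cgf1_has_derivative[OF that]] that
      mgf_pos[OF integrable_mgf, of s] by auto
  ultimately show ?thesis
    unfolding cgf2_def[abs_def] outer_def
    by (intro continuous_at_imp_continuous_on ballI continuous_intros) auto
qed

lemma transpose_cgf2: "norm s \<le> d \<Longrightarrow> transpose (cgf2 s) = cgf2 s"
proof -
  assume s: "norm s \<le> d"
  have "transpose (mgf2 s) = mgf2 s"
    unfolding mgf2_def
    by (simp add: transpose_integral linear_scale[OF bounded_linear.linear[OF bounded_linear_transpose]])
  then show ?thesis
    by (simp add: cgf2_def linear_diff[OF bounded_linear.linear[OF bounded_linear_transpose]]
        linear_scale[OF bounded_linear.linear[OF bounded_linear_transpose]])
qed

end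

section \<open>Exponential families\<close>

lemma gradient_eqI:
  assumes "GDERIV g x :> D"
  shows "gradient g x = D"
  unfolding gradient_def
proof (rule the_equality, rule assms)
  fix D' assume "GDERIV g x :> D'"
  then have "(\<lambda>h. h \<bullet> D') = (\<lambda>h. h \<bullet> D)"
    using assms unfolding gderiv_def by (rule has_derivative_unique)
  then show "D' = D"
    by (metis inner_commute vector_eq_rdot)
qed

lemma jacobian_eqI:
  fixes g :: "real^'n \<Rightarrow> real^'m"
  assumes "(g has_derivative (\<lambda>v. A *v v)) (at x)"
  shows "jacobian g (at x) = A"
  unfolding jacobian_def frechet_derivative_at[OF assms, symmetric] by (rule matrix_of_matrix_vector_mul)

text \<open>The family in coordinates adapted to \<open>\<theta>0\<close>; \<open>a0\<close>
  collects the constants left by centring. The radius \<open>d\<close> is at once the moment radius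
  and that of a ball inside \<open>\<Theta>\<close>: derivatives are taken in this ball, and
  convexity reaches the rest of \<open>\<Theta>\<close>.\<close>

locale expfam = exp_moments P c d for P :: "'x measure" and c :: "'x \<Rightarrow> real^'p" and d +
  fixes f :: "'x \<Rightarrow> real^'p \<Rightarrow> real" and \<Theta> :: "(real^'p) set" and \<theta>0 :: "real^'p" and a0 :: real
  assumes centred: "(\<integral>x. c x \<partial>P) = 0"
    and nondegenerate: "\<And>v. (AE x in P. v \<bullet> c x = 0) \<Longrightarrow> v = 0"
    and ball_subset: "ball \<theta>0 d \<subseteq> \<Theta>"
    and f_eq: "\<And>x \<theta>. \<theta> \<in> \<Theta> \<Longrightarrow> f x \<theta> = exp (\<theta> \<bullet> c x - (a0 + ln (mgf (\<theta> - \<theta>0))))"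
    and integrable_param: "\<And>\<theta>. \<theta> \<in> \<Theta> \<Longrightarrow> integrable P (\<lambda>x. exp ((\<theta> - \<theta>0) \<bullet> c x))"
    and compact_param: "compact \<Theta>"
begin

definition normalizer :: "real^'p \<Rightarrow> real" where "normalizer \<theta> = a0 + ln (mgf (\<theta> - \<theta>0))"
text \<open>On the ball of radius \<open>d\<close> around \<open>\<theta>0\<close> this is the
  score, by \<open>score_eq\<close>.\<close>

definition resid :: "real^'p \<Rightarrow> 'x \<Rightarrow> real^'p" where "resid \<theta> x = c x - cgf1 (\<theta> - \<theta>0)"
definition logf :: "real^'p \<Rightarrow> 'x \<Rightarrow> real" where "logf \<theta> x = \<theta> \<bullet> c x - normalizer \<theta>"

text \<open>The Fisher information at \<open>\<theta>0\<close>, where the score is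
  \<open>c\<close>.\<close>

definition \<Sigma> :: "real^'p^'p" where "\<Sigma> = (\<integral>x. outer (c x) (c x) \<partial>P)"

lemma f_logf: "\<theta> \<in> \<Theta> \<Longrightarrow> f x \<theta> = exp (logf \<theta> x)"
  by (simp add: f_eq logf_def normalizer_def)

lemma resid_measurable [measurable]: "resid \<theta> \<in> borel_measurable P"
  unfolding resid_def[abs_def] by measurable

lemma logf_measurable [measurable]: "logf \<theta> \<in> borel_measurable P"
  unfolding logf_def[abs_def] by measurable

lemma in_param: "norm (\<theta> - \<theta>0) < d \<Longrightarrow> \<theta> \<in> \<Theta>"
  using ball_subset by (auto simp: dist_norm norm_minus_commute)

lemma mgf_0 [simp]: "mgf 0 = 1"
  by (simp add: mgf_def prob_space)

lemma cgf1_0 [simp]: "cgf1 0 = 0"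
  by (simp add: cgf1_def mgf1_def centred)

lemma cgf2_0: "cgf2 0 = \<Sigma>"
  by (simp add: cgf2_def mgf2_def \<Sigma>_def outer_def vec_eq_iff)

lemma \<Sigma>_quadratic: "v \<bullet> (\<Sigma> *v v) = (\<integral>x. (v \<bullet> c x)\<^sup>2 \<partial>P)"
proof -
  have i: "integrable P (\<lambda>x. outer (c x) (c x))"
    using integrable_mgf2[of 0] d_pos by simp
  have "\<Sigma> *v v = (\<integral>x. (c x \<bullet> v) *\<^sub>R c x \<partial>P)"
    unfolding \<Sigma>_def by (subst integral_bounded_linear[OF bounded_linear_matrix_apply i, symmetric])
      (simp add: outer_mult_vector)
  moreover have "integrable P (\<lambda>x. (c x \<bullet> v) *\<^sub>R c x)"
    using integrable_bounded_linear[OF bounded_linear_matrix_apply i, of v]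
    by (simp add: outer_mult_vector)
  ultimately show ?thesis
    by (simp add: power2_eq_square inner_commute flip: integral_inner_right)
qed

lemma integrable_inner_square: "integrable P (\<lambda>x. (v \<bullet> c x)\<^sup>2)"
proof -
  have i: "integrable P (\<lambda>x. outer (c x) (c x))"
    using integrable_mgf2[of 0] d_pos by simp
  have "integrable P (\<lambda>x. v \<bullet> (outer (c x) (c x) *v v))"
    by (intro integrable_inner_right impI integrable_bounded_linear[OF bounded_linear_matrix_apply i])
  then show ?thesis by (simp add: outer_mult_vector power2_eq_square inner_commute)
qed

lemma sym_pos_def_\<Sigma>: "sym_pos_def \<Sigma>"
proof -
  have "v \<bullet> (\<Sigma> *v v) > 0" if "v \<noteq> 0" for v
  proof -
    have "(\<integral>x. (v \<bullet> c x)\<^sup>2 \<partial>P) \<noteq> 0"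
    proof
      assume "(\<integral>x. (v \<bullet> c x)\<^sup>2 \<partial>P) = 0"
      then have "AE x in P. v \<bullet> c x = 0"
        using integral_nonneg_eq_0_iff_AE[OF integrable_inner_square, of v] by simp
      then show False using nondegenerate that by blast
    qed
    moreover have "(\<integral>x. (v \<bullet> c x)\<^sup>2 \<partial>P) \<ge> 0" by (intro integral_nonneg_AE) simp
    ultimately have "(\<integral>x. (v \<bullet> c x)\<^sup>2 \<partial>P) > 0" by linarith
    then show ?thesis by (simp add: \<Sigma>_quadratic)
  qed
  then show ?thesis by (simp add: sym_pos_def_def \<Sigma>_def transpose_integral)
qed

lemma normalizer_has_derivative:
  assumes "norm (\<theta> - \<theta>0) < d"
  shows "(normalizer has_derivative (\<lambda>v. v \<bullet> cgf1 (\<theta> - \<theta>0))) (at \<theta>)"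
proof -
  have "((\<lambda>\<theta>. \<theta> - \<theta>0) has_derivative (\<lambda>v. v)) (at \<theta>)"
    by (auto intro!: derivative_eq_intros)
  from has_derivative_compose[OF this cgf_has_derivative[OF assms]]
  have "((\<lambda>\<theta>. a0 + ln (mgf (\<theta> - \<theta>0))) has_derivative (\<lambda>v. 0 + v \<bullet> cgf1 (\<theta> - \<theta>0))) (at \<theta>)"
    by (intro has_derivative_add has_derivative_const)
  then show ?thesis by (simp add: normalizer_def[abs_def])
qed

lemma resid_has_derivative:
  assumes "norm (\<theta> - \<theta>0) < d"
  shows "((\<lambda>\<theta>. resid \<theta> x) has_derivative (\<lambda>v. - (cgf2 (\<theta> - \<theta>0) *v v))) (at \<theta>)"
proof -
  have "((\<lambda>\<theta>. \<theta> - \<theta>0) has_derivative (\<lambda>v. v)) (at \<theta>)"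
    by (auto intro!: derivative_eq_intros)
  from has_derivative_compose[OF this cgf1_has_derivative[OF assms]]
  have "((\<lambda>\<theta>. c x - cgf1 (\<theta> - \<theta>0)) has_derivative (\<lambda>v. 0 - cgf2 (\<theta> - \<theta>0) *v v)) (at \<theta>)"
    by (intro has_derivative_diff has_derivative_const)
  then show ?thesis by (simp add: resid_def[abs_def])
qed

lemma logf_has_derivative:
  assumes "norm (\<theta> - \<theta>0) < d"
  shows "((\<lambda>\<theta>. logf \<theta> x) has_derivative (\<lambda>v. v \<bullet> resid \<theta> x)) (at \<theta>)"
  unfolding logf_def[abs_def]
  by (auto intro!: derivative_eq_intros normalizer_has_derivative assms simp: resid_def inner_diff_right)

lemma open_param_ball: "open {\<theta>. norm (\<theta> - \<theta>0) < d}"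
  using open_ball[of \<theta>0 d] by (simp add: ball_def dist_norm norm_minus_commute)

lemma score_eq:
  assumes "norm (\<theta> - \<theta>0) < d"
  shows "score f x \<theta> = resid \<theta> x"
  unfolding score_def
proof (rule gradient_eqI, unfold gderiv_def)
  \<comment> \<open>\<open>f\<close> has the form \<open>exp (logf \<theta> x)\<close> on
    \<open>\<Theta>\<close> only, so the derivative is transferred on an open ball inside
    \<open>\<Theta>\<close>.\<close>
  show "((\<lambda>t. ln (f x t)) has_derivative (\<lambda>h. h \<bullet> resid \<theta> x)) (at \<theta>)"
    by (rule has_derivative_transform_within_open[OF logf_has_derivative[OF assms] open_param_ball])
       (use assms in \<open>auto simp: f_logf in_param\<close>)
qed

text \<open>Here and in the Jacobian below, \<open>r\<close> stands for the distortion parameter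
  itself, so the density is raised to the power \<open>1 - r\<close>.\<close>

lemma mod_score_eq:
  assumes "norm (\<theta> - \<theta>0) < d"
  shows "mod_score f x \<theta> r = exp ((1 - r) * logf \<theta> x) *\<^sub>R resid \<theta> x"
  using assms by (simp add: mod_score_def score_eq f_logf in_param powr_def)

lemma jacobian_mod_score:
  assumes "norm (\<theta> - \<theta>0) < d"
  shows "jacobian (\<lambda>\<theta>. mod_score f x \<theta> r) (at \<theta>) =
    exp ((1 - r) * logf \<theta> x) *\<^sub>R ((1 - r) *\<^sub>R outer (resid \<theta> x) (resid \<theta> x) - cgf2 (\<theta> - \<theta>0))"
    (is "_ = ?A")
proof (rule jacobian_eqI, rule has_derivative_transform_within_open[OF _ open_param_ball])
  have "((\<lambda>\<theta>. exp ((1 - r) * logf \<theta> x) *\<^sub>R resid \<theta> x) has_derivative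
      (\<lambda>v. exp ((1 - r) * logf \<theta> x) *\<^sub>R (- (cgf2 (\<theta> - \<theta>0) *v v)) +
        (((1 - r) * (v \<bullet> resid \<theta> x)) * exp ((1 - r) * logf \<theta> x)) *\<^sub>R resid \<theta> x)) (at \<theta>)"
    by (auto intro!: derivative_eq_intros logf_has_derivative resid_has_derivative assms)
  then show "((\<lambda>\<theta>. exp ((1 - r) * logf \<theta> x) *\<^sub>R resid \<theta> x) has_derivative (\<lambda>v. ?A *v v)) (at \<theta>)"
    by (rule has_derivative_eq_rhs)
       (simp add: fun_eq_iff matrix_vector_mult_diff_rdistrib outer_mult_vector inner_commute
         scaleR_matrix_vector_assoc[symmetric] scaleR_diff_right mult_ac)
qed (use assms in \<open>auto simp: mod_score_eq\<close>)

lemma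
  assumes t: "t \<longlonglongrightarrow> \<theta>0"
  shows cgf1_tendsto: "(\<lambda>n. cgf1 (t n - \<theta>0)) \<longlonglongrightarrow> 0"
    and cgf2_tendsto: "(\<lambda>n. cgf2 (t n - \<theta>0)) \<longlonglongrightarrow> \<Sigma>"
    and normalizer_tendsto: "(\<lambda>n. normalizer (t n)) \<longlonglongrightarrow> normalizer \<theta>0"
    and logf_tendsto: "(\<lambda>n. logf (t n) x) \<longlonglongrightarrow> logf \<theta>0 x"
    and resid_tendsto: "(\<lambda>n. resid (t n) x) \<longlonglongrightarrow> c x"
proof -
  have t0: "(\<lambda>n. t n - \<theta>0) \<longlonglongrightarrow> 0" using t by (simp add: LIM_zero)
  have "isCont cgf1 0" by (rule has_derivative_continuous[OF cgf1_has_derivative]) (simp add: d_pos)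
  from isCont_tendsto_compose[OF this t0] show *: "(\<lambda>n. cgf1 (t n - \<theta>0)) \<longlonglongrightarrow> 0" by simp
  have "isCont cgf2 0"
    using continuous_on_cgf2 d_pos by (simp add: continuous_on_eq_continuous_at)
  from isCont_tendsto_compose[OF this t0] show "(\<lambda>n. cgf2 (t n - \<theta>0)) \<longlonglongrightarrow> \<Sigma>" by (simp add: cgf2_0)
  have "isCont normalizer \<theta>0"
    by (rule has_derivative_continuous[OF normalizer_has_derivative]) (simp add: d_pos)
  from isCont_tendsto_compose[OF this t] show **: "(\<lambda>n. normalizer (t n)) \<longlonglongrightarrow> normalizer \<theta>0" .
  show "(\<lambda>n. logf (t n) x) \<longlonglongrightarrow> logf \<theta>0 x"
    unfolding logf_def by (intro tendsto_intros t **)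
  show "(\<lambda>n. resid (t n) x) \<longlonglongrightarrow> c x"
    unfolding resid_def using tendsto_diff[OF tendsto_const[of "c x"] *] by simp
qed

text \<open>Common to the limits of \<open>J_seq\<close> and \<open>K_seq\<close>: the weights tend
  to 1. As \<open>r n *\<^sub>R t n\<close> tends to 0, it enters the ball of exponential moments,
  which dominates the weight; \<open>exp 1\<close> covers the normaliser. Quadratic growth is that
  of a product of two residuals.\<close>

lemma tendsto_weighted_integral:
  fixes G :: "nat \<Rightarrow> 'x \<Rightarrow> 'v::{banach, second_countable_topology}"
  assumes r: "r \<longlonglongrightarrow> 0" and t: "t \<longlonglongrightarrow> \<theta>0"
    and [measurable]: "\<And>n. G n \<in> borel_measurable P" "G' \<in> borel_measurable P"
    and lim: "\<And>x. (\<lambda>n. G n x) \<longlonglongrightarrow> G' x"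
    and bd: "\<forall>\<^sub>F n in sequentially. \<forall>x. norm (G n x) \<le> B + 2 * (norm (c x))\<^sup>2"
  shows "(\<lambda>n. \<integral>x. exp (r n * logf (t n) x) *\<^sub>R G n x \<partial>P) \<longlonglongrightarrow> (\<integral>x. G' x \<partial>P)"
proof (rule dominated_convergence_eventually)
  show "integrable P (\<lambda>x. exp 1 * (B * (norm (c x) ^ 0 * exp (d * norm (c x)))
      + 2 * (norm (c x) ^ 2 * exp (d * norm (c x)))))"
    by (intro integrable_mult_right Bochner_Integration.integrable_add integrable_power_exp)
  show "(\<lambda>n. exp (r n * logf (t n) x) *\<^sub>R G n x) \<longlonglongrightarrow> G' x" for x
  proof -
    have "(\<lambda>n. exp (r n * logf (t n) x) *\<^sub>R G n x) \<longlonglongrightarrow> exp (0 * logf \<theta>0 x) *\<^sub>R G' x"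
      by (intro tendsto_intros lim r logf_tendsto t)
    then show ?thesis by simp
  qed
  have "(\<lambda>n. norm (r n *\<^sub>R t n)) \<longlonglongrightarrow> norm (0 *\<^sub>R \<theta>0)" "(\<lambda>n. \<bar>r n * normalizer (t n)\<bar>) \<longlonglongrightarrow> \<bar>0 * normalizer \<theta>0\<bar>"
    by (intro tendsto_intros r t normalizer_tendsto)+
  then have "\<forall>\<^sub>F n in sequentially. norm (r n *\<^sub>R t n) < d"
    "\<forall>\<^sub>F n in sequentially. \<bar>r n * normalizer (t n)\<bar> < 1"
    using d_pos by (auto intro: order_tendstoD)
  with bd show "\<forall>\<^sub>F n in sequentially. \<forall>x. norm (exp (r n * logf (t n) x) *\<^sub>R G n x)
      \<le> exp 1 * (B * (norm (c x) ^ 0 * exp (d * norm (c x)))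
        + 2 * (norm (c x) ^ 2 * exp (d * norm (c x))))"
  proof eventually_elim
    case (elim n)
    show ?case
    proof
      fix x
      have "r n * logf (t n) x = (r n *\<^sub>R t n) \<bullet> c x - r n * normalizer (t n)"
        by (simp add: logf_def right_diff_distrib)
      also have "\<dots> \<le> d * norm (c x) + 1"
        using abs_inner_le_norm[of "r n *\<^sub>R t n" d "c x"] elim(2,3) by linarith
      finally have "exp (r n * logf (t n) x) * norm (G n x)
          \<le> exp (d * norm (c x) + 1) * (B + 2 * (norm (c x))\<^sup>2)"
        using elim(1) by (intro mult_mono) auto
      then show "norm (exp (r n * logf (t n) x) *\<^sub>R G n x)
          \<le> exp 1 * (B * (norm (c x) ^ 0 * exp (d * norm (c x)))
            + 2 * (norm (c x) ^ 2 * exp (d * norm (c x))))"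
        by (simp add: exp_add algebra_simps)
    qed
  qed
qed measurable

lemma norm_resid_square_le:
  assumes "norm (cgf1 (\<theta> - \<theta>0)) \<le> 1"
  shows "(norm (resid \<theta> x))\<^sup>2 \<le> 2 + 2 * (norm (c x))\<^sup>2"
proof -
  have "norm (resid \<theta> x) \<le> norm (c x) + 1"
    unfolding resid_def using norm_triangle_ineq4[of "c x" "cgf1 (\<theta> - \<theta>0)"] assms by linarith
  then have "(norm (resid \<theta> x))\<^sup>2 \<le> (norm (c x) + 1)\<^sup>2"
    by (intro power_mono) auto
  also have "\<dots> \<le> 2 + 2 * (norm (c x))\<^sup>2"
    using sum_squares_bound[of "norm (c x)" 1] by (simp add: power2_sum)
  finally show ?thesis .
qed

section \<open>Limits of the matrices J, K and V\<close>

context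
  fixes t :: "nat \<Rightarrow> real^'p" and q :: "nat \<Rightarrow> real"
  assumes t: "t \<longlonglongrightarrow> \<theta>0" and q: "q \<longlonglongrightarrow> 1"
begin

text \<open>The matrices of the statement, with \<open>P\<close> as the measure and along a sequence
  \<open>t\<close> that is only known to tend to \<open>\<theta>0\<close>; \<open>ts\<close> is
  substituted later.\<close>

definition J_seq :: "nat \<Rightarrow> real^'p^'p" where
  "J_seq n = (\<integral>x. jacobian (\<lambda>\<theta>. mod_score f x \<theta> (q n)) (at (t n)) \<partial>P)"
definition K_seq :: "nat \<Rightarrow> real^'p^'p" where
  "K_seq n = (\<integral>x. outer (mod_score f x (t n) (q n)) (mod_score f x (t n) (q n)) \<partial>P)"
definition V_seq :: "nat \<Rightarrow> real^'p^'p" where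
  "V_seq n = matrix_inv (J_seq n) ** K_seq n ** matrix_inv (J_seq n)"

lemma one_minus_q_tendsto: "(\<lambda>n. 1 - q n) \<longlonglongrightarrow> 0"
  using tendsto_diff[OF tendsto_const[of 1] q] by simp

lemma eventually_param: "\<forall>\<^sub>F n in sequentially. norm (t n - \<theta>0) < d"
  using tendstoD[OF t d_pos] by (simp add: dist_norm)

lemma eventually_cgf1_le: "\<forall>\<^sub>F n in sequentially. norm (cgf1 (t n - \<theta>0)) \<le> 1"
  using tendstoD[OF cgf1_tendsto[OF t], of 1] by (auto elim: eventually_mono)

text \<open>Differentiating the weight produces the outer product with the factor
  \<open>1 - q n\<close>, which dies out; the Hessian of the normaliser survives.\<close>

lemma J_seq_tendsto: "J_seq \<longlonglongrightarrow> - \<Sigma>"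
proof -
  have "(\<lambda>n. \<integral>x. exp ((1 - q n) * logf (t n) x) *\<^sub>R
      ((1 - q n) *\<^sub>R outer (resid (t n) x) (resid (t n) x) - cgf2 (t n - \<theta>0)) \<partial>P) \<longlonglongrightarrow> (\<integral>x. - \<Sigma> \<partial>P)"
  proof (rule tendsto_weighted_integral[OF one_minus_q_tendsto t])
    fix x
    have "(\<lambda>n. (1 - q n) *\<^sub>R outer (resid (t n) x) (resid (t n) x) - cgf2 (t n - \<theta>0))
        \<longlonglongrightarrow> 0 *\<^sub>R outer (c x) (c x) - \<Sigma>"
      by (intro tendsto_intros one_minus_q_tendsto tendsto_outer resid_tendsto cgf2_tendsto t)
    then show "(\<lambda>n. (1 - q n) *\<^sub>R outer (resid (t n) x) (resid (t n) x) - cgf2 (t n - \<theta>0)) \<longlonglongrightarrow> - \<Sigma>"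
      by simp
  next
    have "\<forall>\<^sub>F n in sequentially. dist (cgf2 (t n - \<theta>0)) \<Sigma> < 1"
      by (intro tendstoD cgf2_tendsto t) auto
    moreover have "\<forall>\<^sub>F n in sequentially. dist (1 - q n) 0 < 1"
      by (intro tendstoD one_minus_q_tendsto) auto
    \<comment> \<open>The constant is 2 from \<open>norm_resid_square_le\<close> plus
      \<open>1 + norm \<Sigma>\<close> from the convergence of \<open>cgf2\<close>.\<close>
    ultimately show "\<forall>\<^sub>F n in sequentially. \<forall>x. norm ((1 - q n) *\<^sub>R outer (resid (t n) x) (resid (t n) x)
        - cgf2 (t n - \<theta>0)) \<le> (3 + norm \<Sigma>) + 2 * (norm (c x))\<^sup>2"
      using eventually_cgf1_le
    proof eventually_elim
      case (elim n)
      show ?case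
      proof
        fix x
        have "norm ((1 - q n) *\<^sub>R outer (resid (t n) x) (resid (t n) x)) \<le> 1 * (norm (resid (t n) x))\<^sup>2"
          using elim by (simp add: norm_outer power2_eq_square mult_left_le_one_le)
        moreover have "norm (cgf2 (t n - \<theta>0)) \<le> 1 + norm \<Sigma>"
          using elim norm_triangle_ineq2[of "cgf2 (t n - \<theta>0)" \<Sigma>] by (simp add: dist_norm)
        moreover have "(norm (resid (t n) x))\<^sup>2 \<le> 2 + 2 * (norm (c x))\<^sup>2"
          by (rule norm_resid_square_le) (use elim in auto)
        ultimately show "norm ((1 - q n) *\<^sub>R outer (resid (t n) x) (resid (t n) x)
            - cgf2 (t n - \<theta>0)) \<le> (3 + norm \<Sigma>) + 2 * (norm (c x))\<^sup>2"
          using norm_triangle_ineq4[of "(1 - q n) *\<^sub>R outer (resid (t n) x) (resid (t n) x)" "cgf2 (t n - \<theta>0)"]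
          by linarith
      qed
    qed
  qed measurable
  then have lim: "(\<lambda>n. \<integral>x. exp ((1 - q n) * logf (t n) x) *\<^sub>R
      ((1 - q n) *\<^sub>R outer (resid (t n) x) (resid (t n) x) - cgf2 (t n - \<theta>0)) \<partial>P) \<longlonglongrightarrow> - \<Sigma>"
    by (simp add: prob_space)
  show ?thesis
    by (rule Lim_transform_eventually[OF lim])
       (use eventually_param in \<open>eventually_elim, simp add: J_seq_def jacobian_mod_score\<close>)
qed

text \<open>The two weights multiply, hence the exponent \<open>2 * (1 - q n)\<close>, which still
  vanishes.\<close>

lemma K_seq_tendsto: "K_seq \<longlonglongrightarrow> \<Sigma>"
proof -
  have r: "(\<lambda>n. 2 * (1 - q n)) \<longlonglongrightarrow> 0"
    using tendsto_mult_right_zero[OF one_minus_q_tendsto, of 2] by simp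
  have lim: "(\<lambda>n. \<integral>x. exp ((2 * (1 - q n)) * logf (t n) x) *\<^sub>R outer (resid (t n) x) (resid (t n) x) \<partial>P)
      \<longlonglongrightarrow> (\<integral>x. outer (c x) (c x) \<partial>P)"
  proof (rule tendsto_weighted_integral[OF r t, where B=2])
    show "\<forall>\<^sub>F n in sequentially. \<forall>x. norm (outer (resid (t n) x) (resid (t n) x)) \<le> 2 + 2 * (norm (c x))\<^sup>2"
      using eventually_cgf1_le
      by eventually_elim (use norm_resid_square_le in \<open>simp add: norm_outer power2_eq_square\<close>)
  next
    show "(\<lambda>n. outer (resid (t n) x) (resid (t n) x)) \<longlonglongrightarrow> outer (c x) (c x)" for x
      by (intro tendsto_outer resid_tendsto t)
  qed measurable
  show ?thesis
    unfolding \<Sigma>_def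
  proof (rule Lim_transform_eventually[OF lim])
    show "\<forall>\<^sub>F n in sequentially. (\<integral>x. exp ((2 * (1 - q n)) * logf (t n) x) *\<^sub>R outer (resid (t n) x) (resid (t n) x) \<partial>P) = K_seq n"
      using eventually_param
    proof eventually_elim
      case (elim n)
      have "outer (a *\<^sub>R u) (a *\<^sub>R u) = (a * a) *\<^sub>R outer u u" for a and u :: "real^'p"
        by (simp add: outer_def vec_eq_iff)
      moreover have "exp (2 * (1 - q n) * logf (t n) x) = exp ((1 - q n) * logf (t n) x) * exp ((1 - q n) * logf (t n) x)" for x
        by (simp add: mult_exp_exp)
      ultimately show ?case
        using elim by (simp add: K_seq_def mod_score_eq)
    qed
  qed
qed

lemma V_seq_tendsto: "V_seq \<longlonglongrightarrow> matrix_inv \<Sigma>"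
proof -
  have inv: "invertible \<Sigma>" by (rule sym_pos_def_invertible[OF sym_pos_def_\<Sigma>])
  have neg: "(- \<Sigma>) *v y = - (\<Sigma> *v y)" for y
    using matrix_vector_mult_diff_rdistrib[of 0 \<Sigma> y] by simp
  have invm: "invertible (- \<Sigma>)"
    by (rule invertible_if_bounded_below[of "norm (matrix_inv \<Sigma>)"])
       (simp add: neg matrix_inv_bounded_below[OF inv])
  have minv: "matrix_inv (- \<Sigma>) *v y = - (matrix_inv \<Sigma> *v y)" for y
  proof -
    have "(- \<Sigma>) *v (- (matrix_inv \<Sigma> *v y)) = y"
      using matrix_vector_mult_diff_distrib[of \<Sigma> 0 "matrix_inv \<Sigma> *v y"]
      by (simp add: neg matrix_inv_mult_vector(2)[OF inv])
    then show ?thesis using matrix_inv_mult_vector(1)[OF invm] by metis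
  qed
  have "V_seq \<longlonglongrightarrow> matrix_inv (- \<Sigma>) ** \<Sigma> ** matrix_inv (- \<Sigma>)"
    unfolding V_seq_def[abs_def]
    by (intro tendsto_matrix_mult tendsto_matrix_inv J_seq_tendsto K_seq_tendsto invm)
  also have "matrix_inv (- \<Sigma>) ** \<Sigma> ** matrix_inv (- \<Sigma>) = matrix_inv \<Sigma>"
  proof -
    have "\<Sigma> *v (- y) = - (\<Sigma> *v y)" for y
      using matrix_vector_mult_diff_distrib[of \<Sigma> 0 y] by simp
    moreover have "matrix_inv \<Sigma> *v (- y) = - (matrix_inv \<Sigma> *v y)" for y
      using matrix_vector_mult_diff_distrib[of "matrix_inv \<Sigma>" 0 y] by simp
    ultimately show ?thesis
      by (simp add: matrix_eq minv matrix_inv_mult_vector(2)[OF inv] flip: matrix_vector_mul_assoc)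
  qed
  finally show ?thesis .
qed

text \<open>Symmetry of \<open>V_seq n\<close> is derived once \<open>J_seq n\<close> is invertible,
  because \<open>matrix_inv\<close> of a singular matrix is unspecified; closeness to
  \<open>- \<Sigma>\<close> ensures this.\<close>

lemma eventually_sym_pos_def_V_seq: "\<forall>\<^sub>F n in sequentially. sym_pos_def (V_seq n)"
proof (rule eventually_sym_pos_def[OF V_seq_tendsto sym_pos_def_matrix_inv[OF sym_pos_def_\<Sigma>]])
  have "invertible \<Sigma>" by (rule sym_pos_def_invertible[OF sym_pos_def_\<Sigma>])
  then have "invertible (- \<Sigma>)"
    using scalar_invertible[of "-1" \<Sigma>] by simp
  from eventually_invertible[OF J_seq_tendsto this] eventually_param
  show "\<forall>\<^sub>F n in sequentially. transpose (V_seq n) = V_seq n"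
  proof eventually_elim
    case (elim n)
    have "transpose (J_seq n) = J_seq n"
      using elim by (simp add: J_seq_def transpose_integral jacobian_mod_score transpose_cgf2
          linear_diff[OF bounded_linear.linear[OF bounded_linear_transpose]]
          linear_scale[OF bounded_linear.linear[OF bounded_linear_transpose]])
    moreover have "transpose (K_seq n) = K_seq n"
      by (simp add: K_seq_def transpose_integral)
    ultimately show ?case
      using elim by (simp add: V_seq_def matrix_transpose_mul symmetric_matrix_inv matrix_mul_assoc)
  qed
qed

lemma
  shows spd_sqrt_V_tendsto: "(\<lambda>n. spd_sqrt (V_seq n)) \<longlonglongrightarrow> spd_sqrt (matrix_inv \<Sigma>)"
    and inv_sqrt_V_tendsto:
      "(\<lambda>n. matrix_inv (spd_sqrt (V_seq n))) \<longlonglongrightarrow> matrix_inv (spd_sqrt (matrix_inv \<Sigma>))"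
proof -
  show *: "(\<lambda>n. spd_sqrt (V_seq n)) \<longlonglongrightarrow> spd_sqrt (matrix_inv \<Sigma>)"
    by (intro tendsto_spd_sqrt V_seq_tendsto eventually_sym_pos_def_V_seq sym_pos_def_matrix_inv sym_pos_def_\<Sigma>)
  show "(\<lambda>n. matrix_inv (spd_sqrt (V_seq n))) \<longlonglongrightarrow> matrix_inv (spd_sqrt (matrix_inv \<Sigma>))"
    by (intro tendsto_matrix_inv * sym_pos_def_invertible sym_pos_def_spd_sqrt sym_pos_def_matrix_inv sym_pos_def_\<Sigma>)
qed

end

end

section \<open>Averages over independent samples\<close>

locale iid_sample = prob_space M + P: prob_space P for M :: "'w measure" and P :: "'x measure" +
  fixes X :: "nat \<Rightarrow> 'w \<Rightarrow> 'x"
  assumes indep: "indep_vars (\<lambda>_. P) X UNIV"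
    and distr_X: "\<And>i. distr M P (X i) = P"
begin

lemma X_measurable [measurable]: "X i \<in> M \<rightarrow>\<^sub>M P"
  using indep by (simp add: indep_vars_def2)

lemma
  fixes h :: "'x \<Rightarrow> 'v::{banach, second_countable_topology}"
  assumes "h \<in> borel_measurable P"
  shows integral_X: "(\<integral>\<omega>. h (X i \<omega>) \<partial>M) = (\<integral>x. h x \<partial>P)"
    and integrable_X_iff: "integrable M (\<lambda>\<omega>. h (X i \<omega>)) \<longleftrightarrow> integrable P h"
  using integral_distr[OF X_measurable assms, of i] integrable_distr_eq[OF X_measurable assms, of i]
  by (simp_all add: distr_X)

text \<open>At \<open>n = 0\<close> the average is 0, hence the condition \<open>n \<ge> 1\<close>
  in identities with constants or means.\<close>

definition avg :: "nat \<Rightarrow> ('x \<Rightarrow> 'v::real_vector) \<Rightarrow> 'w \<Rightarrow> 'v" where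
  "avg n h \<omega> = (1 / real n) *\<^sub>R (\<Sum>i<n. h (X i \<omega>))"

lemma borel_measurable_avg [measurable]:
  fixes h :: "'x \<Rightarrow> 'v::{real_normed_vector, second_countable_topology}"
  assumes [measurable]: "h \<in> borel_measurable P"
  shows "avg n h \<in> borel_measurable M"
  unfolding avg_def by measurable

lemma avg_add: "avg n (\<lambda>x. h x + k x) \<omega> = avg n h \<omega> + avg n k \<omega>"
  and avg_diff: "avg n (\<lambda>x. h x - k x) \<omega> = avg n h \<omega> - avg n k \<omega>"
  and avg_scaleR: "avg n (\<lambda>x. r *\<^sub>R h x) \<omega> = r *\<^sub>R avg n h \<omega>"
  by (simp_all add: avg_def sum.distrib sum_subtractf scaleR_add_right scaleR_diff_right
      scaleR_sum_right[symmetric])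

lemma avg_cmult: "avg n (\<lambda>x. r * h x) \<omega> = r * avg n h \<omega>" for r :: real
  using avg_scaleR[of n r h] by simp

lemma avg_const: "n \<ge> 1 \<Longrightarrow> avg n (\<lambda>_. v) \<omega> = v"
  by (simp add: avg_def sum_constant_scaleR)

lemma avg_linear: "bounded_linear L \<Longrightarrow> avg n (\<lambda>x. L (h x)) \<omega> = L (avg n h \<omega>)"
  by (simp add: avg_def linear_simps bounded_linear.linear linear_sum linear_cmul)

lemma avg_mono: "(\<And>x. h x \<le> k x) \<Longrightarrow> avg n h \<omega> \<le> avg n k \<omega>" for h k :: "'x \<Rightarrow> real"
  by (auto simp: avg_def intro!: mult_left_mono sum_mono divide_right_mono)

lemma norm_avg_le: "norm (avg n h \<omega>) \<le> avg n (\<lambda>x. norm (h x)) \<omega>"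
  by (auto simp: avg_def intro!: divide_right_mono norm_sum)

lemma avg_nonneg: "(\<And>x. h x \<ge> 0) \<Longrightarrow> avg n h \<omega> \<ge> 0" for h :: "'x \<Rightarrow> real"
  by (auto simp: avg_def intro!: divide_nonneg_nonneg sum_nonneg)

lemma
  fixes h :: "'x \<Rightarrow> 'v::{banach, second_countable_topology}"
  assumes h: "integrable P h"
  shows integrable_avg: "integrable M (avg n h)"
    and expectation_avg: "n \<ge> 1 \<Longrightarrow> (\<integral>\<omega>. avg n h \<omega> \<partial>M) = (\<integral>x. h x \<partial>P)"
proof -
  have m: "h \<in> borel_measurable P" using h by auto
  have i: "integrable M (\<lambda>\<omega>. h (X i \<omega>))" for i using h by (simp add: integrable_X_iff[OF m])
  show "integrable M (avg n h)" unfolding avg_def using i by auto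
  show "n \<ge> 1 \<Longrightarrow> (\<integral>\<omega>. avg n h \<omega> \<partial>M) = (\<integral>x. h x \<partial>P)"
    unfolding avg_def using i by (simp add: integral_X[OF m] sum_constant_scaleR)
qed

lemma expectation_avg_le:
  fixes h :: "'x \<Rightarrow> real"
  assumes h: "integrable P h" "\<And>x. h x \<ge> 0"
  shows "(\<integral>\<omega>. avg n h \<omega> \<partial>M) \<le> (\<integral>x. h x \<partial>P)"
  using expectation_avg[OF h(1), of n] integral_nonneg_AE[of h P] h(2)
  by (cases "n = 0") (auto simp: avg_def)

text \<open>Expand the square: independence and mean zero remove the off-diagonal terms.\<close>

lemma
  fixes h :: "'x \<Rightarrow> real"
  assumes h: "integrable P h" and h2: "integrable P (\<lambda>x. (h x)\<^sup>2)" and mean: "(\<integral>x. h x \<partial>P) = 0"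
  shows integrable_square_sum: "integrable M (\<lambda>\<omega>. (\<Sum>i<n. h (X i \<omega>))\<^sup>2)"
    and expectation_square_sum: "(\<integral>\<omega>. (\<Sum>i<n. h (X i \<omega>))\<^sup>2 \<partial>M) = real n * (\<integral>x. (h x)\<^sup>2 \<partial>P)"
proof -
  have m [measurable]: "h \<in> borel_measurable P" using h by auto
  have ind: "indep_vars (\<lambda>_. borel) (\<lambda>i \<omega>. h (X i \<omega>)) {i, j}" for i j
    using indep_vars_compose2[OF indep_vars_subset[OF indep subset_UNIV], where Y="\<lambda>_. h" and N="\<lambda>_. borel"] by simp
  have i: "integrable M (\<lambda>\<omega>. h (X i \<omega>))" for i using h by (simp add: integrable_X_iff[OF m])
  have p: "integrable M (\<lambda>\<omega>. h (X i \<omega>) * h (X j \<omega>)) \<and>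
      (\<integral>\<omega>. h (X i \<omega>) * h (X j \<omega>) \<partial>M) = (if i = j then \<integral>x. (h x)\<^sup>2 \<partial>P else 0)" for i j
  proof (cases "i = j")
    case True
    then show ?thesis
      using h2 integrable_X_iff[of "\<lambda>x. (h x)\<^sup>2" i] integral_X[of "\<lambda>x. (h x)\<^sup>2" i]
      by (simp add: power2_eq_square)
  next
    case False
    then show ?thesis
      using indep_vars_integrable[OF _ ind[of i j] i] indep_vars_lebesgue_integral[OF _ ind[of i j] i]
      by (simp add: integral_X[OF m] mean)
  qed
  have eq: "(\<Sum>i<n. h (X i \<omega>))\<^sup>2 = (\<Sum>i<n. \<Sum>j<n. h (X i \<omega>) * h (X j \<omega>))" for \<omega>
    by (simp add: power2_eq_square sum_product)
  show "integrable M (\<lambda>\<omega>. (\<Sum>i<n. h (X i \<omega>))\<^sup>2)" unfolding eq using p by auto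
  show "(\<integral>\<omega>. (\<Sum>i<n. h (X i \<omega>))\<^sup>2 \<partial>M) = real n * (\<integral>x. (h x)\<^sup>2 \<partial>P)"
    unfolding eq using p by (simp add: sum.delta)
qed

text \<open>The scalar identity is applied to each coordinate and summed; the factor
  \<open>sqrt n\<close> balances the normalisation of the average.\<close>

lemma
  fixes h :: "'x \<Rightarrow> real^'p"
  assumes m [measurable]: "h \<in> borel_measurable P" and h2: "integrable P (\<lambda>x. (norm (h x))\<^sup>2)"
    and mean: "(\<integral>x. h x \<partial>P) = 0" and n: "n \<ge> 1"
  shows integrable_norm_square_avg: "integrable M (\<lambda>\<omega>. (norm (sqrt n *\<^sub>R avg n h \<omega>))\<^sup>2)"
    and expectation_norm_square_avg:
      "(\<integral>\<omega>. (norm (sqrt n *\<^sub>R avg n h \<omega>))\<^sup>2 \<partial>M) = (\<integral>x. (norm (h x))\<^sup>2 \<partial>P)"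
proof -
  have sq: "(norm v)\<^sup>2 = (\<Sum>k\<in>UNIV. (v $ k)\<^sup>2)" for v :: "real^'p"
    unfolding power2_norm_eq_inner by (simp add: inner_vec_def power2_eq_square)
  have mk [measurable]: "(\<lambda>x. h x $ k) \<in> borel_measurable P" for k
  proof -
    have "(\<lambda>x. h x \<bullet> axis k 1) \<in> borel_measurable P" by measurable
    then show ?thesis by (simp add: inner_axis)
  qed
  have h2k: "integrable P (\<lambda>x. (h x $ k)\<^sup>2)" for k
  proof (rule Bochner_Integration.integrable_bound[OF h2])
    have "(h x $ k)\<^sup>2 \<le> (norm (h x))\<^sup>2" for x
      using component_le_norm_cart[of "h x" k] by (simp add: abs_le_square_iff[symmetric])
    then show "AE x in P. norm ((h x $ k)\<^sup>2) \<le> norm ((norm (h x))\<^sup>2)" by simp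
  qed measurable
  have hk: "integrable P (\<lambda>x. h x $ k)" for k
    by (rule P.square_integrable_imp_integrable[OF _ h2k]) measurable
  have "integrable P h"
    using P.square_integrable_imp_integrable[OF _ h2] by (simp add: integrable_norm_iff)
  then have meank: "(\<integral>x. h x $ k \<partial>P) = 0" for k
    using integral_bounded_linear[OF bounded_linear_vec_nth, of P h k] mean by simp
  have eq: "(norm (sqrt n *\<^sub>R avg n h \<omega>))\<^sup>2 = (1 / n) * (\<Sum>k\<in>UNIV. (\<Sum>i<n. h (X i \<omega>) $ k)\<^sup>2)" for \<omega>
  proof -
    have "sqrt n *\<^sub>R avg n h \<omega> = (1 / sqrt n) *\<^sub>R (\<Sum>i<n. h (X i \<omega>))"
    proof -
      have "sqrt n * (1 / n) = 1 / sqrt n" using n by (simp add: field_simps)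
      then show ?thesis by (simp add: avg_def)
    qed
    then show ?thesis
      using n by (simp add: power_divide sq[of "\<Sum>i<n. h (X i \<omega>)"])
  qed
  note S = integrable_square_sum[OF hk h2k meank, where n=n] expectation_square_sum[OF hk h2k meank, where n=n]
  show "integrable M (\<lambda>\<omega>. (norm (sqrt n *\<^sub>R avg n h \<omega>))\<^sup>2)"
    unfolding eq using S(1) by auto
  have "(\<integral>\<omega>. (norm (sqrt n *\<^sub>R avg n h \<omega>))\<^sup>2 \<partial>M) = (\<Sum>k\<in>UNIV. \<integral>x. (h x $ k)\<^sup>2 \<partial>P)"
    unfolding eq using S n by (simp add: sum_distrib_left[symmetric])
  then show "(\<integral>\<omega>. (norm (sqrt n *\<^sub>R avg n h \<omega>))\<^sup>2 \<partial>M) = (\<integral>x. (norm (h x))\<^sup>2 \<partial>P)"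
    unfolding sq using h2k by simp
qed

text \<open>The central limit theorem concerns the standardised sum; evaluating its characteristic
  function at \<open>\<sigma>\<close> undoes the division by \<open>\<sigma>\<close>.\<close>

lemma central_limit_char:
  fixes h :: "'x \<Rightarrow> real"
  assumes h: "integrable P h" and h2: "integrable P (\<lambda>x. (h x)\<^sup>2)" and mean: "(\<integral>x. h x \<partial>P) = 0"
    and \<sigma>: "(\<integral>x. (h x)\<^sup>2 \<partial>P) = \<sigma>\<^sup>2" "\<sigma> > 0"
  shows "(\<lambda>n. \<integral>\<omega>. cis (sqrt n * avg n h \<omega>) \<partial>M) \<longlonglongrightarrow> of_real (exp (- \<sigma>\<^sup>2 / 2))"
proof -
  have m [measurable]: "h \<in> borel_measurable P" using h by auto
  define Y where "Y i \<omega> = h (X i \<omega>)" for i \<omega>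
  have [measurable]: "Y i \<in> borel_measurable M" for i unfolding Y_def by measurable
  have ind: "indep_vars (\<lambda>_. borel) Y UNIV"
    unfolding Y_def using indep_vars_compose2[OF indep, where Y="\<lambda>_. h" and N="\<lambda>_. borel"] by simp
  have EY: "expectation (Y i) = 0" for i by (simp add: Y_def[abs_def] integral_X[OF m] mean)
  have Y2: "integrable M (\<lambda>\<omega>. (Y i \<omega>)\<^sup>2)" "variance (Y i) = \<sigma>\<^sup>2" for i
    using h2 \<sigma> unfolding EY unfolding Y_def
    by (simp_all add: integrable_X_iff[of "\<lambda>x. (h x)\<^sup>2"] integral_X[of "\<lambda>x. (h x)\<^sup>2"])
  have D: "distr M borel (Y i) = distr P borel h" for i
  proof -
    have "distr P borel h = distr (distr M P (X i)) borel h" by (simp add: distr_X)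
    also have "\<dots> = distr M borel (Y i)" by (subst distr_distr) (auto simp: Y_def[abs_def] comp_def)
    finally show ?thesis by simp
  qed
  have "weak_conv_m (\<lambda>n. distr M borel (\<lambda>\<omega>. (\<Sum>i<n. Y i \<omega>) / sqrt (n * \<sigma>\<^sup>2))) std_normal_distribution"
    by (rule central_limit_theorem_zero_mean[OF ind EY \<sigma>(2) Y2 D])
  then have "(\<lambda>n. char (distr M borel (\<lambda>\<omega>. (\<Sum>i<n. Y i \<omega>) / sqrt (n * \<sigma>\<^sup>2))) \<sigma>) \<longlonglongrightarrow> char std_normal_distribution \<sigma>"
    by (intro levy_continuity1 real_distribution_distr real_dist_normal_dist) auto
  moreover have "char (distr M borel (\<lambda>\<omega>. (\<Sum>i<n. Y i \<omega>) / sqrt (n * \<sigma>\<^sup>2))) \<sigma> = (\<integral>\<omega>. cis (sqrt n * avg n h \<omega>) \<partial>M)" for n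
  proof -
    have "\<sigma> * ((\<Sum>i<n. Y i \<omega>) / sqrt (n * \<sigma>\<^sup>2)) = sqrt n * avg n h \<omega>" for \<omega>
      using \<sigma>(2) by (cases "n = 0") (simp_all add: avg_def Y_def real_sqrt_mult real_div_sqrt field_simps)
    then show ?thesis
      unfolding char_def by (subst integral_distr) (auto simp flip: cis_conv_exp of_real_mult)
  qed
  ultimately show ?thesis by (simp add: char_std_normal_distribution)
qed

end

section \<open>The maximum Lq-likelihood estimator\<close>

lemma Lq_exp: "Lq r (exp y) = (if r = 1 then y else (exp ((1 - r) * y) - 1) / (1 - r))"
  by (simp add: Lq_def powr_def)

text \<open>One formula covers \<open>r = 1\<close> and \<open>r \<noteq> 1\<close>, which frees the
  score equation from case distinctions.\<close>

lemma Lq_exp_has_derivative: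
  fixes y :: "'v::real_normed_vector \<Rightarrow> real"
  assumes "(y has_derivative y') (at x)"
  shows "((\<lambda>x. Lq r (exp (y x))) has_derivative (\<lambda>v. exp ((1 - r) * y x) * y' v)) (at x)"
proof (cases "r = 1")
  case False
  define s where "s = 1 - r"
  have s: "s \<noteq> 0" using False by (simp add: s_def)
  have "((\<lambda>x. (exp (s * y x) - 1) / s) has_derivative (\<lambda>v. exp (s * y x) * y' v)) (at x)"
    using s by (auto intro!: derivative_eq_intros assms)
  then show ?thesis using False by (simp add: Lq_exp s_def)
qed (use assms in \<open>simp add: Lq_exp\<close>)

text \<open>The equality case of the tangent inequality, responsible for strictness in Jensen's
  inequality. It follows by squaring \<open>1 + y / 2 \<le> exp (y / 2)\<close>.\<close>

lemma exp_eq_one_plus_iff: "exp y = 1 + y \<longleftrightarrow> y = 0" for y :: real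
proof
  assume eq: "exp y = 1 + y"
  then have y: "1 + y / 2 > 0" using exp_gt_zero[of y] by simp
  have "(1 + y / 2)\<^sup>2 \<le> (exp (y / 2))\<^sup>2"
    using y by (intro power_mono exp_ge_add_one_self) auto
  also have "\<dots> = 1 + y" using eq by (simp add: power2_eq_square mult_exp_exp)
  finally have "y * y \<le> 0" by (simp add: power2_eq_square algebra_simps)
  then show "y = 0" using zero_le_square[of y] by (metis antisym mult_eq_0_iff)
qed simp

context iid_sample
begin

lemma avg_sum: "n \<ge> 1 \<Longrightarrow> (\<Sum>i<n. h (X i \<omega>)) = real n *\<^sub>R avg n h \<omega>"
  by (simp add: avg_def)

text \<open>The lower bound is Jensen's, from the tangent of \<open>exp\<close> at the mean
  \<open>m\<close>; the upper one combines \<open>ln u \<le> u - 1\<close> with the second-order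
  bound for \<open>exp\<close>.\<close>

lemma ln_avg_exp_bounds:
  fixes z :: "'x \<Rightarrow> real"
  assumes n: "n \<ge> 1"
  shows "avg n z \<omega> \<le> ln (avg n (\<lambda>x. exp (z x)) \<omega>)"
    and "ln (avg n (\<lambda>x. exp (z x)) \<omega>) \<le> avg n z \<omega> + avg n (\<lambda>x. (z x)\<^sup>2 * exp \<bar>z x\<bar>) \<omega>"
    and "avg n (\<lambda>x. exp (z x)) \<omega> > 0"
proof -
  define m where "m = avg n z \<omega>"
  have "avg n (\<lambda>x. exp m * (1 - m) + exp m * z x) \<omega> \<le> avg n (\<lambda>x. exp (z x)) \<omega>"
  proof (rule avg_mono)
    fix x
    have "exp m * (1 + (z x - m)) \<le> exp m * exp (z x - m)"
      by (intro mult_left_mono exp_ge_add_one_self) auto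
    then show "exp m * (1 - m) + exp m * z x \<le> exp (z x)"
      by (simp add: mult_exp_exp algebra_simps)
  qed
  also have "avg n (\<lambda>x. exp m * (1 - m) + exp m * z x) \<omega> = exp m"
    using n by (simp only: avg_add avg_const avg_cmult m_def[symmetric]) (simp add: algebra_simps)
  finally have le: "exp m \<le> avg n (\<lambda>x. exp (z x)) \<omega>" .
  then show pos: "avg n (\<lambda>x. exp (z x)) \<omega> > 0"
    by (rule less_le_trans[OF exp_gt_zero])
  from le pos show "avg n z \<omega> \<le> ln (avg n (\<lambda>x. exp (z x)) \<omega>)"
    by (simp add: m_def ln_ge_iff)
  have "ln (avg n (\<lambda>x. exp (z x)) \<omega>) \<le> avg n (\<lambda>x. exp (z x)) \<omega> - 1"
    using ln_le_minus_one[OF pos] .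
  also have "avg n (\<lambda>x. exp (z x)) \<omega> \<le> avg n (\<lambda>x. 1 + (z x + (z x)\<^sup>2 * exp \<bar>z x\<bar>)) \<omega>"
    using abs_exp_minus_linear_le by (intro avg_mono) (smt (verit))
  also have "\<dots> = 1 + (avg n z \<omega> + avg n (\<lambda>x. (z x)\<^sup>2 * exp \<bar>z x\<bar>) \<omega>)"
    using n by (simp add: avg_add avg_const)
  finally show "ln (avg n (\<lambda>x. exp (z x)) \<omega>) \<le> avg n z \<omega> + avg n (\<lambda>x. (z x)\<^sup>2 * exp \<bar>z x\<bar>) \<omega>"
    by simp
qed

end

locale mlqe_setup = expfam P c d f \<Theta> \<theta>0 a0 + M: iid_sample M P X
  for P :: "'x measure" and c :: "'x \<Rightarrow> real^'p" and d f \<Theta> \<theta>0 a0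
    and M :: "'w measure" and X :: "nat \<Rightarrow> 'w \<Rightarrow> 'x" +
  fixes q :: "nat \<Rightarrow> real" and T :: "nat \<Rightarrow> 'w \<Rightarrow> real^'p"
  assumes q_pos: "\<And>n. q n > 0" and q_lim: "q \<longlonglongrightarrow> 1"
    and T_meas [measurable]: "\<And>n. T n \<in> borel_measurable M"
    and T_MLqE: "\<And>n. n \<ge> 1 \<Longrightarrow> AE \<omega> in M. is_MLqE f \<Theta> (q n) n (\<lambda>i. X i \<omega>) (T n \<omega>)"
begin

text \<open>Averages of \<open>c\<close>-polynomials times \<open>exp (d |c|)\<close> dominate all empirical remainders.\<close>

definition envelope :: "nat \<Rightarrow> nat \<Rightarrow> 'w \<Rightarrow> real" where
  "envelope k n \<omega> = M.avg n (\<lambda>x. norm (c x) ^ k * exp (d * norm (c x))) \<omega>"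

lemma envelope_nonneg: "envelope k n \<omega> \<ge> 0"
  unfolding envelope_def by (intro M.avg_nonneg) auto

text \<open>The means of \<open>envelope k n\<close> are bounded by one integral under
  \<open>P\<close>, so the envelopes are tight.\<close>

lemma tendsto_mult_envelope:
  assumes "(r \<longlongrightarrow> 0) (prob_filter M)"
  shows "((\<lambda>p. r p * envelope k (fst p) (snd p)) \<longlongrightarrow> 0) (prob_filter M)"
  unfolding envelope_def
  by (rule M.tendsto_prob_filter_mult_bounded[OF assms, where B="\<integral>x. norm (c x) ^ k * exp (d * norm (c x)) \<partial>P"])
     (auto intro!: M.integrable_avg integrable_power_exp M.expectation_avg_le M.avg_nonneg)

definition cbar :: "nat \<Rightarrow> 'w \<Rightarrow> real^'p" where "cbar n \<omega> = M.avg n c \<omega>"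

lemma cbar_measurable [measurable]: "cbar n \<in> borel_measurable M"
  unfolding cbar_def[abs_def] by measurable

lemma integrable_norm_c_square: "integrable P (\<lambda>x. (norm (c x))\<^sup>2)"
proof (rule Bochner_Integration.integrable_bound[OF integrable_power_exp[of 2]])
  have "(norm (c x))\<^sup>2 * 1 \<le> (norm (c x))\<^sup>2 * exp (d * norm (c x))" for x
    using d_pos by (intro mult_left_mono) auto
  then show "AE x in P. norm ((norm (c x))\<^sup>2) \<le> norm ((norm (c x))\<^sup>2 * exp (d * norm (c x)))"
    by simp
qed measurable

lemma
  shows integrable_cbar_square: "integrable M (\<lambda>\<omega>. (norm (sqrt n *\<^sub>R cbar n \<omega>))\<^sup>2)"
    and expectation_cbar_square:
      "(\<integral>\<omega>. (norm (sqrt n *\<^sub>R cbar n \<omega>))\<^sup>2 \<partial>M) \<le> (\<integral>x. (norm (c x))\<^sup>2 \<partial>P)"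
proof -
  have "integrable M (\<lambda>\<omega>. (norm (sqrt n *\<^sub>R cbar n \<omega>))\<^sup>2) \<and>
      (\<integral>\<omega>. (norm (sqrt n *\<^sub>R cbar n \<omega>))\<^sup>2 \<partial>M) \<le> (\<integral>x. (norm (c x))\<^sup>2 \<partial>P)"
  proof (cases "n = 0")
    case False
    then show ?thesis
      using M.integrable_norm_square_avg[OF c_meas integrable_norm_c_square centred, of n]
        M.expectation_norm_square_avg[OF c_meas integrable_norm_c_square centred, of n]
      by (simp add: cbar_def)
  qed simp
  then show "integrable M (\<lambda>\<omega>. (norm (sqrt n *\<^sub>R cbar n \<omega>))\<^sup>2)"
    "(\<integral>\<omega>. (norm (sqrt n *\<^sub>R cbar n \<omega>))\<^sup>2 \<partial>M) \<le> (\<integral>x. (norm (c x))\<^sup>2 \<partial>P)" by auto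
qed

text \<open>A bounded second moment makes \<open>sqrt n *\<^sub>R cbar n\<close> tight; the
  inequality \<open>y \<le> 1 + y\<^sup>2\<close> brings this under the result for bounded
  means.\<close>

lemma tendsto_mult_norm_cbar:
  assumes r: "(r \<longlongrightarrow> 0) (prob_filter M)"
  shows "((\<lambda>p. r p * norm (sqrt (real (fst p)) *\<^sub>R cbar (fst p) (snd p))) \<longlongrightarrow> 0) (prob_filter M)"
proof (rule Lim_null_comparison)
  show "((\<lambda>p. \<bar>r p\<bar> * (1 + (norm (sqrt (real (fst p)) *\<^sub>R cbar (fst p) (snd p)))\<^sup>2)) \<longlongrightarrow> 0) (prob_filter M)"
  proof (rule M.tendsto_prob_filter_mult_bounded)
    show "integrable M (\<lambda>\<omega>. 1 + (norm (sqrt n *\<^sub>R cbar n \<omega>))\<^sup>2)" for n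
      by (intro Bochner_Integration.integrable_add integrable_cbar_square) auto
    show "M.expectation (\<lambda>\<omega>. 1 + (norm (sqrt n *\<^sub>R cbar n \<omega>))\<^sup>2) \<le> 1 + (\<integral>x. (norm (c x))\<^sup>2 \<partial>P)" for n
      by (subst Bochner_Integration.integral_add[OF _ integrable_cbar_square])
         (simp_all add: M.prob_space expectation_cbar_square del: norm_scaleR)
  qed (use r in \<open>auto intro: tendsto_rabs_zero\<close>)
  have "y \<le> 1 + y\<^sup>2" for y :: real
  proof -
    have "2 * y \<le> 1 + y\<^sup>2" using zero_le_power2[of "y - 1"] by (simp add: power2_diff)
    moreover have "0 \<le> y\<^sup>2" by simp
    ultimately show ?thesis by linarith
  qed
  then show "\<forall>\<^sub>F p in prob_filter M. norm (r p * norm (sqrt (real (fst p)) *\<^sub>R cbar (fst p) (snd p)))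
      \<le> \<bar>r p\<bar> * (1 + (norm (sqrt (real (fst p)) *\<^sub>R cbar (fst p) (snd p)))\<^sup>2)"
    by (intro always_eventually allI) (simp add: abs_mult mult_left_mono del: norm_scaleR)
qed

lemma cbar_tendsto: "((\<lambda>(n, \<omega>). cbar n \<omega>) \<longlongrightarrow> 0) (prob_filter M)"
proof -
  have "(\<lambda>n. 1 / sqrt (real n)) \<longlonglongrightarrow> 0"
    by (intro tendsto_divide_0[OF tendsto_const] filterlim_at_top_imp_at_infinity
        filterlim_compose[OF sqrt_at_top filterlim_real_sequentially])
  from M.tendsto_prob_filter_deterministic[OF this]
  have "((\<lambda>p. 1 / sqrt (real (fst p)) * norm (sqrt (real (fst p)) *\<^sub>R cbar (fst p) (snd p))) \<longlongrightarrow> 0) (prob_filter M)"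
    by (rule tendsto_mult_norm_cbar)
  then have "((\<lambda>p. norm (cbar (fst p) (snd p))) \<longlongrightarrow> 0) (prob_filter M)"
  proof (rule Lim_transform_eventually)
    \<comment> \<open>At index 0 both sides are 0, since \<open>cbar 0\<close> is an empty
      average.\<close>
    show "\<forall>\<^sub>F p in prob_filter M. 1 / sqrt (real (fst p)) * norm (sqrt (real (fst p)) *\<^sub>R cbar (fst p) (snd p))
        = norm (cbar (fst p) (snd p))"
      by (intro always_eventually) (auto simp: cbar_def M.avg_def)
  qed
  then show ?thesis by (simp add: tendsto_norm_zero_iff case_prod_unfold)
qed

subsection \<open>Consistency\<close>

definition radius :: real where "radius = (SOME R. R > 0 \<and> (\<forall>\<theta>\<in>\<Theta>. norm \<theta> \<le> R))"

lemma radius: "radius > 0" "\<theta> \<in> \<Theta> \<Longrightarrow> norm \<theta> \<le> radius"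
proof -
  have "\<exists>R. R > 0 \<and> (\<forall>\<theta>\<in>\<Theta>. norm \<theta> \<le> R)"
    using compact_imp_bounded[OF compact_param] by (simp add: bounded_pos)
  from someI_ex[OF this] show "radius > 0" "\<theta> \<in> \<Theta> \<Longrightarrow> norm \<theta> \<le> radius"
    by (auto simp: radius_def)
qed

lemma \<theta>0_in: "\<theta>0 \<in> \<Theta>"
  using in_param[of \<theta>0] d_pos by simp

lemma MLqE_D:
  assumes "is_MLqE f \<Theta> (q n) n (\<lambda>i. X i \<omega>) \<theta>"
  shows "\<theta> \<in> \<Theta>"
    and "\<theta>' \<in> \<Theta> \<Longrightarrow> (\<Sum>i<n. Lq (q n) (exp (logf \<theta>' (X i \<omega>)))) \<le> (\<Sum>i<n. Lq (q n) (exp (logf \<theta> (X i \<omega>))))"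
  using assms by (auto simp: is_MLqE_def is_arg_max_def f_logf not_less)

text \<open>The empirical \<open>Lq\<close>-likelihood is, up to a strictly increasing transformation,
  \<open>empirical_cgf r n \<theta> \<omega> - normalizer \<theta>\<close> with \<open>r = 1 - q\<close>.\<close>

definition empirical_cgf :: "real \<Rightarrow> nat \<Rightarrow> real^'p \<Rightarrow> 'w \<Rightarrow> real" where
  "empirical_cgf r n \<theta> \<omega> =
     (if r = 0 then \<theta> \<bullet> cbar n \<omega> else ln (M.avg n (\<lambda>x. exp (r * (\<theta> \<bullet> c x))) \<omega>) / r)"

lemma inner_cbar: "\<theta> \<bullet> cbar n \<omega> = M.avg n (\<lambda>x. \<theta> \<bullet> c x) \<omega>"
  unfolding cbar_def by (rule M.avg_linear[symmetric, OF bounded_linear_inner_right])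

text \<open>The maps \<open>L \<mapsto> (exp L - 1) / r\<close> and \<open>L \<mapsto> L / r\<close>
  are both increasing for \<open>r > 0\<close> and both decreasing for \<open>r < 0\<close>, so they
  order parameters alike for either sign of \<open>1 - q\<close>.\<close>

lemma empirical_cgf_mono:
  assumes n: "n \<ge> 1" and le: "(\<Sum>i<n. Lq (1 - r) (exp (logf \<theta>' (X i \<omega>)))) \<le> (\<Sum>i<n. Lq (1 - r) (exp (logf \<theta> (X i \<omega>))))"
  shows "empirical_cgf r n \<theta>' \<omega> - normalizer \<theta>' \<le> empirical_cgf r n \<theta> \<omega> - normalizer \<theta>"
proof (cases "r = 0")
  case True
  have "real n * M.avg n (logf \<theta>') \<omega> \<le> real n * M.avg n (logf \<theta>) \<omega>"
    using le True M.avg_sum[OF n, of "logf \<theta>'" \<omega>] M.avg_sum[OF n, of "logf \<theta>" \<omega>]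
    by (simp add: Lq_exp)
  then have "M.avg n (logf \<theta>') \<omega> \<le> M.avg n (logf \<theta>) \<omega>" using n by simp
  moreover have "M.avg n (logf \<theta>) \<omega> = \<theta> \<bullet> cbar n \<omega> - normalizer \<theta>" for \<theta>
    unfolding logf_def[abs_def] using n by (simp add: M.avg_diff M.avg_const inner_cbar)
  ultimately show ?thesis using True by (simp add: empirical_cgf_def)
next
  case False
  define E where "E \<theta> = M.avg n (\<lambda>x. exp (r * (\<theta> \<bullet> c x))) \<omega>" for \<theta>
  have Epos: "E \<theta> > 0" for \<theta>
    unfolding E_def by (rule M.ln_avg_exp_bounds(3)[OF n])
  have sum: "(\<Sum>i<n. Lq (1 - r) (exp (logf \<theta> (X i \<omega>)))) = real n * ((exp (- (r * normalizer \<theta>)) * E \<theta> - 1) / r)" for \<theta>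
  proof -
    have "(\<lambda>x. Lq (1 - r) (exp (logf \<theta> x))) = (\<lambda>x. (1 / r) * (exp (- (r * normalizer \<theta>)) * exp (r * (\<theta> \<bullet> c x)) - 1))"
    proof -
      have "exp (r * logf \<theta> x) = exp (- (r * normalizer \<theta>)) * exp (r * (\<theta> \<bullet> c x))" for x
        by (simp add: logf_def mult_exp_exp right_diff_distrib)
      then show ?thesis using False by (simp add: Lq_exp)
    qed
    then have "M.avg n (\<lambda>x. Lq (1 - r) (exp (logf \<theta> x))) \<omega> = (1 / r) * (exp (- (r * normalizer \<theta>)) * E \<theta> - 1)"
      using n by (simp only: M.avg_cmult M.avg_diff M.avg_const E_def)
    then show ?thesis
      using M.avg_sum[OF n, of "\<lambda>x. Lq (1 - r) (exp (logf \<theta> x))" \<omega>] by simp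
  qed
  define L where "L \<theta> = ln (E \<theta>) - r * normalizer \<theta>" for \<theta>
  have expL: "exp (L \<theta>) = exp (- (r * normalizer \<theta>)) * E \<theta>" for \<theta>
    using Epos[of \<theta>] by (simp add: L_def exp_diff exp_minus divide_inverse)
  have "real n * ((exp (L \<theta>') - 1) / r) \<le> real n * ((exp (L \<theta>) - 1) / r)"
    using le unfolding sum expL .
  then have "(exp (L \<theta>') - 1) / r \<le> (exp (L \<theta>) - 1) / r"
    by (rule mult_left_le_imp_le) (use n in simp)
  then have "L \<theta>' / r \<le> L \<theta> / r"
    using False by (cases "r > 0") (auto simp: divide_le_cancel)
  moreover have "L \<theta> / r = empirical_cgf r n \<theta> \<omega> - normalizer \<theta>" for \<theta>
    using False by (simp add: L_def empirical_cgf_def E_def diff_divide_distrib)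
  ultimately show ?thesis by simp
qed

text \<open>The bound depends on \<open>\<theta>\<close> through \<open>radius\<close> only, hence
  is uniform over \<open>\<Theta>\<close>; it stands in for a uniform law of large numbers.\<close>

lemma empirical_cgf_approx:
  assumes n: "n \<ge> 1" and \<theta>: "norm \<theta> \<le> radius" and r: "\<bar>r\<bar> * radius \<le> d"
  shows "\<bar>empirical_cgf r n \<theta> \<omega> - \<theta> \<bullet> cbar n \<omega>\<bar> \<le> \<bar>r\<bar> * radius\<^sup>2 * envelope 2 n \<omega>"
proof (cases "r = 0")
  case False
  define z where "z x = r * (\<theta> \<bullet> c x)" for x
  have zle: "\<bar>\<theta> \<bullet> c x\<bar> \<le> radius * norm (c x)" for x by (rule abs_inner_le_norm[OF \<theta>])
  have "M.avg n (\<lambda>x. (z x)\<^sup>2 * exp \<bar>z x\<bar>) \<omega> \<le> M.avg n (\<lambda>x. (r\<^sup>2 * radius\<^sup>2) * (norm (c x) ^ 2 * exp (d * norm (c x)))) \<omega>"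
  proof (rule M.avg_mono)
    fix x
    have "\<bar>z x\<bar> \<le> \<bar>r\<bar> * (radius * norm (c x))"
      unfolding z_def abs_mult by (intro mult_left_mono zle) auto
    moreover have "\<bar>r\<bar> * (radius * norm (c x)) \<le> d * norm (c x)"
      using mult_right_mono[OF r, of "norm (c x)"] by (simp add: mult_ac)
    moreover have "(z x)\<^sup>2 \<le> (\<bar>r\<bar> * (radius * norm (c x)))\<^sup>2"
      using calculation(1) by (metis abs_ge_zero power2_abs power_mono)
    ultimately have "(z x)\<^sup>2 * exp \<bar>z x\<bar> \<le> (\<bar>r\<bar> * (radius * norm (c x)))\<^sup>2 * exp (d * norm (c x))"
      by (intro mult_mono) auto
    then show "(z x)\<^sup>2 * exp \<bar>z x\<bar> \<le> (r\<^sup>2 * radius\<^sup>2) * (norm (c x) ^ 2 * exp (d * norm (c x)))"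
      by (simp add: power_mult_distrib mult_ac)
  qed
  also have "\<dots> = (r\<^sup>2 * radius\<^sup>2) * envelope 2 n \<omega>" by (simp only: M.avg_cmult envelope_def)
  finally have "\<bar>ln (M.avg n (\<lambda>x. exp (z x)) \<omega>) - M.avg n z \<omega>\<bar> \<le> (r\<^sup>2 * radius\<^sup>2) * envelope 2 n \<omega>"
    using M.ln_avg_exp_bounds(1,2)[OF n, of z \<omega>] by linarith
  moreover have "M.avg n z \<omega> = r * (\<theta> \<bullet> cbar n \<omega>)"
    unfolding z_def[abs_def] by (simp only: M.avg_cmult inner_cbar)
  ultimately have "\<bar>r * (empirical_cgf r n \<theta> \<omega> - \<theta> \<bullet> cbar n \<omega>)\<bar> \<le> \<bar>r\<bar> * (\<bar>r\<bar> * radius\<^sup>2 * envelope 2 n \<omega>)"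
    using False by (simp add: empirical_cgf_def z_def right_diff_distrib power2_eq_square mult_ac)
  then show ?thesis using False by (simp add: abs_mult)
qed (simp add: empirical_cgf_def)

text \<open>Compare the maximiser with \<open>\<theta>0\<close>: the normaliser charges it exactly
  \<open>ln (mgf (\<theta> - \<theta>0))\<close>, which therefore cannot exceed the random
  fluctuations at the two parameters.\<close>

lemma MLqE_cgf_bound:
  assumes n: "n \<ge> 1" and ml: "is_MLqE f \<Theta> (q n) n (\<lambda>i. X i \<omega>) \<theta>" and r: "\<bar>1 - q n\<bar> * radius \<le> d"
  shows "ln (mgf (\<theta> - \<theta>0)) \<le> 2 * radius * norm (cbar n \<omega>) + 2 * (\<bar>1 - q n\<bar> * radius\<^sup>2 * envelope 2 n \<omega>)"
proof -
  have \<theta>: "norm \<theta> \<le> radius" "norm \<theta>0 \<le> radius" using radius(2) MLqE_D(1)[OF ml] \<theta>0_in by auto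
  have "empirical_cgf (1 - q n) n \<theta>0 \<omega> - normalizer \<theta>0 \<le> empirical_cgf (1 - q n) n \<theta> \<omega> - normalizer \<theta>"
    using MLqE_D(2)[OF ml \<theta>0_in] by (intro empirical_cgf_mono[OF n]) simp
  moreover have "normalizer \<theta> - normalizer \<theta>0 = ln (mgf (\<theta> - \<theta>0))"
    by (simp add: normalizer_def)
  moreover have "(\<theta> - \<theta>0) \<bullet> cbar n \<omega> \<le> 2 * radius * norm (cbar n \<omega>)"
  proof -
    have "norm (\<theta> - \<theta>0) \<le> 2 * radius" using norm_triangle_ineq4[of \<theta> \<theta>0] \<theta> by linarith
    from abs_inner_le_norm[OF this, of "cbar n \<omega>"] show ?thesis by linarith
  qed
  ultimately show ?thesis
    using empirical_cgf_approx[OF n \<theta>(1) r, of \<omega>] empirical_cgf_approx[OF n \<theta>(2) r, of \<omega>]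
    unfolding inner_diff_left by linarith
qed

text \<open>Continuity of \<open>mgf\<close> is available near \<open>\<theta>0\<close>. On a small
  sphere there, strict Jensen gives a minimum above 1; convexity along rays carries this value
  outward to the rest of \<open>\<Theta>\<close>.\<close>

lemma cgf_separation:
  assumes \<epsilon>: "0 < \<epsilon>" "\<epsilon> < d"
  obtains \<eta> where "\<eta> > 0" "\<And>\<theta>. \<theta> \<in> \<Theta> \<Longrightarrow> norm (\<theta> - \<theta>0) \<ge> \<epsilon> \<Longrightarrow> ln (mgf (\<theta> - \<theta>0)) \<ge> \<eta>"
proof -
  have "isCont mgf s" if "s \<in> sphere 0 \<epsilon>" for s
    using has_derivative_continuous[OF mgf_has_derivative[of s]] that \<epsilon> by simp
  then have "continuous_on (sphere 0 \<epsilon>) mgf" by (simp add: continuous_at_imp_continuous_on)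
  from continuous_attains_inf[OF compact_sphere _ this] \<epsilon>
  obtain u where u: "norm u = \<epsilon>" "\<And>s. norm s = \<epsilon> \<Longrightarrow> mgf u \<le> mgf s" by auto
  have ic: "integrable P (\<lambda>x. s \<bullet> c x)" for s
    using integrable_mgf1[of 0] d_pos by simp
  have mean: "(\<integral>x. s \<bullet> c x \<partial>P) = 0" for s
    using integrable_mgf1[of 0] d_pos centred by (subst integral_inner_right) auto
  have "mgf u > 1"
  proof -
    have i: "integrable P (\<lambda>x. exp (u \<bullet> c x) - (1 + u \<bullet> c x))"
      using integrable_mgf[of u] ic u \<epsilon> by auto
    have "(\<integral>x. exp (u \<bullet> c x) - (1 + u \<bullet> c x) \<partial>P) \<noteq> 0"
    proof
      assume "(\<integral>x. exp (u \<bullet> c x) - (1 + u \<bullet> c x) \<partial>P) = 0"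
      then have "AE x in P. exp (u \<bullet> c x) - (1 + u \<bullet> c x) = 0"
        using integral_nonneg_eq_0_iff_AE[OF i] exp_ge_add_one_self by simp
      then have "AE x in P. u \<bullet> c x = 0"
        by eventually_elim (simp add: exp_eq_one_plus_iff)
      then show False using nondegenerate u \<epsilon> by fastforce
    qed
    moreover have "(\<integral>x. exp (u \<bullet> c x) - (1 + u \<bullet> c x) \<partial>P) \<ge> 0"
      using exp_ge_add_one_self by (intro integral_nonneg_AE) simp
    moreover have "(\<integral>x. exp (u \<bullet> c x) - (1 + u \<bullet> c x) \<partial>P) = mgf u - 1"
      using integrable_mgf[of u] ic u \<epsilon> by (simp add: mgf_def mean prob_space)
    ultimately show ?thesis by linarith
  qed
  moreover have "mgf u \<le> mgf (\<theta> - \<theta>0)" if \<theta>: "\<theta> \<in> \<Theta>" "norm (\<theta> - \<theta>0) \<ge> \<epsilon>" for \<theta>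
  proof -
    define s where "s = \<theta> - \<theta>0"
    define l where "l = \<epsilon> / norm s"
    have ns: "0 < norm s" "\<epsilon> \<le> norm s" using \<epsilon> \<theta> unfolding s_def by linarith+
    then have l: "0 < l" "l \<le> 1" "norm (l *\<^sub>R s) = \<epsilon>" using \<epsilon> by (simp_all add: l_def)
    have int_s: "integrable P (\<lambda>x. exp (s \<bullet> c x))" using integrable_param[OF \<theta>(1)] by (simp add: s_def)
    have il: "integrable P (\<lambda>x. exp ((l *\<^sub>R s) \<bullet> c x))" using l \<epsilon> by (intro integrable_mgf) simp
    \<comment> \<open>The added term has mean zero. It turns the comparison of two integrals into a
      pointwise inequality, which follows from convexity and the tangent bound.\<close>
    have "mgf (l *\<^sub>R s) = (\<integral>x. exp ((l *\<^sub>R s) \<bullet> c x) + (1 - l) * (s \<bullet> c x) \<partial>P)"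
      using il ic by (simp add: mgf_def mean)
    also have "\<dots> \<le> (\<integral>x. exp (s \<bullet> c x) \<partial>P)"
    proof (intro integral_mono int_s Bochner_Integration.integrable_add il integrable_mult_right ic)
      fix x
      define y where "y = s \<bullet> c x"
      have "exp ((1 - l) *\<^sub>R 0 + l *\<^sub>R y) \<le> (1 - l) * exp 0 + l * exp y"
        using convex_onD[OF exp_convex, of l 0 y] l by simp
      moreover have "(1 - l) * (1 + y) \<le> (1 - l) * exp y"
        using l by (intro mult_left_mono exp_ge_add_one_self) auto
      ultimately show "exp ((l *\<^sub>R s) \<bullet> c x) + (1 - l) * (s \<bullet> c x) \<le> exp (s \<bullet> c x)"
        by (simp add: y_def[symmetric] algebra_simps)
    qed
    finally show ?thesis using u(2)[OF l(3)] by (simp add: mgf_def s_def)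
  qed
  ultimately show thesis
    by (intro that[of "ln (mgf u)"]) (auto intro!: ln_mono)
qed

abbreviation F :: "(nat \<times> 'w) filter" where "F \<equiv> prob_filter M"

lemma q1_tendsto: "((\<lambda>p. 1 - q (fst p)) \<longlongrightarrow> 0) F"
proof -
  have "(\<lambda>n. 1 - q n) \<longlonglongrightarrow> 1 - 1" by (intro tendsto_intros q_lim)
  then show ?thesis by (intro M.tendsto_prob_filter_deterministic) simp
qed

lemma eventually_MLqE:
  "\<forall>\<^sub>F p in F. fst p \<ge> 1 \<and> is_MLqE f \<Theta> (q (fst p)) (fst p) (\<lambda>i. X i (snd p)) (T (fst p) (snd p))"
  by (rule M.eventually_prob_filter_AE) (use T_MLqE in \<open>auto simp: eventually_sequentially\<close>)

lemma eventually_q_small: "\<forall>\<^sub>F p in F. \<bar>1 - q (fst p)\<bar> * radius \<le> d"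
proof -
  have "((\<lambda>p. \<bar>1 - q (fst p)\<bar> * radius) \<longlongrightarrow> \<bar>0\<bar> * radius) F"
    by (intro tendsto_intros q1_tendsto)
  then have "\<forall>\<^sub>F p in F. \<bar>1 - q (fst p)\<bar> * radius < d"
    using d_pos by (intro order_tendstoD(2)[where y="\<bar>0\<bar> * radius"]) auto
  then show ?thesis by (auto elim: eventually_mono)
qed

lemma T_consistent: "((\<lambda>p. T (fst p) (snd p)) \<longlongrightarrow> \<theta>0) F"
proof (rule tendstoI)
  fix e :: real assume e: "e > 0"
  define \<epsilon> where "\<epsilon> = min e (d / 2)"
  have \<epsilon>: "0 < \<epsilon>" "\<epsilon> < d" using e d_pos by (auto simp: \<epsilon>_def)
  obtain \<eta> where \<eta>: "\<eta> > 0" "\<And>\<theta>. \<theta> \<in> \<Theta> \<Longrightarrow> norm (\<theta> - \<theta>0) \<ge> \<epsilon> \<Longrightarrow> ln (mgf (\<theta> - \<theta>0)) \<ge> \<eta>"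
    using cgf_separation[OF \<epsilon>] by blast
  have "((\<lambda>p. \<bar>1 - q (fst p)\<bar> * radius\<^sup>2) \<longlongrightarrow> \<bar>0\<bar> * radius\<^sup>2) F"
    by (intro tendsto_intros q1_tendsto)
  then have "((\<lambda>p. \<bar>1 - q (fst p)\<bar> * radius\<^sup>2 * envelope 2 (fst p) (snd p)) \<longlongrightarrow> 0) F"
    by (intro tendsto_mult_envelope) simp
  moreover have "((\<lambda>p. norm (cbar (fst p) (snd p))) \<longlongrightarrow> 0) F"
    using tendsto_norm_zero[OF cbar_tendsto] by (simp add: case_prod_unfold)
  ultimately have "((\<lambda>p. 2 * radius * norm (cbar (fst p) (snd p))
      + 2 * (\<bar>1 - q (fst p)\<bar> * radius\<^sup>2 * envelope 2 (fst p) (snd p))) \<longlongrightarrow> 2 * radius * 0 + 2 * 0) F"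
    by (intro tendsto_intros)
  then have "\<forall>\<^sub>F p in F. 2 * radius * norm (cbar (fst p) (snd p))
      + 2 * (\<bar>1 - q (fst p)\<bar> * radius\<^sup>2 * envelope 2 (fst p) (snd p)) < \<eta>"
    using \<eta>(1) by (intro order_tendstoD(2)[where y="2 * radius * 0 + 2 * 0"]) auto
  with eventually_MLqE eventually_q_small
  show "\<forall>\<^sub>F p in F. dist (T (fst p) (snd p)) \<theta>0 < e"
  proof eventually_elim
    case (elim p)
    have "norm (T (fst p) (snd p) - \<theta>0) < \<epsilon>"
    proof (rule ccontr)
      assume "\<not> norm (T (fst p) (snd p) - \<theta>0) < \<epsilon>"
      with elim have "\<eta> \<le> ln (mgf (T (fst p) (snd p) - \<theta>0))"
        by (intro \<eta>(2)) (auto dest: MLqE_D(1))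
      also note MLqE_cgf_bound[OF _ _ elim(2), of "snd p" "T (fst p) (snd p)"]
      finally show False using elim by simp
    qed
    then show ?case by (simp add: dist_norm \<epsilon>_def)
  qed
qed

subsection \<open>The estimating equation\<close>

text \<open>The score equation without its common positive factor
  \<open>exp (- ((1 - q n) * normalizer \<theta>))\<close>; the zeros are unchanged.\<close>

definition est :: "nat \<Rightarrow> real^'p \<Rightarrow> 'w \<Rightarrow> real^'p" where
  "est n \<theta> \<omega> = M.avg n (\<lambda>x. exp ((1 - q n) * (\<theta> \<bullet> c x)) *\<^sub>R resid \<theta> x) \<omega>"

text \<open>A maximiser in the ball of radius \<open>d\<close> is interior to
  \<open>\<Theta>\<close>, so the gradient of the objective vanishes there.\<close>

lemma est_MLqE:
  assumes n: "n \<ge> 1" and ml: "is_MLqE f \<Theta> (q n) n (\<lambda>i. X i \<omega>) \<theta>" and \<theta>: "norm (\<theta> - \<theta>0) < d"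
  shows "est n \<theta> \<omega> = 0"
proof -
  define w where "w = (\<Sum>i<n. exp ((1 - q n) * logf \<theta> (X i \<omega>)) *\<^sub>R resid \<theta> (X i \<omega>))"
  have "((\<lambda>\<theta>. \<Sum>i<n. Lq (q n) (exp (logf \<theta> (X i \<omega>)))) has_derivative
      (\<lambda>v. \<Sum>i<n. exp ((1 - q n) * logf \<theta> (X i \<omega>)) * (v \<bullet> resid \<theta> (X i \<omega>)))) (at \<theta>)"
    by (intro has_derivative_sum Lq_exp_has_derivative logf_has_derivative \<theta>)
  then have "((\<lambda>\<theta>. \<Sum>i<n. Lq (q n) (exp (logf \<theta> (X i \<omega>)))) has_derivative (\<lambda>v. v \<bullet> w)) (at \<theta>)"
    by (simp add: w_def inner_sum_right)
  from differential_zero_maxmin[OF _ open_param_ball this] \<theta>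
  have "(\<lambda>v. v \<bullet> w) = (\<lambda>v. 0)"
    using MLqE_D(2)[OF ml in_param] by auto
  then have "w = 0" by (metis inner_eq_zero_iff)
  have "w = real n *\<^sub>R M.avg n (\<lambda>x. exp ((1 - q n) * logf \<theta> x) *\<^sub>R resid \<theta> x) \<omega>"
    unfolding w_def by (rule M.avg_sum[OF n])
  also have "(\<lambda>x. exp ((1 - q n) * logf \<theta> x) *\<^sub>R resid \<theta> x)
      = (\<lambda>x. exp (- ((1 - q n) * normalizer \<theta>)) *\<^sub>R (exp ((1 - q n) * (\<theta> \<bullet> c x)) *\<^sub>R resid \<theta> x))"
    by (simp add: logf_def fun_eq_iff mult_exp_exp algebra_simps)
  finally have "w = real n *\<^sub>R (exp (- ((1 - q n) * normalizer \<theta>)) *\<^sub>R est n \<theta> \<omega>)"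
    by (simp only: M.avg_scaleR est_def)
  with \<open>w = 0\<close> n show ?thesis by simp
qed

definition ts :: "nat \<Rightarrow> real^'p" where "ts n = (1 / q n) *\<^sub>R \<theta>0"

lemma ts_tendsto: "ts \<longlonglongrightarrow> \<theta>0"
proof -
  have "(\<lambda>n. (1 / q n) *\<^sub>R \<theta>0) \<longlonglongrightarrow> (1 / 1) *\<^sub>R \<theta>0"
    by (intro tendsto_intros q_lim) auto
  then show ?thesis by (simp add: ts_def[abs_def])
qed

text \<open>The defining property of the surrogate: at \<open>ts n\<close> the exponent of the
  weight is the tilt that leads from \<open>\<theta>0\<close> to \<open>ts n\<close>.\<close>

lemma ts_eq: "(1 - q n) *\<^sub>R ts n = ts n - \<theta>0"
  using q_pos[of n] by (simp add: ts_def scaleR_diff_left[symmetric] scaleR_left_diff_distrib diff_divide_distrib)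

definition score_err :: "nat \<Rightarrow> 'x \<Rightarrow> real^'p" where
  "score_err n x = exp ((ts n - \<theta>0) \<bullet> c x) *\<^sub>R resid (ts n) x - c x"

lemma score_err_measurable [measurable]: "score_err n \<in> borel_measurable P"
  unfolding score_err_def[abs_def] by measurable

text \<open>The weight turns \<open>P\<close> into the law at \<open>ts n\<close> up to the factor
  \<open>mgf\<close>, and \<open>resid (ts n)\<close> is centred under that law.\<close>

lemma integral_score_err:
  assumes "norm (ts n - \<theta>0) < d"
  shows "(\<integral>x. score_err n x \<partial>P) = 0"
proof -
  define s where "s = ts n - \<theta>0"
  have s: "norm s \<le> d" using assms by (simp add: s_def)
  have pos: "mgf s > 0" by (rule mgf_pos[OF integrable_mgf[OF s]])
  have ic: "integrable P c" using integrable_mgf1[of 0] d_pos by simp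
  have "score_err n = (\<lambda>x. exp (s \<bullet> c x) *\<^sub>R c x - exp (s \<bullet> c x) *\<^sub>R cgf1 s - c x)"
    by (simp add: score_err_def[abs_def] resid_def s_def scaleR_diff_right)
  then have "(\<integral>x. score_err n x \<partial>P) = mgf1 s - mgf s *\<^sub>R cgf1 s"
    using integrable_mgf[OF s] integrable_mgf1[OF s] ic by (simp add: mgf_def mgf1_def centred)
  also have "\<dots> = 0" using pos by (simp add: cgf1_def)
  finally show ?thesis .
qed

lemma
  shows eventually_integrable_score_err: "\<forall>\<^sub>F n in sequentially. integrable P (\<lambda>x. (norm (score_err n x))\<^sup>2)"
    and score_err_tendsto: "(\<lambda>n. \<integral>x. (norm (score_err n x))\<^sup>2 \<partial>P) \<longlonglongrightarrow> 0"
proof -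
  \<comment> \<open>The constants come from \<open>2 * (2 + 2 * (norm (c x))\<^sup>2)\<close> for
    the weighted residual and \<open>2 * (norm (c x))\<^sup>2\<close> for \<open>c x\<close>.
    Squaring the weight doubles the tilt, hence the condition on
    \<open>2 *\<^sub>R (ts n - \<theta>0)\<close> below.\<close>
  define w where "w x = 4 * (norm (c x) ^ 0 * exp (d * norm (c x))) + 6 * (norm (c x) ^ 2 * exp (d * norm (c x)))" for x
  have w: "integrable P w"
    unfolding w_def by (intro Bochner_Integration.integrable_add integrable_mult_right integrable_power_exp)
  have s: "(\<lambda>n. ts n - \<theta>0) \<longlonglongrightarrow> 0" using ts_tendsto by (simp add: LIM_zero)
  have "(\<lambda>n. norm (2 *\<^sub>R (ts n - \<theta>0))) \<longlonglongrightarrow> norm (2 *\<^sub>R (0 :: real^'p))"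
    by (intro tendsto_intros s)
  then have "\<forall>\<^sub>F n in sequentially. norm (2 *\<^sub>R (ts n - \<theta>0)) < d"
    using d_pos by (intro order_tendstoD(2)[where y="norm (2 *\<^sub>R (0 :: real^'p))"]) auto
  then have bd: "\<forall>\<^sub>F n in sequentially. \<forall>x. norm ((norm (score_err n x))\<^sup>2) \<le> w x"
    using eventually_cgf1_le[OF ts_tendsto q_lim]
  proof eventually_elim
    case (elim n)
    show ?case
    proof
      fix x
      define a where "a = exp ((ts n - \<theta>0) \<bullet> c x)"
      have "a\<^sup>2 = exp ((2 *\<^sub>R (ts n - \<theta>0)) \<bullet> c x)"
        by (simp add: a_def power2_eq_square mult_exp_exp)
      also have "\<dots> \<le> exp (d * norm (c x))" using elim by (intro exp_inner_le) simp
      finally have a: "a\<^sup>2 \<le> exp (d * norm (c x))" .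
      have 1: "(norm (score_err n x))\<^sup>2 \<le> (norm (a *\<^sub>R resid (ts n) x) + norm (c x))\<^sup>2"
        unfolding score_err_def a_def by (intro power_mono norm_triangle_ineq4) auto
      have 2: "(norm (a *\<^sub>R resid (ts n) x) + norm (c x))\<^sup>2 \<le> 2 * (norm (a *\<^sub>R resid (ts n) x))\<^sup>2 + 2 * (norm (c x))\<^sup>2"
        using sum_squares_bound[of "norm (a *\<^sub>R resid (ts n) x)" "norm (c x)"] by (simp add: power2_sum)
      have "(norm (a *\<^sub>R resid (ts n) x))\<^sup>2 = a\<^sup>2 * (norm (resid (ts n) x))\<^sup>2"
        by (simp add: power_mult_distrib)
      also have "\<dots> \<le> exp (d * norm (c x)) * (2 + 2 * (norm (c x))\<^sup>2)"
        using a elim by (intro mult_mono norm_resid_square_le) auto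
      finally have 3: "(norm (a *\<^sub>R resid (ts n) x))\<^sup>2 \<le> exp (d * norm (c x)) * (2 + 2 * (norm (c x))\<^sup>2)" .
      have 4: "(norm (c x))\<^sup>2 * 1 \<le> (norm (c x))\<^sup>2 * exp (d * norm (c x))"
        using d_pos by (intro mult_left_mono) auto
      show "norm ((norm (score_err n x))\<^sup>2) \<le> w x"
        using order_trans[OF 1 2] 3 4 by (simp add: w_def algebra_simps)
    qed
  qed
  show "\<forall>\<^sub>F n in sequentially. integrable P (\<lambda>x. (norm (score_err n x))\<^sup>2)"
    using bd
  proof eventually_elim
    case (elim n)
    show ?case
    proof (rule Bochner_Integration.integrable_bound[OF w])
      show "AE x in P. norm ((norm (score_err n x))\<^sup>2) \<le> norm (w x)"
        using elim by (intro AE_I2) (metis abs_ge_self order_trans real_norm_def)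
    qed measurable
  qed
  have "(\<lambda>n. \<integral>x. (norm (score_err n x))\<^sup>2 \<partial>P) \<longlonglongrightarrow> (\<integral>x. 0 \<partial>P)"
  proof (rule dominated_convergence_eventually[OF _ _ w _ bd])
    fix x
    have "(\<lambda>n. (norm (score_err n x))\<^sup>2) \<longlonglongrightarrow> (norm (exp (0 \<bullet> c x) *\<^sub>R c x - c x))\<^sup>2"
      unfolding score_err_def by (intro tendsto_intros s resid_tendsto ts_tendsto)
    then show "(\<lambda>n. (norm (score_err n x))\<^sup>2) \<longlonglongrightarrow> 0" by simp
  qed measurable
  then show "(\<lambda>n. \<integral>x. (norm (score_err n x))\<^sup>2 \<partial>P) \<longlonglongrightarrow> 0" by simp
qed

text \<open>The summands \<open>score_err n\<close> change with \<open>n\<close>, so the argument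
  goes through second moments: the scaled average has exactly the second moment of one summand,
  which tends to 0.\<close>

lemma est_ts_tendsto:
  "((\<lambda>p. sqrt (real (fst p)) *\<^sub>R est (fst p) (ts (fst p)) (snd p) - sqrt (real (fst p)) *\<^sub>R cbar (fst p) (snd p)) \<longlongrightarrow> 0) F"
proof -
  have eq: "sqrt n *\<^sub>R est n (ts n) \<omega> - sqrt n *\<^sub>R cbar n \<omega> = sqrt n *\<^sub>R M.avg n (score_err n) \<omega>" for n \<omega>
  proof -
    have "(1 - q n) * (ts n \<bullet> c x) = (ts n - \<theta>0) \<bullet> c x" for x
      by (simp flip: ts_eq)
    then show ?thesis
      unfolding est_def cbar_def score_err_def[abs_def] by (simp add: M.avg_diff scaleR_diff_right)
  qed
  have ev: "\<forall>\<^sub>F n in sequentially. integrable M (\<lambda>\<omega>. (norm (sqrt n *\<^sub>R M.avg n (score_err n) \<omega>))\<^sup>2) \<and>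
      (\<integral>\<omega>. (norm (sqrt n *\<^sub>R M.avg n (score_err n) \<omega>))\<^sup>2 \<partial>M) = (\<integral>x. (norm (score_err n x))\<^sup>2 \<partial>P)"
    using eventually_integrable_score_err eventually_param[OF ts_tendsto q_lim] eventually_ge_at_top[of "1::nat"]
    by eventually_elim
       (intro conjI M.integrable_norm_square_avg M.expectation_norm_square_avg integral_score_err score_err_measurable, auto)
  have "((\<lambda>(n, \<omega>). sqrt n *\<^sub>R M.avg n (score_err n) \<omega>) \<longlongrightarrow> 0) F"
  proof (rule M.tendsto_prob_filter_L2)
    show "\<forall>\<^sub>F n in sequentially. integrable M (\<lambda>\<omega>. (norm (sqrt n *\<^sub>R M.avg n (score_err n) \<omega>))\<^sup>2)"
      using ev by eventually_elim auto
    show "(\<lambda>n. \<integral>\<omega>. (norm (sqrt n *\<^sub>R M.avg n (score_err n) \<omega>))\<^sup>2 \<partial>M) \<longlonglongrightarrow> 0"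
      by (rule Lim_transform_eventually[OF score_err_tendsto]) (use ev in \<open>eventually_elim, simp\<close>)
  qed
  then show ?thesis unfolding eq by (simp add: case_prod_unfold)
qed

end

lemma measurable_matrix_vector_mult [measurable]:
  fixes A :: "real^'n^'m"
  assumes "g \<in> borel_measurable N"
  shows "(\<lambda>x. A *v g x) \<in> borel_measurable N"
  by (rule borel_measurable_continuous_on[OF matrix_vector_mult_linear_continuous_on assms])

section \<open>Linearization of the estimating equation\<close>

context expfam
begin

text \<open>Both \<open>\<theta> - \<theta>0\<close> and \<open>ts n - \<theta>0\<close> move, so a
  derivative at 0 does not suffice. Continuity of \<open>cgf2\<close> and the mean value inequality
  on a ball give strict differentiability.\<close>

lemma cgf1_strict_derivative:
  assumes e: "e > 0"
  obtains \<delta> where "0 < \<delta>" "\<delta> \<le> d"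
    "\<And>x y. norm x < \<delta> \<Longrightarrow> norm y < \<delta> \<Longrightarrow> norm (cgf1 x - cgf1 y - \<Sigma> *v (x - y)) \<le> e * norm (x - y)"
proof -
  have "isCont cgf2 0"
    using continuous_on_cgf2 d_pos by (simp add: continuous_on_eq_continuous_at)
  then obtain \<delta>0 where \<delta>0: "\<delta>0 > 0" "\<And>s. norm s < \<delta>0 \<Longrightarrow> norm (cgf2 s - \<Sigma>) < e"
    using e unfolding continuous_at_eps_delta by (auto simp: dist_norm cgf2_0)
  define \<delta> where "\<delta> = min \<delta>0 d"
  have "norm (cgf1 x - cgf1 y - \<Sigma> *v (x - y)) \<le> e * norm (x - y)" if "norm x < \<delta>" "norm y < \<delta>" for x y
  proof -
    have "norm ((cgf1 x - \<Sigma> *v x) - (cgf1 y - \<Sigma> *v y)) \<le> e * norm (x - y)"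
    proof (rule differentiable_bound[where S="ball 0 \<delta>" and f'="\<lambda>s v. cgf2 s *v v - \<Sigma> *v v"])
      fix s :: "real^'p" assume s: "s \<in> ball 0 \<delta>"
      have "((\<lambda>x. cgf1 x - \<Sigma> *v x) has_derivative (\<lambda>v. cgf2 s *v v - \<Sigma> *v v)) (at s)"
        using s by (intro has_derivative_diff cgf1_has_derivative
            bounded_linear_imp_has_derivative matrix_vector_mul_bounded_linear) (simp add: \<delta>_def)
      then show "((\<lambda>x. cgf1 x - \<Sigma> *v x) has_derivative (\<lambda>v. cgf2 s *v v - \<Sigma> *v v)) (at s within ball 0 \<delta>)"
        by (rule has_derivative_at_withinI)
      show "onorm (\<lambda>v. cgf2 s *v v - \<Sigma> *v v) \<le> e"
      proof (rule onorm_le)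
        fix v
        have "norm (cgf2 s *v v - \<Sigma> *v v) \<le> norm (cgf2 s - \<Sigma>) * norm v"
          using norm_matrix_vector_mult_le[of "cgf2 s - \<Sigma>" v] by (simp add: matrix_vector_mult_diff_rdistrib)
        also have "\<dots> \<le> e * norm v"
          using \<delta>0(2)[of s] s by (intro mult_right_mono) (auto simp: \<delta>_def)
        finally show "norm (cgf2 s *v v - \<Sigma> *v v) \<le> e * norm v" .
      qed
    qed (use that in auto)
    then show ?thesis by (simp add: matrix_vector_mult_diff_distrib algebra_simps)
  qed
  with \<delta>0(1) d_pos show thesis by (intro that[of \<delta>]) (auto simp: \<delta>_def)
qed

end

context mlqe_setup
begin

text \<open>The weights \<open>exp ((1 - q) \<theta> \<bullet> c)\<close> depend on \<open>\<theta>\<close> only through the vanishing factor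
  \<open>1 - q\<close>, so only the centring \<open>cgf1 (\<theta> - \<theta>0)\<close> contributes to the derivative in the limit.\<close>

lemma est_expansion:
  assumes n: "n \<ge> 1" and T0: "est n \<theta> \<omega> = 0"
    and r: "norm ((1 - q n) *\<^sub>R \<theta>) \<le> d" "norm ((1 - q n) *\<^sub>R ts n) \<le> d"
    and g: "norm (cgf1 (ts n - \<theta>0)) \<le> 1"
    and lin: "norm (cgf1 (\<theta> - \<theta>0) - cgf1 (ts n - \<theta>0) - \<Sigma> *v (\<theta> - ts n)) \<le> e * norm (\<theta> - ts n)"
    and e: "0 \<le> e" "e \<le> 1"
  shows "norm (\<Sigma> *v (\<theta> - ts n) - est n (ts n) \<omega>) \<le>
    (e + \<bar>1 - q n\<bar> * norm \<theta> * envelope 1 n \<omega> * (norm \<Sigma> + 1) + \<bar>1 - q n\<bar> * (envelope 1 n \<omega> + envelope 2 n \<omega>)) * norm (\<theta> - ts n)"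
proof -
  define r where "r = 1 - q n"
  define h where "h = \<theta> - ts n"
  define D where "D = cgf1 (\<theta> - \<theta>0) - cgf1 (ts n - \<theta>0)"
  define A where "A x = exp (r * (\<theta> \<bullet> c x))" for x
  define B where "B x = exp (r * (ts n \<bullet> c x))" for x
  define m where "m = M.avg n A \<omega>"
  define Q where "Q = M.avg n (\<lambda>x. (A x - B x) *\<^sub>R resid (ts n) x) \<omega>"
  \<comment> \<open>\<open>Q\<close> collects the change of the weights at the residual of
    \<open>ts n\<close>, and \<open>m *\<^sub>R D\<close> the change of the centring under the
    weights of \<open>\<theta>\<close>.\<close>
  have "est n \<theta> \<omega> - est n (ts n) \<omega> = Q - m *\<^sub>R D"
  proof -
    have "(\<lambda>x. A x *\<^sub>R resid \<theta> x - B x *\<^sub>R resid (ts n) x) = (\<lambda>x. (A x - B x) *\<^sub>R resid (ts n) x - A x *\<^sub>R D)"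
      by (simp add: resid_def D_def algebra_simps fun_eq_iff)
    then have "est n \<theta> \<omega> - est n (ts n) \<omega> = M.avg n (\<lambda>x. (A x - B x) *\<^sub>R resid (ts n) x - A x *\<^sub>R D) \<omega>"
      by (simp add: est_def A_def B_def r_def flip: M.avg_diff)
    also have "\<dots> = Q - m *\<^sub>R D"
      using M.avg_linear[OF bounded_linear_scaleR_left, of n A D \<omega>] by (simp add: M.avg_diff Q_def m_def)
    finally show ?thesis .
  qed
  then have eq: "\<Sigma> *v h - est n (ts n) \<omega> = (\<Sigma> *v h - D) + ((1 - m) *\<^sub>R D) + Q"
    using T0 by (simp add: algebra_simps)
  have lin': "norm (\<Sigma> *v h - D) \<le> e * norm h"
    using lin by (simp add: h_def D_def norm_minus_commute)
  have Dle: "norm D \<le> (norm \<Sigma> + 1) * norm h"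
  proof -
    have "norm D \<le> norm (\<Sigma> *v h) + norm (\<Sigma> *v h - D)"
      using norm_triangle_ineq4[of "\<Sigma> *v h" "\<Sigma> *v h - D"] by simp
    also have "\<dots> \<le> norm \<Sigma> * norm h + 1 * norm h"
      using lin' mult_right_mono[OF e(2) norm_ge_zero[of h]] norm_matrix_vector_mult_le[of \<Sigma> h] by linarith
    finally show ?thesis by (simp add: algebra_simps)
  qed
  have Ale: "r * (\<theta> \<bullet> c x) \<le> d * norm (c x)" "\<bar>r * (\<theta> \<bullet> c x)\<bar> \<le> \<bar>r\<bar> * norm \<theta> * norm (c x)"
    "r * (ts n \<bullet> c x) \<le> d * norm (c x)" for x
    using abs_inner_le_norm[OF r(1), of "c x"] abs_inner_le_norm[OF r(2), of "c x"]
      abs_inner_le_norm[OF order_refl, of "r *\<^sub>R \<theta>" "c x"] by (auto simp: r_def)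
  have mle: "\<bar>1 - m\<bar> \<le> \<bar>r\<bar> * norm \<theta> * envelope 1 n \<omega>"
  proof -
    have "\<bar>1 - m\<bar> = norm (M.avg n (\<lambda>x. 1 - A x) \<omega>)"
      using n by (simp add: m_def M.avg_diff M.avg_const)
    also have "\<dots> \<le> M.avg n (\<lambda>x. norm (1 - A x)) \<omega>" by (rule M.norm_avg_le)
    also have "\<dots> \<le> M.avg n (\<lambda>x. (\<bar>r\<bar> * norm \<theta>) * (norm (c x) ^ 1 * exp (d * norm (c x)))) \<omega>"
    proof (rule M.avg_mono)
      fix x
      have "norm (1 - A x) \<le> \<bar>r * (\<theta> \<bullet> c x)\<bar> * exp (max (r * (\<theta> \<bullet> c x)) 0)"
        using abs_exp_diff_le[of "r * (\<theta> \<bullet> c x)" 0] by (simp add: A_def abs_minus_commute)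
      also have "\<dots> \<le> (\<bar>r\<bar> * norm \<theta> * norm (c x)) * exp (d * norm (c x))"
        using Ale[of x] d_pos by (intro mult_mono) auto
      finally show "norm (1 - A x) \<le> (\<bar>r\<bar> * norm \<theta>) * (norm (c x) ^ 1 * exp (d * norm (c x)))"
        by (simp add: mult_ac)
    qed
    also have "\<dots> = \<bar>r\<bar> * norm \<theta> * envelope 1 n \<omega>" by (simp only: M.avg_cmult envelope_def)
    finally show ?thesis .
  qed
  have Qle: "norm Q \<le> (\<bar>r\<bar> * (envelope 1 n \<omega> + envelope 2 n \<omega>)) * norm h"
  proof -
    have "norm Q \<le> M.avg n (\<lambda>x. norm ((A x - B x) *\<^sub>R resid (ts n) x)) \<omega>"
      unfolding Q_def by (rule M.norm_avg_le)
    also have "\<dots> \<le> M.avg n (\<lambda>x. (\<bar>r\<bar> * norm h) * (norm (c x) ^ 1 * exp (d * norm (c x)) + norm (c x) ^ 2 * exp (d * norm (c x)))) \<omega>"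
    proof (rule M.avg_mono)
      fix x
      have "\<bar>A x - B x\<bar> \<le> \<bar>r * (\<theta> \<bullet> c x) - r * (ts n \<bullet> c x)\<bar> * exp (max (r * (\<theta> \<bullet> c x)) (r * (ts n \<bullet> c x)))"
        unfolding A_def B_def by (rule abs_exp_diff_le)
      also have "\<dots> \<le> (\<bar>r\<bar> * norm h * norm (c x)) * exp (d * norm (c x))"
      proof (intro mult_mono)
        have "r * (\<theta> \<bullet> c x) - r * (ts n \<bullet> c x) = (r *\<^sub>R h) \<bullet> c x"
          by (simp add: h_def inner_diff_left right_diff_distrib)
        then show "\<bar>r * (\<theta> \<bullet> c x) - r * (ts n \<bullet> c x)\<bar> \<le> \<bar>r\<bar> * norm h * norm (c x)"
          using Cauchy_Schwarz_ineq2[of "r *\<^sub>R h" "c x"] by simp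
      qed (use Ale[of x] in auto)
      finally have AB: "\<bar>A x - B x\<bar> \<le> (\<bar>r\<bar> * norm h * norm (c x)) * exp (d * norm (c x))" .
      have "norm (resid (ts n) x) \<le> 1 + norm (c x)"
        unfolding resid_def using norm_triangle_ineq4[of "c x" "cgf1 (ts n - \<theta>0)"] g by linarith
      then have "\<bar>A x - B x\<bar> * norm (resid (ts n) x) \<le> ((\<bar>r\<bar> * norm h * norm (c x)) * exp (d * norm (c x))) * (1 + norm (c x))"
        by (intro mult_mono AB) auto
      then show "norm ((A x - B x) *\<^sub>R resid (ts n) x)
          \<le> (\<bar>r\<bar> * norm h) * (norm (c x) ^ 1 * exp (d * norm (c x)) + norm (c x) ^ 2 * exp (d * norm (c x)))"
        unfolding norm_scaleR by (simp add: power2_eq_square algebra_simps)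
    qed
    also have "\<dots> = (\<bar>r\<bar> * (envelope 1 n \<omega> + envelope 2 n \<omega>)) * norm h"
      by (simp only: M.avg_cmult M.avg_add envelope_def mult_ac)
    finally show ?thesis .
  qed
  have "norm (\<Sigma> *v h - est n (ts n) \<omega>) \<le> norm (\<Sigma> *v h - D) + \<bar>1 - m\<bar> * norm D + norm Q"
    unfolding eq by (rule order_trans[OF norm_triangle_ineq add_right_mono[OF order_trans[OF norm_triangle_ineq]]]) simp
  also have "\<dots> \<le> e * norm h + (\<bar>r\<bar> * norm \<theta> * envelope 1 n \<omega>) * ((norm \<Sigma> + 1) * norm h)
      + (\<bar>r\<bar> * (envelope 1 n \<omega> + envelope 2 n \<omega>)) * norm h"
    using mle Dle by (intro add_mono lin' mult_mono Qle) (auto simp: envelope_nonneg)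
  finally show ?thesis by (simp add: r_def h_def algebra_simps)
qed

lemma est_linearization:
  assumes e: "e > 0"
  shows "\<forall>\<^sub>F p in F. norm (\<Sigma> *v (T (fst p) (snd p) - ts (fst p)) - est (fst p) (ts (fst p)) (snd p))
    \<le> e * norm (T (fst p) (snd p) - ts (fst p))"
proof -
  \<comment> \<open>Half of \<open>e\<close> is left for the empirical error \<open>k\<close>; the
    cap at 1 meets the condition \<open>e \<le> 1\<close> of \<open>est_expansion\<close>.\<close>
  define e' where "e' = min 1 (e / 2)"
  have e': "0 < e'" "e' \<le> 1" "e' \<le> e / 2" using e by (auto simp: e'_def)
  obtain \<delta> where \<delta>: "0 < \<delta>" "\<delta> \<le> d"
    "\<And>x y. norm x < \<delta> \<Longrightarrow> norm y < \<delta> \<Longrightarrow> norm (cgf1 x - cgf1 y - \<Sigma> *v (x - y)) \<le> e' * norm (x - y)"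
    using cgf1_strict_derivative[OF e'(1)] by blast
  have tsF: "((\<lambda>p. ts (fst p)) \<longlongrightarrow> \<theta>0) F"
    by (intro M.tendsto_prob_filter_deterministic ts_tendsto)
  have s1: "\<forall>\<^sub>F p in F. dist (T (fst p) (snd p)) \<theta>0 < \<delta>" and s2: "\<forall>\<^sub>F p in F. dist (ts (fst p)) \<theta>0 < \<delta>"
    using \<delta>(1) T_consistent tsF by (auto intro: tendstoD)
  have r1: "((\<lambda>p. (1 - q (fst p)) *\<^sub>R T (fst p) (snd p)) \<longlongrightarrow> 0 *\<^sub>R \<theta>0) F"
    and r2: "((\<lambda>p. (1 - q (fst p)) *\<^sub>R ts (fst p)) \<longlongrightarrow> 0 *\<^sub>R \<theta>0) F"
    by (intro tendsto_intros q1_tendsto T_consistent tsF)+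
  have b1: "\<forall>\<^sub>F p in F. norm ((1 - q (fst p)) *\<^sub>R T (fst p) (snd p)) < d"
    and b2: "\<forall>\<^sub>F p in F. norm ((1 - q (fst p)) *\<^sub>R ts (fst p)) < d"
    using tendstoD[OF r1 d_pos] tendstoD[OF r2 d_pos] by simp_all
  have g: "\<forall>\<^sub>F p in F. norm (cgf1 (ts (fst p) - \<theta>0)) \<le> 1"
    using filterlim_iff[THEN iffD1, OF M.filterlim_fst_prob_filter] eventually_cgf1_le[OF ts_tendsto q_lim] by auto
  define k where "k p = \<bar>1 - q (fst p)\<bar> * norm (T (fst p) (snd p)) * envelope 1 (fst p) (snd p) * (norm \<Sigma> + 1)
      + (\<bar>1 - q (fst p)\<bar> * envelope 1 (fst p) (snd p) + \<bar>1 - q (fst p)\<bar> * envelope 2 (fst p) (snd p))" for p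
  have q1: "((\<lambda>p. \<bar>1 - q (fst p)\<bar>) \<longlongrightarrow> 0) F" by (rule tendsto_rabs_zero[OF q1_tendsto])
  have "((\<lambda>p. \<bar>1 - q (fst p)\<bar> * norm (T (fst p) (snd p))) \<longlongrightarrow> 0 * norm \<theta>0) F"
    by (intro tendsto_intros q1 T_consistent)
  then have d1: "((\<lambda>p. \<bar>1 - q (fst p)\<bar> * norm (T (fst p) (snd p)) * envelope 1 (fst p) (snd p)) \<longlongrightarrow> 0) F"
    by (intro tendsto_mult_envelope) simp
  have "(k \<longlongrightarrow> 0 * (norm \<Sigma> + 1) + (0 + 0)) F"
    unfolding k_def[abs_def]
    by (intro tendsto_add tendsto_mult[OF d1 tendsto_const] tendsto_mult_envelope[OF q1])
  then have "\<forall>\<^sub>F p in F. k p < e / 2"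
    using e by (intro order_tendstoD(2)[where y="0 * (norm \<Sigma> + 1) + (0 + 0)"]) auto
  with eventually_MLqE s1 s2 b1 b2 g show ?thesis
  proof eventually_elim
    case (elim p)
    define n \<omega> where "n = fst p" and "\<omega> = snd p"
    note elim = elim[folded n_def \<omega>_def]
    have T0: "est n (T n \<omega>) \<omega> = 0"
      using elim \<delta>(2) by (intro est_MLqE) (auto simp: dist_norm)
    have lin: "norm (cgf1 (T n \<omega> - \<theta>0) - cgf1 (ts n - \<theta>0) - \<Sigma> *v (T n \<omega> - ts n)) \<le> e' * norm (T n \<omega> - ts n)"
      using \<delta>(3)[of "T n \<omega> - \<theta>0" "ts n - \<theta>0"] elim by (simp add: dist_norm)
    have "norm (\<Sigma> *v (T n \<omega> - ts n) - est n (ts n) \<omega>) \<le> (e' + \<bar>1 - q n\<bar> * norm (T n \<omega>) * envelope 1 n \<omega> * (norm \<Sigma> + 1)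
        + \<bar>1 - q n\<bar> * (envelope 1 n \<omega> + envelope 2 n \<omega>)) * norm (T n \<omega> - ts n)"
      using elim e' by (intro est_expansion T0 lin) auto
    also have "\<dots> = (e' + k p) * norm (T n \<omega> - ts n)"
      by (simp add: k_def n_def \<omega>_def algebra_simps)
    also have "\<dots> \<le> e * norm (T n \<omega> - ts n)"
      using elim e' by (intro mult_right_mono) auto
    finally show ?case by (simp add: n_def \<omega>_def)
  qed
qed

definition S :: "nat \<Rightarrow> 'w \<Rightarrow> real^'p" where "S n \<omega> = sqrt n *\<^sub>R cbar n \<omega>"

lemma S_measurable [measurable]: "S n \<in> borel_measurable M"
  unfolding S_def[abs_def] by measurable

lemma tendsto_mult_norm_S: "(r \<longlongrightarrow> 0) F \<Longrightarrow> ((\<lambda>p. r p * norm (S (fst p) (snd p))) \<longlongrightarrow> 0) F"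
  unfolding S_def by (rule tendsto_mult_norm_cbar)

text \<open>The linearization error is small only relative to \<open>h\<close>, whose size is
  unknown. Invertibility of \<open>\<Sigma>\<close> bounds \<open>h\<close> by \<open>g\<close>, so
  the error is small relative to \<open>g\<close>, and \<open>g\<close> is tight because it is close
  to \<open>S\<close>.\<close>

lemma T_asymptotically_linear:
  "((\<lambda>p. sqrt (real (fst p)) *\<^sub>R (T (fst p) (snd p) - ts (fst p)) - matrix_inv \<Sigma> *v S (fst p) (snd p)) \<longlongrightarrow> 0) F"
proof -
  have inv: "invertible \<Sigma>" by (rule sym_pos_def_invertible[OF sym_pos_def_\<Sigma>])
  define h where "h p = sqrt (real (fst p)) *\<^sub>R (T (fst p) (snd p) - ts (fst p))" for p
  define g where "g p = sqrt (real (fst p)) *\<^sub>R est (fst p) (ts (fst p)) (snd p)" for p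
  define K where "K = norm (matrix_inv \<Sigma>) + 1"
  have K: "K \<ge> 1" by (simp add: K_def)
  have hK: "norm (h p) \<le> K * norm (\<Sigma> *v h p)" for p
    using matrix_inv_bounded_below[OF inv, of "h p"] mult_right_mono[of "norm (matrix_inv \<Sigma>)" K "norm (\<Sigma> *v h p)"]
    by (simp add: K_def)
  have lin: "\<forall>\<^sub>F p in F. norm (\<Sigma> *v h p - g p) \<le> e * norm (h p)" if "e > 0" for e
    using est_linearization[OF that]
  proof eventually_elim
    case (elim p)
    have "norm (\<Sigma> *v h p - g p)
        = sqrt (real (fst p)) * norm (\<Sigma> *v (T (fst p) (snd p) - ts (fst p)) - est (fst p) (ts (fst p)) (snd p))"
      by (simp add: h_def g_def matrix_vector_mult_scaleR flip: scaleR_diff_right)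
    also have "\<dots> \<le> sqrt (real (fst p)) * (e * norm (T (fst p) (snd p) - ts (fst p)))"
      using elim by (intro mult_left_mono) auto
    finally show ?case by (simp add: h_def mult_ac)
  qed
  have lin2: "\<forall>\<^sub>F p in F. norm (\<Sigma> *v h p - g p) \<le> e * norm (g p)" if e: "e > 0" for e
  proof -
    \<comment> \<open>The bound \<open>1 / (2 * K)\<close> lets the term in
      \<open>norm (h p)\<close> be absorbed on the left; \<open>e / (2 * K)\<close> produces the
      final factor \<open>e\<close>.\<close>
    define e' where "e' = min (1 / (2 * K)) (e / (2 * K))"
    have e': "e' > 0" "K * e' \<le> 1 / 2" "2 * K * e' \<le> e"
      using e K by (auto simp: e'_def min_def field_simps)
    show ?thesis
      using lin[OF e'(1)]
    proof eventually_elim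
      case (elim p)
      have "norm (\<Sigma> *v h p) \<le> norm (g p) + e' * norm (h p)"
        using elim norm_triangle_ineq2[of "\<Sigma> *v h p" "g p"] by linarith
      then have "K * norm (\<Sigma> *v h p) \<le> K * (norm (g p) + e' * norm (h p))"
        using K by (intro mult_left_mono) auto
      then have "norm (h p) \<le> K * norm (g p) + (K * e') * norm (h p)"
        using hK[of p] by (simp add: algebra_simps)
      moreover have "(K * e') * norm (h p) \<le> 1 / 2 * norm (h p)"
        using e' by (intro mult_right_mono) auto
      ultimately have "norm (h p) \<le> 2 * K * norm (g p)" by simp
      then have "e' * norm (h p) \<le> e' * (2 * K * norm (g p))"
        using e' by (intro mult_left_mono) auto
      also have "\<dots> = (2 * K * e') * norm (g p)" by simp
      also have "\<dots> \<le> e * norm (g p)"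
        using e' by (intro mult_right_mono) auto
      finally show ?case using elim by linarith
    qed
  qed
  \<comment> \<open>The relative error as a random factor. Where \<open>g p = 0\<close> it is 0 by
    convention, and \<open>lin2\<close> makes the numerator vanish there too.\<close>
  define k where "k p = norm (\<Sigma> *v h p - g p) / norm (g p)" for p
  have k: "(k \<longlongrightarrow> 0) F"
  proof (rule tendstoI)
    fix e :: real assume e: "e > 0"
    then have "e / 2 > 0" by simp
    from lin2[OF this] show "\<forall>\<^sub>F p in F. dist (k p) 0 < e"
    proof eventually_elim
      case (elim p)
      then have "k p \<le> e / 2"
        using e by (cases "norm (g p) = 0") (auto simp: k_def divide_le_eq)
      moreover have "k p \<ge> 0" by (simp add: k_def)
      ultimately show ?case using e by simp
    qed
  qed
  have gS: "((\<lambda>p. g p - S (fst p) (snd p)) \<longlongrightarrow> 0) F"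
    using est_ts_tendsto by (simp add: g_def S_def)
  have lim: "((\<lambda>p. k p * norm (S (fst p) (snd p)) + k p * norm (g p - S (fst p) (snd p))) \<longlongrightarrow> 0) F"
    using tendsto_add[OF tendsto_mult_norm_S[OF k] tendsto_mult[OF k tendsto_norm_zero[OF gS]]] by simp
  have "((\<lambda>p. \<Sigma> *v h p - g p) \<longlongrightarrow> 0) F"
  proof (rule Lim_null_comparison[OF _ lim])
    show "\<forall>\<^sub>F p in F. norm (\<Sigma> *v h p - g p) \<le> k p * norm (S (fst p) (snd p)) + k p * norm (g p - S (fst p) (snd p))"
      using lin2[OF zero_less_one]
    proof eventually_elim
      case (elim p)
      have "norm (\<Sigma> *v h p - g p) = k p * norm (g p)"
        using elim by (cases "g p = 0") (auto simp: k_def)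
      also have "\<dots> \<le> k p * (norm (S (fst p) (snd p)) + norm (g p - S (fst p) (snd p)))"
        using norm_triangle_ineq[of "S (fst p) (snd p)" "g p - S (fst p) (snd p)"]
        by (intro mult_left_mono) (auto simp: k_def)
      finally show ?case by (simp add: algebra_simps)
    qed
  qed
  then have "((\<lambda>p. matrix_inv \<Sigma> *v ((\<Sigma> *v h p - g p) + (g p - S (fst p) (snd p)))) \<longlongrightarrow> matrix_inv \<Sigma> *v (0 + 0)) F"
    by (intro tendsto_matrix_vector_mult tendsto_const tendsto_add gS)
  then show ?thesis
    by (simp add: matrix_vector_mult_diff_distrib matrix_inv_mult_vector(1)[OF inv] h_def)
qed

subsection \<open>Asymptotic normality\<close>

definition V :: "nat \<Rightarrow> real^'p^'p" where "V n = V_seq ts q n"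
definition W :: "nat \<Rightarrow> real^'p^'p" where "W n = matrix_inv (spd_sqrt (V n))"
definition W0 :: "real^'p^'p" where "W0 = matrix_inv (spd_sqrt (matrix_inv \<Sigma>))"

lemma W_tendsto: "W \<longlonglongrightarrow> W0"
  unfolding W_def[abs_def] V_def[abs_def] W0_def by (rule inv_sqrt_V_tendsto[OF ts_tendsto q_lim])

definition Z :: "nat \<Rightarrow> 'w \<Rightarrow> real^'p" where
  "Z n \<omega> = sqrt n *\<^sub>R (W n *v (T n \<omega> - ts n))"

lemma Z_measurable [measurable]: "Z n \<in> borel_measurable M"
  unfolding Z_def[abs_def] by measurable

text \<open>Replacing \<open>W n\<close> by \<open>W0\<close> costs a deterministic null factor
  times the tight \<open>S\<close>.\<close>

lemma Z_asymptotically_linear: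
  "((\<lambda>p. Z (fst p) (snd p) - W0 *v (matrix_inv \<Sigma> *v S (fst p) (snd p))) \<longlongrightarrow> 0) F"
proof -
  have WF: "((\<lambda>p. W (fst p)) \<longlongrightarrow> W0) F"
    by (rule M.tendsto_prob_filter_deterministic[OF W_tendsto])
  have "((\<lambda>p. W (fst p) *v (sqrt (real (fst p)) *\<^sub>R (T (fst p) (snd p) - ts (fst p)) - matrix_inv \<Sigma> *v S (fst p) (snd p))) \<longlongrightarrow> W0 *v 0) F"
    by (intro tendsto_matrix_vector_mult WF T_asymptotically_linear)
  moreover have "((\<lambda>p. (W (fst p) - W0) *v (matrix_inv \<Sigma> *v S (fst p) (snd p))) \<longlongrightarrow> 0) F"
  proof (rule Lim_null_comparison)
    have "((\<lambda>p. norm (W (fst p) - W0) * norm (matrix_inv \<Sigma>)) \<longlongrightarrow> norm (W0 - W0) * norm (matrix_inv \<Sigma>)) F"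
      by (intro tendsto_intros WF)
    then show "((\<lambda>p. norm (W (fst p) - W0) * norm (matrix_inv \<Sigma>) * norm (S (fst p) (snd p))) \<longlongrightarrow> 0) F"
      by (intro tendsto_mult_norm_S) simp
    have "norm ((W (fst p) - W0) *v (matrix_inv \<Sigma> *v S (fst p) (snd p)))
        \<le> norm (W (fst p) - W0) * (norm (matrix_inv \<Sigma>) * norm (S (fst p) (snd p)))" for p
      by (intro order_trans[OF norm_matrix_vector_mult_le] mult_left_mono norm_matrix_vector_mult_le) auto
    then show "\<forall>\<^sub>F p in F. norm ((W (fst p) - W0) *v (matrix_inv \<Sigma> *v S (fst p) (snd p)))
        \<le> norm (W (fst p) - W0) * norm (matrix_inv \<Sigma>) * norm (S (fst p) (snd p))"
      by (simp add: mult_ac)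
  qed
  ultimately have "((\<lambda>p. W (fst p) *v (sqrt (real (fst p)) *\<^sub>R (T (fst p) (snd p) - ts (fst p)) - matrix_inv \<Sigma> *v S (fst p) (snd p))
      + (W (fst p) - W0) *v (matrix_inv \<Sigma> *v S (fst p) (snd p))) \<longlongrightarrow> W0 *v 0 + 0) F"
    by (rule tendsto_add)
  then show ?thesis
    by (simp add: Z_def matrix_vector_mult_diff_distrib matrix_vector_mult_diff_rdistrib matrix_vector_mult_scaleR)
qed

lemma Z_char_tendsto: "(\<lambda>n. \<integral>\<omega>. cis (t \<bullet> Z n \<omega>) \<partial>M) \<longlonglongrightarrow> of_real (exp (- (norm t)\<^sup>2 / 2))"
\<comment> \<open>The case \<open>t = 0\<close> is split off because
  \<open>central_limit_char\<close> asks for a positive variance.\<close>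
proof (cases "t = 0")
  case False
  define R where "R = spd_sqrt (matrix_inv \<Sigma>)"
  have inv: "invertible \<Sigma>" by (rule sym_pos_def_invertible[OF sym_pos_def_\<Sigma>])
  have spd: "sym_pos_def (matrix_inv \<Sigma>)" by (rule sym_pos_def_matrix_inv[OF sym_pos_def_\<Sigma>])
  have Rspd: "sym_pos_def R" and RR: "R ** R = matrix_inv \<Sigma>"
    unfolding R_def by (rule sym_pos_def_spd_sqrt[OF spd], rule spd_sqrt_square[OF spd])
  have Rinv: "invertible R" by (rule sym_pos_def_invertible[OF Rspd])
  have sym: "transpose (matrix_inv \<Sigma>) = matrix_inv \<Sigma>" "transpose W0 = W0" "transpose R = R"
    using spd sym_pos_def_matrix_inv[OF Rspd] Rspd by (simp_all add: sym_pos_def_def W0_def R_def)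
  \<comment> \<open>By symmetry of the matrices the limiting functional is
    \<open>a \<bullet> S\<close>. Since \<open>W0\<close> is the inverse of \<open>R\<close> and
    \<open>R ** R\<close> that of \<open>\<Sigma>\<close>, its variance
    \<open>a \<bullet> (\<Sigma> *v a)\<close> collapses to \<open>(norm t)\<^sup>2\<close>.\<close>
  define a where "a = matrix_inv \<Sigma> *v (W0 *v t)"
  have aS: "t \<bullet> (W0 *v (matrix_inv \<Sigma> *v S n \<omega>)) = sqrt n * M.avg n (\<lambda>x. a \<bullet> c x) \<omega>" for n \<omega>
  proof -
    have "t \<bullet> (W0 *v (matrix_inv \<Sigma> *v S n \<omega>)) = a \<bullet> S n \<omega>"
      unfolding a_def by (simp add: inner_symmetric_matrix sym)
    then show ?thesis by (simp add: S_def inner_cbar)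
  qed
  have \<Sigma>a: "\<Sigma> *v a = W0 *v t"
    by (simp add: a_def matrix_inv_mult_vector(2)[OF inv])
  have aR: "a = R *v (R *v (W0 *v t))"
    by (simp add: a_def flip: RR matrix_vector_mul_assoc)
  have "a \<bullet> (\<Sigma> *v a) = (R *v (W0 *v t)) \<bullet> (R *v (W0 *v t))"
    unfolding \<Sigma>a by (subst aR) (rule inner_symmetric_matrix[OF sym(3)])
  then have var: "(\<integral>x. (a \<bullet> c x)\<^sup>2 \<partial>P) = (norm t)\<^sup>2"
    by (simp add: \<Sigma>_quadratic W0_def R_def[symmetric] matrix_inv_mult_vector(2)[OF Rinv] power2_norm_eq_inner)
  have ic: "integrable P c" using integrable_mgf1[of 0] d_pos by simp
  have clt: "(\<lambda>n. \<integral>\<omega>. cis (sqrt n * M.avg n (\<lambda>x. a \<bullet> c x) \<omega>) \<partial>M) \<longlonglongrightarrow> of_real (exp (- (norm t)\<^sup>2 / 2))"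
    using ic False by (intro M.central_limit_char integrable_inner_square var) (auto simp: centred)
  have "((\<lambda>p. t \<bullet> (Z (fst p) (snd p) - W0 *v (matrix_inv \<Sigma> *v S (fst p) (snd p)))) \<longlongrightarrow> t \<bullet> 0) F"
    by (intro tendsto_intros Z_asymptotically_linear)
  then have "((\<lambda>(n, \<omega>). t \<bullet> Z n \<omega> - sqrt n * M.avg n (\<lambda>x. a \<bullet> c x) \<omega>) \<longlongrightarrow> 0) F"
    by (simp add: inner_diff_right aS case_prod_unfold)
  then have "(\<lambda>n. (\<integral>\<omega>. cis (t \<bullet> Z n \<omega>) \<partial>M) - (\<integral>\<omega>. cis (sqrt n * M.avg n (\<lambda>x. a \<bullet> c x) \<omega>) \<partial>M)) \<longlonglongrightarrow> 0"
    by (rule M.tendsto_expectation_cis_diff[rotated -1]) measurable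
  from tendsto_add[OF this clt] show ?thesis by simp
qed (simp add: M.prob_space)

theorem Z_normal: "conv_in_distribution M Z std_normal_vec"
  by (intro conv_in_distribution_std_normal_vecI Z_measurable Z_char_tendsto) (rule M.prob_space_axioms)

section \<open>Recentring at the true parameter\<close>

definition shift :: "nat \<Rightarrow> real^'p" where "shift n = sqrt n *\<^sub>R (W n *v (ts n - \<theta>0))"

lemma shifted_char: "(\<integral>\<omega>. cis (t \<bullet> (Z n \<omega> + shift n)) \<partial>M) = cis (t \<bullet> shift n) * (\<integral>\<omega>. cis (t \<bullet> Z n \<omega>) \<partial>M)"
proof -
  have "cis (t \<bullet> (Z n \<omega> + shift n)) = cis (t \<bullet> shift n) * cis (t \<bullet> Z n \<omega>)" for \<omega>
    by (simp add: cis_mult inner_add_right add.commute)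
  then show ?thesis by simp
qed

lemma shifted_normal_iff:
  "conv_in_distribution M (\<lambda>n \<omega>. Z n \<omega> + shift n) std_normal_vec \<longleftrightarrow> shift \<longlonglongrightarrow> 0"
proof
  assume "shift \<longlonglongrightarrow> 0"
  show "conv_in_distribution M (\<lambda>n \<omega>. Z n \<omega> + shift n) std_normal_vec"
  proof (rule conv_in_distribution_std_normal_vecI)
    fix t
    have "(\<lambda>n. cis (t \<bullet> shift n) * (\<integral>\<omega>. cis (t \<bullet> Z n \<omega>) \<partial>M)) \<longlonglongrightarrow> cis (t \<bullet> 0) * of_real (exp (- (norm t)\<^sup>2 / 2))"
      by (intro tendsto_intros Z_char_tendsto \<open>shift \<longlonglongrightarrow> 0\<close>)
    then show "(\<lambda>n. \<integral>\<omega>. cis (t \<bullet> (Z n \<omega> + shift n)) \<partial>M) \<longlonglongrightarrow> of_real (exp (- (norm t)\<^sup>2 / 2))"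
      by (simp add: shifted_char)
  next
    show "(\<lambda>\<omega>. Z n \<omega> + shift n) \<in> borel_measurable M" for n
      by (intro borel_measurable_add Z_measurable) simp
  qed (rule M.prob_space_axioms)
next
  assume conv: "conv_in_distribution M (\<lambda>n \<omega>. Z n \<omega> + shift n) std_normal_vec"
  interpret N: prob_space "std_normal_vec :: (real^'p) measure" by (rule prob_space_std_normal_vec)
  have cis1: "(\<lambda>n. cis (t \<bullet> shift n)) \<longlonglongrightarrow> 1" for t
  proof -
    define z :: complex where "z = of_real (exp (- (norm t)\<^sup>2 / 2))"
    define a where "a n = (\<integral>\<omega>. cis (t \<bullet> Z n \<omega>) \<partial>M)" for n
    have z: "z \<noteq> 0" by (simp add: z_def)
    have a: "a \<longlonglongrightarrow> z" unfolding a_def[abs_def] z_def by (rule Z_char_tendsto)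
    have "(\<lambda>n. \<integral>\<omega>. cis (t \<bullet> (Z n \<omega> + shift n)) \<partial>M) \<longlonglongrightarrow> z"
      unfolding z_def by (rule conv_in_distribution_char[OF borel_measurable_add[OF Z_measurable borel_measurable_const] M.prob_space_axioms conv])
    then have "(\<lambda>n. (cis (t \<bullet> shift n) * a n) / a n) \<longlonglongrightarrow> z / z"
      unfolding shifted_char a_def[symmetric] by (intro tendsto_divide a z)
    then have lim: "(\<lambda>n. (cis (t \<bullet> shift n) * a n) / a n) \<longlonglongrightarrow> 1" using z by simp
    have ev: "\<forall>\<^sub>F n in sequentially. a n \<noteq> 0" by (rule tendsto_imp_eventually_ne[OF a z])
    show ?thesis
      by (rule Lim_transform_eventually[OF lim]) (use ev in \<open>eventually_elim, simp\<close>)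
  qed
  \<comment> \<open>Averaging over a Gaussian \<open>t\<close> yields
    \<open>exp (- (norm (shift n))\<^sup>2 / 2)\<close>, whose convergence to 1 forces
    \<open>shift n\<close> to 0 and so also excludes an escape to infinity.\<close>
  have "(\<lambda>n. \<integral>t. cis (t \<bullet> shift n) \<partial>std_normal_vec) \<longlonglongrightarrow> (\<integral>t. 1 \<partial>(std_normal_vec :: (real^'p) measure))"
    by (rule integral_dominated_convergence[where w="\<lambda>_. 1"]) (auto simp: cis1)
  then have "(\<lambda>n. complex_of_real (exp (- (norm (shift n))\<^sup>2 / 2))) \<longlonglongrightarrow> complex_of_real 1"
    by (simp add: inner_commute[of _ "shift _"] char_std_normal_vec N.prob_space)
  then have "(\<lambda>n. exp (- (norm (shift n))\<^sup>2 / 2)) \<longlonglongrightarrow> 1"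
    unfolding tendsto_of_real_iff .
  then have "(\<lambda>n. ln (exp (- (norm (shift n))\<^sup>2 / 2))) \<longlonglongrightarrow> ln 1"
    by (intro tendsto_intros) auto
  then have "(\<lambda>n. sqrt (- 2 * (- (norm (shift n))\<^sup>2 / 2))) \<longlonglongrightarrow> sqrt (- 2 * 0)"
    by (intro tendsto_intros) simp
  then have "(\<lambda>n. norm (shift n)) \<longlonglongrightarrow> 0" by simp
  then show "shift \<longlonglongrightarrow> 0" by (rule tendsto_norm_zero_cancel)
qed

lemma ts_minus: "sqrt n *\<^sub>R (ts n - \<theta>0) = - ((sqrt n * (q n - 1)) / q n) *\<^sub>R \<theta>0"
proof -
  have "ts n - \<theta>0 = (1 / q n - 1) *\<^sub>R \<theta>0" by (simp add: ts_def scaleR_diff_left)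
  also have "1 / q n - 1 = - ((q n - 1) / q n)" using q_pos[of n] by (simp add: field_simps)
  finally show ?thesis by simp
qed

lemma shift_eq: "shift n = W n *v (sqrt n *\<^sub>R (ts n - \<theta>0))"
  by (simp add: shift_def matrix_vector_mult_scaleR)

lemma shift_tendsto_0:
  assumes "(\<lambda>n. sqrt n * (q n - 1)) \<longlonglongrightarrow> 0"
  shows "shift \<longlonglongrightarrow> 0"
proof -
  have "(\<lambda>n. W n *v (- ((sqrt n * (q n - 1)) / q n) *\<^sub>R \<theta>0)) \<longlonglongrightarrow> W0 *v (- (0 / 1) *\<^sub>R \<theta>0)"
    by (intro tendsto_matrix_vector_mult W_tendsto tendsto_intros assms q_lim) simp
  then show ?thesis by (simp add: shift_eq[abs_def] ts_minus del: scaleR_minus_left)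
qed

text \<open>Multiplying by the square root of \<open>V n\<close> eventually undoes the
  standardisation and leaves a multiple of \<open>\<theta>0\<close>, whose coefficient is recovered
  by dividing by \<open>norm \<theta>0\<close>.\<close>

lemma shift_tendsto_0_D:
  assumes "shift \<longlonglongrightarrow> 0" "\<theta>0 \<noteq> 0"
  shows "(\<lambda>n. sqrt n * (q n - 1)) \<longlonglongrightarrow> 0"
proof -
  define R where "R n = spd_sqrt (V n)" for n
  have "(\<lambda>n. R n *v shift n) \<longlonglongrightarrow> spd_sqrt (matrix_inv \<Sigma>) *v 0"
    unfolding R_def V_def by (intro tendsto_matrix_vector_mult spd_sqrt_V_tendsto ts_tendsto q_lim assms)
  then have lim: "(\<lambda>n. R n *v shift n) \<longlonglongrightarrow> 0" by simp
  have "\<forall>\<^sub>F n in sequentially. R n *v shift n = sqrt n *\<^sub>R (ts n - \<theta>0)"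
    using eventually_sym_pos_def_V_seq[OF ts_tendsto q_lim]
  proof eventually_elim
    case (elim n)
    then have "invertible (R n)"
      unfolding R_def V_def by (intro sym_pos_def_invertible sym_pos_def_spd_sqrt)
    then show ?case by (simp add: shift_eq W_def R_def[symmetric] matrix_inv_mult_vector(2))
  qed
  from Lim_transform_eventually[OF lim this]
  have "(\<lambda>n. (norm (sqrt n *\<^sub>R (ts n - \<theta>0)) / norm \<theta>0) * \<bar>q n\<bar>) \<longlonglongrightarrow> (norm (0 :: real^'p) / norm \<theta>0) * \<bar>1\<bar>"
    using assms(2) by (intro tendsto_intros q_lim) auto
  moreover have "(norm (sqrt n *\<^sub>R (ts n - \<theta>0)) / norm \<theta>0) * \<bar>q n\<bar> = \<bar>sqrt n * (q n - 1)\<bar>" for n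
    unfolding ts_minus using assms(2) q_pos[of n] by (simp add: abs_mult)
  ultimately have "(\<lambda>n. \<bar>sqrt n * (q n - 1)\<bar>) \<longlonglongrightarrow> 0" by simp
  then show ?thesis by (rule tendsto_rabs_zero_cancel)
qed

end

section \<open>Reduction of the theorem to the centred setting\<close>

lemma exp_norm_le_sum_exp_coords:
  fixes v :: "real^'p"
  assumes "\<rho> > 0"
  shows "exp (\<rho> / CARD('p) * norm v) \<le> (\<Sum>k\<in>UNIV. exp (\<rho> * v $ k) + exp (- \<rho> * v $ k))"
proof -
  \<comment> \<open>The norm is at most the sum of the absolute coordinates, so one coordinate
    carries the fraction \<open>1 / CARD('p)\<close>. Exponential integrals along the coordinate
    axes then control \<open>exp\<close> of the norm.\<close>
  have "\<exists>k. norm v / CARD('p) \<le> \<bar>v $ k\<bar>"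
  proof (rule ccontr)
    assume "\<not> (\<exists>k. norm v / CARD('p) \<le> \<bar>v $ k\<bar>)"
    then have "(\<Sum>k\<in>UNIV. \<bar>v $ k\<bar>) < (\<Sum>k\<in>(UNIV :: 'p set). norm v / CARD('p))"
      by (intro sum_strict_mono) (auto simp: not_le)
    then show False using norm_le_l1_cart[of v] by simp
  qed
  then obtain k where k: "norm v / CARD('p) \<le> \<bar>v $ k\<bar>" ..
  have "\<rho> / CARD('p) * norm v \<le> \<rho> * \<bar>v $ k\<bar>"
    using mult_left_mono[OF k, of \<rho>] assms by simp
  then have "exp (\<rho> / CARD('p) * norm v) \<le> exp (\<rho> * \<bar>v $ k\<bar>)" by simp
  also have "\<dots> \<le> exp (\<rho> * v $ k) + exp (- \<rho> * v $ k)"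
    by (cases "v $ k \<ge> 0") (simp_all add: abs_if)
  also have "\<dots> \<le> (\<Sum>k\<in>UNIV. exp (\<rho> * v $ k) + exp (- \<rho> * v $ k))"
    by (rule member_le_sum) auto
  finally show ?thesis .
qed

text \<open>For \<open>\<theta>0 = 0\<close> the surrogate equals \<open>\<theta>0\<close> for every
  \<open>q n\<close>; the two centrings coincide, and normality says nothing about the rate of
  \<open>q\<close>. The necessity half is therefore stated for
  \<open>\<theta>0 \<noteq> 0\<close>.\<close>

theorem theorem3p2:
  fixes \<mu> :: "'x measure" and b :: "'x \<Rightarrow> real^'p" and \<Theta> :: "(real^'p) set"
    and \<theta>0 :: "real^'p" and q :: "nat \<Rightarrow> real"
    and M :: "'w measure" and X :: "nat \<Rightarrow> 'w \<Rightarrow> 'x" and T :: "nat \<Rightarrow> 'w \<Rightarrow> real^'p"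
  defines "f \<equiv> expfam_density \<mu> b"
  defines "\<theta>s \<equiv> \<lambda>n. (1 / q n) *\<^sub>R \<theta>0"
  defines "V \<equiv> \<lambda>n. V_mat \<mu> f \<theta>0 (\<theta>s n) (q n)"
  defines "Z \<equiv> \<lambda>c n \<omega>. sqrt (real n) *\<^sub>R (matrix_inv (spd_sqrt (V n)) *v (T n \<omega> - c n))"
  assumes family: "exponential_family \<mu> b \<Theta>" and full_rank: "full_rank \<mu> b"
    and M: "prob_space M"
    and indep: "prob_space.indep_vars M (\<lambda>_. \<mu>) X UNIV"
    and dens: "\<And>i. distributed M \<mu> (X i) (\<lambda>x. ennreal (f x \<theta>0))"
    and A1: "\<And>n. q n > 0" "q \<longlonglongrightarrow> 1"
    and A2: "compact \<Theta>" "\<theta>0 \<in> interior \<Theta>"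
    and T_meas: "\<And>n. T n \<in> borel_measurable M"
    and T_MLqE: "\<And>n. n \<ge> 1 \<Longrightarrow> AE \<omega> in M. is_MLqE f \<Theta> (q n) n (\<lambda>i. X i \<omega>) (T n \<omega>)"
  shows "conv_in_distribution M (Z \<theta>s) std_normal_vec \<and>
    ((\<lambda>n. sqrt (real n) * (q n - 1)) \<longlonglongrightarrow> 0 \<longrightarrow>
       conv_in_distribution M (Z (\<lambda>_. \<theta>0)) std_normal_vec) \<and>
    (\<theta>0 \<noteq> 0 \<longrightarrow>
       conv_in_distribution M (Z (\<lambda>_. \<theta>0)) std_normal_vec \<longrightarrow>
       (\<lambda>n. sqrt (real n) * (q n - 1)) \<longlonglongrightarrow> 0)"
proof -
  define A where "A = log_partition \<mu> b"
  define P where "P = density \<mu> (\<lambda>x. ennreal (f x \<theta>0))"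
  have b [measurable]: "b \<in> borel_measurable \<mu>" using family by (simp add: exponential_family_def)
  have f: "f x \<theta> = exp (\<theta> \<bullet> b x - A \<theta>)" for x \<theta> by (simp add: f_def expfam_density_def A_def)
  have sets_P [measurable_cong]: "sets P = sets \<mu>" by (simp add: P_def)
  have distr_X: "distr M P (X i) = P" for i
    using dens[of i] unfolding distributed_def P_def by (simp cong: distr_cong)
  interpret M: prob_space M by (rule M)
  have Xm: "X i \<in> M \<rightarrow>\<^sub>M P" for i
    using dens[of i] by (simp add: distributed_def P_def)
  interpret P: prob_space P
    using M.prob_space_distr[OF Xm[of 0]] by (simp add: distr_X)
  \<comment> \<open>Change of base measure: the density at \<open>\<theta>0\<close> cancels the
    \<open>\<theta>0\<close> part of the tilt and leaves the constant
    \<open>exp (- A \<theta>0)\<close>.\<close>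
  have tilt: "integrable P (\<lambda>x. exp ((\<theta> - \<theta>0) \<bullet> b x)) \<longleftrightarrow> integrable \<mu> (\<lambda>x. exp (- A \<theta>0) * exp (\<theta> \<bullet> b x))"
    "(\<integral>x. exp ((\<theta> - \<theta>0) \<bullet> b x) \<partial>P) = exp (- A \<theta>0) * (\<integral>x. exp (\<theta> \<bullet> b x) \<partial>\<mu>)" for \<theta>
  proof -
    have eq: "f x \<theta>0 *\<^sub>R exp ((\<theta> - \<theta>0) \<bullet> b x) = exp (- A \<theta>0) * exp (\<theta> \<bullet> b x)" for x
      by (simp add: f mult_exp_exp inner_diff_left)
    show "integrable P (\<lambda>x. exp ((\<theta> - \<theta>0) \<bullet> b x)) \<longleftrightarrow> integrable \<mu> (\<lambda>x. exp (- A \<theta>0) * exp (\<theta> \<bullet> b x))"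
    proof -
      have "integrable P (\<lambda>x. exp ((\<theta> - \<theta>0) \<bullet> b x))
          \<longleftrightarrow> integrable \<mu> (\<lambda>x. f x \<theta>0 *\<^sub>R exp ((\<theta> - \<theta>0) \<bullet> b x))"
        unfolding P_def by (rule integrable_density) (auto simp: f)
      then show ?thesis by (simp only: eq)
    qed
    have "(\<integral>x. exp ((\<theta> - \<theta>0) \<bullet> b x) \<partial>P) = (\<integral>x. f x \<theta>0 *\<^sub>R exp ((\<theta> - \<theta>0) \<bullet> b x) \<partial>\<mu>)"
      unfolding P_def by (subst integral_density) (auto simp: f)
    then show "(\<integral>x. exp ((\<theta> - \<theta>0) \<bullet> b x) \<partial>P) = exp (- A \<theta>0) * (\<integral>x. exp (\<theta> \<bullet> b x) \<partial>\<mu>)"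
      by (simp only: eq integral_mult_right_zero)
  qed
  have intP: "integrable P (\<lambda>x. exp ((\<theta> - \<theta>0) \<bullet> b x))" if "\<theta> \<in> \<Theta>" for \<theta>
    unfolding tilt using family that by (simp add: exponential_family_def)
  obtain \<rho> where \<rho>: "\<rho> > 0" "cball \<theta>0 \<rho> \<subseteq> \<Theta>"
    using A2(2) by (auto simp: mem_interior_cball)
  \<comment> \<open>Chosen so that \<open>2 * d = \<rho> / CARD('p)\<close>, the exponent in
    \<open>exp_norm_le_sum_exp_coords\<close>.\<close>
  define d where "d = \<rho> / (2 * CARD('p))"
  have d: "d > 0" "d \<le> \<rho>" "2 * d = \<rho> / CARD('p)"
  proof -
    have p: "real CARD('p) \<ge> 1" by (simp add: Suc_leI)
    show "d > 0" "2 * d = \<rho> / CARD('p)" using \<rho> p by (simp_all add: d_def)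
    have "1 \<le> 2 * real CARD('p)" using p by linarith
    then have "\<rho> * 1 \<le> \<rho> * (2 * real CARD('p))" using \<rho>(1) by (intro mult_left_mono) auto
    then show "d \<le> \<rho>" by (simp add: d_def divide_le_eq)
  qed
  \<comment> \<open>Moving \<open>\<theta>0\<close> by \<open>\<rho>\<close> along an axis stays in
    the closed ball, so integrability on \<open>\<Theta>\<close> applies at these finitely many
    points.\<close>
  have int_coord: "integrable P (\<lambda>x. exp (r * b x $ k))" if "\<bar>r\<bar> = \<rho>" for r k
  proof -
    have "\<theta>0 + r *\<^sub>R axis k 1 \<in> \<Theta>"
      using \<rho> that by (auto simp: dist_norm norm_axis_1 intro!: subsetD[OF \<rho>(2)])
    from intP[OF this] show ?thesis by (simp add: inner_axis')
  qed
  have int_b: "integrable P (\<lambda>x. exp (2 * d * norm (b x)))"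
  proof (rule Bochner_Integration.integrable_bound)
    show "integrable P (\<lambda>x. \<Sum>k\<in>UNIV. exp (\<rho> * b x $ k) + exp (- \<rho> * b x $ k))"
      using \<rho>(1) by (intro Bochner_Integration.integrable_sum Bochner_Integration.integrable_add int_coord) auto
    have le: "exp (2 * d * norm (b x)) \<le> (\<Sum>k\<in>UNIV. exp (\<rho> * b x $ k) + exp (- \<rho> * b x $ k))" for x
      using exp_norm_le_sum_exp_coords[OF \<rho>(1), of "b x"] by (simp add: d(3))
    then show "AE x in P. norm (exp (2 * d * norm (b x))) \<le> norm (\<Sum>k\<in>UNIV. exp (\<rho> * b x $ k) + exp (- \<rho> * b x $ k))"
      unfolding real_norm_def abs_exp_cancel by (intro AE_I2 order_trans[OF le abs_ge_self])
  qed measurable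
  have int_b1: "integrable P b"
  proof (rule Bochner_Integration.integrable_bound)
    show "integrable P (\<lambda>x. (1 / (2 * d)) * exp (2 * d * norm (b x)))"
      by (intro integrable_mult_right int_b)
    have "norm (b x) \<le> (1 / (2 * d)) * exp (2 * d * norm (b x))" for x
    proof -
      have "2 * d * norm (b x) \<le> exp (2 * d * norm (b x))"
        using exp_ge_add_one_self[of "2 * d * norm (b x)"] by linarith
      then have "(1 / (2 * d)) * (2 * d * norm (b x)) \<le> (1 / (2 * d)) * exp (2 * d * norm (b x))"
        using d(1) by (intro mult_left_mono) auto
      then show ?thesis using d(1) by simp
    qed
    then show "AE x in P. norm (b x) \<le> norm ((1 / (2 * d)) * exp (2 * d * norm (b x)))"
      using d(1) by simp
  qed measurable
  define m where "m = (\<integral>x. b x \<partial>P)"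
  define c where "c x = b x - m" for x
  interpret c: exp_moments P c d
  proof
    show "c \<in> borel_measurable P" unfolding c_def[abs_def] by measurable
    show "integrable P (\<lambda>x. exp (2 * d * norm (c x)))"
    proof (rule Bochner_Integration.integrable_bound)
      show "integrable P (\<lambda>x. exp (2 * d * norm m) * exp (2 * d * norm (b x)))"
        by (intro integrable_mult_right int_b)
      have "exp (2 * d * norm (c x)) \<le> exp (2 * d * norm m) * exp (2 * d * norm (b x))" for x
      proof -
        have "2 * d * norm (c x) \<le> 2 * d * (norm (b x) + norm m)"
          unfolding c_def using d(1) by (intro mult_left_mono norm_triangle_ineq4) auto
        then show ?thesis by (simp add: mult_exp_exp algebra_simps)
      qed
      then show "AE x in P. norm (exp (2 * d * norm (c x))) \<le> norm (exp (2 * d * norm m) * exp (2 * d * norm (b x)))"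
        by simp
    qed (simp add: c_def)
  qed (rule d)
  have tilt_c: "integrable P (\<lambda>x. exp ((\<theta> - \<theta>0) \<bullet> c x))"
    "c.mgf (\<theta> - \<theta>0) = exp (A \<theta> - A \<theta>0 - (\<theta> - \<theta>0) \<bullet> m)" if \<theta>: "\<theta> \<in> \<Theta>" for \<theta>
  proof -
    have eq: "exp ((\<theta> - \<theta>0) \<bullet> c x) = exp (- ((\<theta> - \<theta>0) \<bullet> m)) * exp ((\<theta> - \<theta>0) \<bullet> b x)" for x
      by (simp add: c_def mult_exp_exp inner_diff_right)
    show i: "integrable P (\<lambda>x. exp ((\<theta> - \<theta>0) \<bullet> c x))"
      unfolding eq by (intro integrable_mult_right intP \<theta>)
    have mgf: "c.mgf (\<theta> - \<theta>0) = exp (- ((\<theta> - \<theta>0) \<bullet> m)) * (exp (- A \<theta>0) * (\<integral>x. exp (\<theta> \<bullet> b x) \<partial>\<mu>))"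
      unfolding c.mgf_def eq by (simp only: integral_mult_right_zero tilt)
    \<comment> \<open>Positivity excludes the conventional value of \<open>ln\<close> at 0, so
      \<open>exp (A \<theta>)\<close> really is the integral.\<close>
    then have "(\<integral>x. exp (\<theta> \<bullet> b x) \<partial>\<mu>) > 0"
      using c.mgf_pos[OF i] by (simp add: zero_less_mult_iff)
    then have "(\<integral>x. exp (\<theta> \<bullet> b x) \<partial>\<mu>) = exp (A \<theta>)"
      by (simp add: A_def log_partition_def)
    then show "c.mgf (\<theta> - \<theta>0) = exp (A \<theta> - A \<theta>0 - (\<theta> - \<theta>0) \<bullet> m)"
      by (simp add: mgf mult_exp_exp)
  qed
  \<comment> \<open>The offset completes \<open>ln (mgf (\<theta> - \<theta>0))\<close> to
    \<open>A \<theta> - \<theta> \<bullet> m\<close>, the normaliser belonging to the centred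
    statistic.\<close>
  interpret S: mlqe_setup P c d f \<Theta> \<theta>0 "A \<theta>0 - \<theta>0 \<bullet> m" M X q T
  proof unfold_locales
    show "(\<integral>x. c x \<partial>P) = 0"
      unfolding c_def using int_b1 by (simp add: m_def P.prob_space)
    show "v = 0" if "AE x in P. v \<bullet> c x = 0" for v
    proof -
      \<comment> \<open>The density is strictly positive, so \<open>P\<close> and
        \<open>\<mu>\<close> have the same null sets and full rank passes to the centred
        statistic.\<close>
      have "AE x in \<mu>. v \<bullet> b x + - (v \<bullet> m) = 0"
        using that unfolding P_def by (simp add: AE_density f c_def inner_diff_right)
      then show ?thesis using full_rank unfolding full_rank_def by blast
    qed
    show "ball \<theta>0 d \<subseteq> \<Theta>" using \<rho>(2) d(2) by (auto intro!: subsetD[OF \<rho>(2)])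
    show "f x \<theta> = exp (\<theta> \<bullet> c x - (A \<theta>0 - \<theta>0 \<bullet> m + ln (c.mgf (\<theta> - \<theta>0))))" if "\<theta> \<in> \<Theta>" for x \<theta>
      by (simp add: tilt_c[OF that] f c_def inner_diff_left inner_diff_right)
    show "M.indep_vars (\<lambda>_. P) X UNIV"
      using indep unfolding M.indep_vars_def2 by (simp add: sets_P Xm)
  qed (use tilt_c A1 A2 T_meas T_MLqE distr_X in auto)
  have V: "V n = S.V n" for n
    unfolding V_def V_mat_def K_mat_def J_mat_def S.V_def S.V_seq_def[OF S.ts_tendsto A1(2)]
      S.J_seq_def[OF S.ts_tendsto A1(2)] S.K_seq_def[OF S.ts_tendsto A1(2)]
      S.ts_def \<theta>s_def
    unfolding P_def ..
  have Z1: "Z \<theta>s = S.Z"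
    by (simp add: fun_eq_iff Z_def S.Z_def S.W_def V \<theta>s_def S.ts_def)
  have Z2: "Z (\<lambda>_. \<theta>0) = (\<lambda>n \<omega>. S.Z n \<omega> + S.shift n)"
    by (simp add: fun_eq_iff Z_def S.Z_def S.W_def V S.shift_def
        flip: scaleR_add_right matrix_vector_right_distrib)
  show ?thesis
    unfolding Z1 Z2 S.shifted_normal_iff
    using S.Z_normal S.shift_tendsto_0 S.shift_tendsto_0_D by blast
qed

end
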